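(* Let $\mathcal{H}:[\sqrt2,2]\to\mathbb{R}$ be the normalized fair entropy function of the tent family, and let $\sqrt2=\mathbbm{a}_2<\mathbbm{a}_3<\cdots$ be the increasing sequence of parameters, converging to $2$, defined in the context. For $r\ge 2$ and $b\in[\sqrt2,2]$ put $$\alpha(r,b):=\frac{(r-1)\log 2}{r\log b}.$$ Then the following hold for each integer $r\ge 2$. (1) For every $b$ with $\mathbbm{a}_r<b\le 2$, $\mathcal{H}$ is Hölder continuous on $[\mathbbm{a}_r,b]$ with Hölder exponent $\alpha(r,b)$. In particular, $\mathcal{H}$ is $\frac12$-Hölder on $[\sqrt2,2]$. (2) These exponents are optimal in the following sense: for any subinterval $J$ of $[\sqrt2,2]$ of positive length with $b=\sup J\le \mathbbm{a}_{r+1}$ and any $\alpha>\alpha(r,b)$, $\mathcal{H}$ is not $\alpha$-Hölder continuous on $J$.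
   Context: Tent maps: for $a\in[\sqrt2,2]$ let $I_a=[1-a,1]$ and $f_a:I_a\to I_a$, $f_a(x)=1-a|x|$, with turning point $c=0$. Put $c_n(a)=f_a^n(0)$ (so $c_0=0$, $c_1=1$, $c_2(a)=1-a$) and $\hat c_2(a)=a-1=-c_2(a)$. Fair measure: let $j_a(x)=\#f_a^{-1}(f_a(x))$, i.e. $j_a(x)=2$ for $x\in[c_2(a),\hat c_2(a)]\setminus\{0\}$ and $j_a(x)=1$ for $x\in\{0\}\cup(\hat c_2(a),1]$. The fair measure $\mu_a$ of $f_a$ is the unique atomless $f_a$-invariant Borel probability measure on $I_a$ such that $\mu_a(f_aE)=\int_E j_a\,d\mu_a$ for every Borel set $E\subset I_a$ on which $f_a$ is injective (existence and uniqueness are known). The fair entropy is the measure-theoretic entropy $h_{\mu_a}(f_a)$, and $\mathcal{H}(a):=\dfrac{h_{\mu_a}(f_a)}{2\log 2}$. Parameters $\mathbbm{a}_r$: for $r\ge2$, $\mathbbm{a}_r$ is the unique parameter $a\in[\sqrt2,2]$ with $c_2(a)<c_3(a)<\cdots<c_r(a)<0<c_{r+1}(a)=\hat c_2(a)$. One has $\mathbbm{a}_2=\sqrt2$, and $(\mathbbm{a}_r)$ is strictly increasing with limit $2$. *)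

theory Defs
  imports "HOL-Probability.Probability"
begin

definition partition_entropy :: "'a measure \<Rightarrow> 'a set set \<Rightarrow> real" where
  "partition_entropy M \<xi> = - (\<Sum>A\<in>\<xi>. measure M A * ln (measure M A))"

text \<open>The refinement \<open>\<Or>\<^bsub>i<n\<^esub> f\<^bsup>-i\<^esup> \<xi>\<close> of a partition of the space of \<open>M\<close>.\<close>

definition dynamical_refinement ::
    "'a measure \<Rightarrow> ('a \<Rightarrow> 'a) \<Rightarrow> 'a set set \<Rightarrow> nat \<Rightarrow> 'a set set" where
  "dynamical_refinement M f \<xi> n =
     common_refinement ((\<lambda>i. (\<lambda>A. (f ^^ i) -` A \<inter> space M) ` \<xi>) ` {..<n})"

text \<open>The limit exists by subadditivity if \<open>f\<close> preserves the probability measure \<open>M\<close>;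
  the supremum is over all finite measurable partitions and may be infinite.\<close>

definition measure_entropy :: "'a measure \<Rightarrow> ('a \<Rightarrow> 'a) \<Rightarrow> ereal" where
  "measure_entropy M f =
     (SUP \<xi>\<in>{\<xi>. finite \<xi> \<and> partition_on (space M) \<xi> \<and> \<xi> \<subseteq> sets M}.
        ereal (lim (\<lambda>n. partition_entropy M (dynamical_refinement M f \<xi> n) / real n)))"

definition tent_interval :: "real \<Rightarrow> real set" where
  "tent_interval a = {1 - a..1}"

definition tent :: "real \<Rightarrow> real \<Rightarrow> real" where
  "tent a x = 1 - a * \<bar>x\<bar>"

definition turning_orbit :: "real \<Rightarrow> nat \<Rightarrow> real" where
  "turning_orbit a n = (tent a ^^ n) 0"

definition preimage_count :: "real \<Rightarrow> real \<Rightarrow> nat" where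
  "preimage_count a x = card {y \<in> tent_interval a. tent a y = tent a x}"

definition is_fair_measure :: "real \<Rightarrow> real measure \<Rightarrow> bool" where
  "is_fair_measure a M \<longleftrightarrow>
     prob_space M \<and>
     sets M = sets (restrict_space borel (tent_interval a)) \<and>
     (\<forall>x\<in>tent_interval a. emeasure M {x} = 0) \<and>
     (\<forall>E\<in>sets M. emeasure M (tent a -` E \<inter> tent_interval a) = emeasure M E) \<and>
     (\<forall>E\<in>sets M. inj_on (tent a) E \<longrightarrow>
        emeasure M (tent a ` E) = (\<integral>\<^sup>+x\<in>E. of_nat (preimage_count a x) \<partial>M))"

definition fair_measure :: "real \<Rightarrow> real measure" where
  "fair_measure a = (THE M. is_fair_measure a M)"

definition normalized_fair_entropy :: "real \<Rightarrow> real" where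
  "normalized_fair_entropy a =
     real_of_ereal (measure_entropy (fair_measure a) (tent a)) / (2 * ln 2)"

text \<open>The parameter with \<open>c\<^sub>2 < c\<^sub>3 < \<dots> < c\<^sub>r < 0 < c\<^bsub>r+1\<^esub> = - c\<^sub>2\<close>,
  where \<open>c\<^sub>n\<close> is the turning orbit.  It is only meant for \<open>r \<ge> 2\<close>.\<close>

definition special_param :: "nat \<Rightarrow> real" where
  "special_param r = (THE a. a \<in> {sqrt 2..2} \<and>
     (\<forall>i\<in>{2..<r}. turning_orbit a i < turning_orbit a (Suc i)) \<and>
     turning_orbit a r < 0 \<and> 0 < turning_orbit a (Suc r) \<and>
     turning_orbit a (Suc r) = - turning_orbit a 2)"

definition holder_exponent :: "nat \<Rightarrow> real \<Rightarrow> real" where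
  "holder_exponent r b = (real r - 1) * ln 2 / (real r * ln b)"

text \<open>No upper bound on the exponent is imposed.\<close>

definition holder_on ::
    "real \<Rightarrow> 'a::metric_space set \<Rightarrow> ('a \<Rightarrow> 'b::metric_space) \<Rightarrow> bool" where
  "holder_on \<alpha> S f \<longleftrightarrow>
     0 < \<alpha> \<and> (\<exists>C. \<forall>x\<in>S. \<forall>y\<in>S. dist (f x) (f y) \<le> C * dist x y powr \<alpha>)"

end

theory Submission
  imports Defs
begin

text \<open>The distribution function \<open>F\<close> of the fair measure satisfies a functional equation in which the only
  unknown constant is \<open>F 0\<close>, and by counting preimages the normalized fair entropy is exactly \<open>F 0\<close>.
  Each point with two preimages halves increments of \<open>F\<close>, while the map expands by \<open>a\<close>, and an orbit returns to
  the region with a single preimage at most once in \<open>r\<close> steps; this is the Hoelder exponent of \<open>F\<close>.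
  The functional equations of two parameters differ by the oscillation of \<open>F\<close> at the scale of their
  distance, so the entropy inherits the exponent.

  For optimality, transversality of the turning orbits gives a parameter at which \<open>0\<close> falls onto a point of
  period \<open>r\<close> that has a single preimage exactly once per period.  A nearby parameter at distance \<open>\<delta>\<close> follows
  this cycle for about \<open>ln (1 / \<delta>) / (r ln b)\<close> periods until the orbits are macroscopically apart.  The
  difference of the distribution functions grows by at most \<open>2\<^bsup>r-1\<^esup>\<close> per period, so that the
  difference of the entropies cannot be much smaller than \<open>\<delta>\<close> to the claimed exponent.\<close>

section \<open>The distribution function of the fair measure\<close>

text \<open>The entropy is \<open>F 0\<close> because each step adds \<open>ln 2\<close> of
  information exactly on the region \<open>[1 - a, a - 1]\<close> with two preimages, and its mass
  is \<open>F (a - 1) = 2 * F 0\<close>. The obstacle to the exponent is the turning point. Cutting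
  an interval there costs a factor \<open>lam = 2 powr (1 / r)\<close>, by concavity of the power,
  and an orbit may force such cuts again and again. The orbit of 0 repays them: of its points with
  indices 0 to r only the one with index 1 fails to halve, which leaves a surplus of one factor
  \<open>lam\<close> after r + 1 steps. One more halving, or one more cut, provides a second factor,
  and this makes the estimates close up. The second factor is in danger only when the point with
  index r + 1 is close to \<open>a - 1\<close>, that is, when a is close to
  \<open>special_param r\<close>. There a is definitely smaller than b, and this slack accumulates:
  at \<open>special_param r\<close> itself the turning orbit is preperiodic and avoids 0, so nearby
  orbits make many steps without being cut.\<close>

definition fair_cdf :: "real \<Rightarrow> (real \<Rightarrow> real) \<Rightarrow> bool" where
  "fair_cdf a F \<longleftrightarrow>
     mono_on {1 - a..1} F \<and> continuous_on {1 - a..1} F \<and> F (1 - a) = 0 \<and> F 1 = 1 \<and>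
     (\<forall>x\<in>{1 - a..0}. F (tent a x) = 1 - 2 * F 0 + 2 * F x) \<and>
     (\<forall>x\<in>{0..a - 1}. F (tent a x) = 1 + 2 * F 0 - 2 * F x) \<and>
     (\<forall>x\<in>{a - 1..1}. F (tent a x) = 1 - F x)"

locale tent_param =
  fixes a :: real
  assumes a_ge: "sqrt 2 \<le> a" and a_le: "a \<le> 2"
begin

lemma a_sq: "2 \<le> a\<^sup>2"
  using power_mono[OF a_ge, of 2] by simp

lemma a_gt: "1.414 < a"
proof -
  have "(1.414::real) < sqrt 2" by (rule real_less_rsqrt) (simp add: power2_eq_square)
  then show ?thesis using a_ge by linarith
qed

lemma tent_mem: "x \<in> {1 - a..1} \<Longrightarrow> tent a x \<in> {1 - a..1}"
proof -
  assume "x \<in> {1 - a..1}"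
  then have "\<bar>x\<bar> \<le> 1" using a_le by auto
  then have "a * \<bar>x\<bar> \<le> a * 1" using a_gt by (intro mult_left_mono) auto
  moreover have "0 \<le> a * \<bar>x\<bar>" using a_gt by simp
  ultimately show ?thesis by (simp add: tent_def)
qed

lemma funpow_tent_mem: "x \<in> {1 - a..1} \<Longrightarrow> (tent a ^^ n) x \<in> {1 - a..1}"
  by (induction n) (use tent_mem in auto)

text \<open>The second bound is \<open>a\<^sup>2 \<ge> 2\<close>. It sends the region with a single
  preimage into \<open>[1 - a, a - 1]\<close>, so that after a step without halving the next step
  halves.\<close>

lemma c3_bounds: "1 - a \<le> 1 - a * (a - 1)" "1 - a * (a - 1) \<le> a - 1"
proof -
  have "a * (a - 1) \<le> a * 1" using a_gt a_le by (intro mult_left_mono) auto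
  then show "1 - a \<le> 1 - a * (a - 1)" by simp
  show "1 - a * (a - 1) \<le> a - 1" using a_sq by (simp add: algebra_simps power2_eq_square)
qed

lemma tent_high: "a - 1 \<le> x \<Longrightarrow> x \<le> 1 \<Longrightarrow> tent a x \<in> {1 - a..1 - a * (a - 1)}"
proof -
  assume "a - 1 \<le> x" "x \<le> 1"
  then have "a * (a - 1) \<le> a * x" "a * x \<le> a * 1" using a_gt by (intro mult_left_mono; simp)+
  then show ?thesis using \<open>a - 1 \<le> x\<close> a_gt by (simp add: tent_def)
qed

lemma tent_high_mid: "a - 1 \<le> x \<Longrightarrow> x \<le> 1 \<Longrightarrow> \<bar>tent a x\<bar> \<le> a - 1"
  using tent_high[of x] c3_bounds by auto

lemma tent_lipschitz: "\<bar>tent a x - tent a y\<bar> \<le> 2 * \<bar>x - y\<bar>"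
proof -
  have "\<bar>tent a x - tent a y\<bar> = a * \<bar>\<bar>x\<bar> - \<bar>y\<bar>\<bar>"
    using a_gt by (simp add: tent_def abs_mult flip: right_diff_distrib)
  also have "\<dots> \<le> 2 * \<bar>x - y\<bar>" using a_le a_gt by (intro mult_mono) auto
  finally show ?thesis .
qed

end

text \<open>An abstract form of the difference of two solutions of the functional equation along an
  orbit: \<open>t\<close> is the difference of their values at the turning point, and \<open>P n\<close> says that
  the \<open>n\<close>-th point of the orbit lies in the region with two preimages.\<close>

lemma orbit_difference_bound:
  fixes D :: "nat \<Rightarrow> real" and e t B :: real
  assumes bd: "\<And>n. \<bar>D n\<bar> \<le> B"
    and mid: "\<And>n. P n \<Longrightarrow> \<exists>s. \<bar>s\<bar> \<le> 1 \<and> \<bar>D n - t - s / 2 * D (Suc n)\<bar> \<le> e"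
    and high: "\<And>n. \<not> P n \<Longrightarrow> P (Suc n) \<and> \<bar>D n\<bar> \<le> \<bar>D (Suc n)\<bar> + e"
    and e: "0 \<le> e"
  shows "\<bar>D n\<bar> \<le> 2 * \<bar>t\<bar> + 4 * e"
proof -
  define S where "S = (SUP n. \<bar>D n\<bar>)"
  have bdd: "bdd_above (range (\<lambda>n. \<bar>D n\<bar>))" using bd by (auto simp: bdd_above_def)
  have le: "\<bar>D n\<bar> \<le> S" for n unfolding S_def by (rule cSUP_upper[OF _ bdd]) simp
  have m: "\<bar>D n\<bar> \<le> \<bar>t\<bar> + S / 2 + e" if Pn: "P n" for n
  proof -
    obtain s where s: "\<bar>s\<bar> \<le> 1" "\<bar>D n - t - s / 2 * D (Suc n)\<bar> \<le> e" using mid[OF Pn] by blast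
    have "\<bar>s / 2 * D (Suc n)\<bar> \<le> (1 / 2) * S"
      unfolding abs_mult using s(1) le[of "Suc n"] by (intro mult_mono) auto
    then show ?thesis using s(2) by linarith
  qed
  \<comment> \<open>An index outside P is passed on to the next one, which lies in P, at the price
    of one more e. Taking suprema gives \<open>S \<le> \<bar>t\<bar> + S / 2 + 2 * e\<close>, a
    contraction by 1/2.\<close>
  have "\<bar>D n\<bar> \<le> \<bar>t\<bar> + S / 2 + 2 * e" for n
  proof (cases "P n")
    case True then show ?thesis using m[of n] e by linarith
  next
    case False then show ?thesis using high[OF False] m[of "Suc n"] by linarith
  qed
  then have "S \<le> \<bar>t\<bar> + S / 2 + 2 * e" unfolding S_def by (intro cSUP_least) auto
  then show ?thesis using le[of n] by linarith
qed

text \<open>The orbit starts where the difference vanishes. Up to multiples of e, the first step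
  says \<open>D 1 = - 2 * t\<close> and the second says that \<open>D 1\<close> differs from t by at
  most \<open>\<bar>t\<bar>\<close>. Both can hold only if t is itself of order e.\<close>

lemma orbit_parameter_bound:
  fixes D :: "nat \<Rightarrow> real" and e t B :: real
  assumes bd: "\<And>n. \<bar>D n\<bar> \<le> B"
    and mid: "\<And>n. P n \<Longrightarrow> \<exists>s. \<bar>s\<bar> \<le> 1 \<and> \<bar>D n - t - s / 2 * D (Suc n)\<bar> \<le> e"
    and high: "\<And>n. \<not> P n \<Longrightarrow> P (Suc n) \<and> \<bar>D n\<bar> \<le> \<bar>D (Suc n)\<bar> + e"
    and e: "0 \<le> e"
    and D0: "D 0 = 0" "\<bar>D 0 - t - D 1 / 2\<bar> \<le> e" and P1: "P 1"
  shows "\<bar>t\<bar> \<le> 5 / 2 * e"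
proof -
  obtain s where s: "\<bar>s\<bar> \<le> 1" "\<bar>D 1 - t - s / 2 * D 2\<bar> \<le> e"
    using mid[OF P1] by (auto simp: numeral_2_eq_2)
  have "\<bar>D 2\<bar> \<le> 2 * \<bar>t\<bar> + 4 * e"
    by (rule orbit_difference_bound[where P = P, OF bd _ _ e]) (use mid high in auto)
  then have "\<bar>s / 2 * D 2\<bar> \<le> (1 / 2) * (2 * \<bar>t\<bar> + 4 * e)"
    unfolding abs_mult using s(1) by (intro mult_mono) auto
  moreover define y where "y = s / 2 * D 2"
  ultimately have y: "\<bar>y\<bar> \<le> \<bar>t\<bar> + 2 * e" by simp
  have "\<bar>D 1 - t - y\<bar> \<le> e" "\<bar>t + D 1 / 2\<bar> \<le> e" using D0 s(2) by (auto simp: y_def)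
  then have "\<bar>t\<bar> * 3 \<le> \<bar>y\<bar> + 3 * e" by linarith
  then show ?thesis using y by linarith
qed

section \<open>Solutions of the functional equation and their dependence on the parameter\<close>

locale tent_cdf = tent_param +
  fixes F :: "real \<Rightarrow> real"
  assumes cdf: "fair_cdf a F"
begin

lemma F_mono: "1 - a \<le> x \<Longrightarrow> x \<le> y \<Longrightarrow> y \<le> 1 \<Longrightarrow> F x \<le> F y"
  using cdf by (auto simp: fair_cdf_def mono_on_def)

lemma F_cont: "continuous_on {1 - a..1} F"
  using cdf by (simp add: fair_cdf_def)

lemma F_ends: "F (1 - a) = 0" "F 1 = 1"
  using cdf by (auto simp: fair_cdf_def)

lemma F_bounds: "x \<in> {1 - a..1} \<Longrightarrow> 0 \<le> F x" "x \<in> {1 - a..1} \<Longrightarrow> F x \<le> 1"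
  using F_mono[of "1 - a" x] F_mono[of x 1] F_ends a_gt by auto

lemma F_left: "1 - a \<le> x \<Longrightarrow> x \<le> 0 \<Longrightarrow> F (tent a x) = 1 - 2 * F 0 + 2 * F x"
  and F_right: "0 \<le> x \<Longrightarrow> x \<le> a - 1 \<Longrightarrow> F (tent a x) = 1 + 2 * F 0 - 2 * F x"
  and F_high: "a - 1 \<le> x \<Longrightarrow> x \<le> 1 \<Longrightarrow> F (tent a x) = 1 - F x"
  using cdf by (auto simp: fair_cdf_def)

lemma F_mid: "\<bar>x\<bar> \<le> a - 1 \<Longrightarrow> F x = F 0 + sgn x / 2 * (1 - F (tent a x))"
proof -
  assume "\<bar>x\<bar> \<le> a - 1"
  then consider "x < 0" "1 - a \<le> x" | "x = 0" | "0 < x" "x \<le> a - 1" by linarith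
  then show ?thesis using F_left[of x] F_right[of x] by cases (auto simp: field_simps)
qed

lemma F_c3: "F (1 - a * (a - 1)) = 1 - 2 * F 0"
  using F_left[of "1 - a"] a_gt F_ends by (simp add: tent_def)

lemma F_chat2: "F (a - 1) = 2 * F 0"
  using F_right[of "a - 1"] a_gt F_c3 by (simp add: tent_def)

lemma H_bounds: "1 / 4 \<le> F 0" "F 0 \<le> 1 / 2"
proof -
  have "F (1 - a * (a - 1)) \<le> F (a - 1)"
    by (rule F_mono) (use c3_bounds a_le in auto)
  then show "1 / 4 \<le> F 0" using F_c3 F_chat2 by simp
  have "F (a - 1) \<le> F 1" by (rule F_mono) (use a_gt a_le in auto)
  then show "F 0 \<le> 1 / 2" using F_ends F_chat2 by simp
qed

end

lemma tent_param_lipschitz: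
  assumes "\<bar>x\<bar> \<le> 1"
  shows "\<bar>tent p x - tent q x\<bar> \<le> \<bar>p - q\<bar>"
proof -
  have "tent p x - tent q x = (q - p) * \<bar>x\<bar>" by (simp add: tent_def algebra_simps)
  then have "\<bar>tent p x - tent q x\<bar> = \<bar>p - q\<bar> * \<bar>x\<bar>" by (simp add: abs_mult abs_minus_commute)
  then show ?thesis using assms by (simp add: mult_left_le)
qed

text \<open>Along the orbit of \<open>f\<^sub>p\<close> the function \<open>G\<close> satisfies the functional equation of \<open>F\<close> up to
  its oscillation at scale \<open>2 (q - p)\<close>.\<close>

locale tent_cdf_pair = lo: tent_cdf p F + hi: tent_cdf q G
  for p q :: real and F G +
  fixes e0 :: real
  assumes pq: "p \<le> q"
    and osc: "\<And>u v. u \<in> {1 - q..1} \<Longrightarrow> v \<in> {1 - q..1} \<Longrightarrow> \<bar>u - v\<bar> \<le> 2 * (q - p) \<Longrightarrow> \<bar>G u - G v\<bar> \<le> e0"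
begin

definition "D w n = G ((tent p ^^ n) w) - F ((tent p ^^ n) w)"

lemma e0_nonneg: "0 \<le> e0"
  using osc[of 1 1] pq hi.a_gt by simp

lemma D_bound: "w \<in> {1 - p..1} \<Longrightarrow> \<bar>D w n\<bar> \<le> 1"
proof -
  assume "w \<in> {1 - p..1}"
  then have "(tent p ^^ n) w \<in> {1 - p..1}" by (rule lo.funpow_tent_mem)
  then show ?thesis using lo.F_bounds hi.F_bounds pq unfolding D_def
    by (smt (verit) atLeastAtMost_iff)
qed

lemma D_mid:
  assumes "w \<in> {1 - p..1}" "\<bar>(tent p ^^ n) w\<bar> \<le> p - 1"
  shows "\<bar>D w n - (G 0 - F 0) - (- sgn ((tent p ^^ n) w)) / 2 * D w (Suc n)\<bar> \<le> 3 / 2 * e0"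
proof -
  let ?x = "(tent p ^^ n) w"
  have x: "?x \<in> {1 - p..1}" using assms(1) by (rule lo.funpow_tent_mem)
  have G: "G ?x = G 0 + sgn ?x / 2 * (1 - G (tent q ?x))" using assms pq by (intro hi.F_mid) auto
  have F: "F ?x = F 0 + sgn ?x / 2 * (1 - F (tent p ?x))" using assms by (intro lo.F_mid) auto
  have "\<bar>G (tent q ?x) - G (tent p ?x)\<bar> \<le> e0"
  proof (rule osc)
    show "tent q ?x \<in> {1 - q..1}" using x pq by (intro hi.tent_mem) auto
    show "tent p ?x \<in> {1 - q..1}" using lo.tent_mem[OF x] pq by auto
    have "\<bar>?x\<bar> \<le> 1" using x lo.a_le by auto
    then show "\<bar>tent q ?x - tent p ?x\<bar> \<le> 2 * (q - p)" using tent_param_lipschitz[of ?x q p] pq by simp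
  qed
  moreover have eq: "D w n - (G 0 - F 0) - (- sgn ?x) / 2 * D w (Suc n) = sgn ?x / 2 * (G (tent p ?x) - G (tent q ?x))"
    unfolding D_def using G F by (simp add: field_simps)
  moreover have "\<bar>sgn ?x / 2 * (G (tent p ?x) - G (tent q ?x))\<bar> \<le> 1 * \<bar>G (tent p ?x) - G (tent q ?x)\<bar>"
    unfolding abs_mult by (intro mult_right_mono) (auto simp: sgn_if)
  ultimately have "\<bar>D w n - (G 0 - F 0) - (- sgn ?x) / 2 * D w (Suc n)\<bar> \<le> e0"
    by (simp only: eq mult_1 abs_minus_commute)
  \<comment> \<open>The constant 3/2 is the one that \<open>D_high\<close> produces; the orbit
    lemmas work with one error for both regions.\<close>
  then show ?thesis using e0_nonneg by simp
qed

lemma D_high: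
  assumes "w \<in> {1 - p..1}" "\<not> \<bar>(tent p ^^ n) w\<bar> \<le> p - 1"
  shows "\<bar>(tent p ^^ Suc n) w\<bar> \<le> p - 1 \<and> \<bar>D w n\<bar> \<le> \<bar>D w (Suc n)\<bar> + 3 / 2 * e0"
proof -
  let ?x = "(tent p ^^ n) w"
  have x: "?x \<in> {1 - p..1}" using assms(1) by (rule lo.funpow_tent_mem)
  then have x1: "p - 1 < ?x" "?x \<le> 1" using assms by auto
  then have mid: "\<bar>(tent p ^^ Suc n) w\<bar> \<le> p - 1" using lo.tent_high_mid[of ?x] by simp
  have F: "F ?x = 1 - F (tent p ?x)" using lo.F_high[of ?x] x1 by simp
  have tq: "tent q ?x \<in> {1 - q..1}" using x pq by (intro hi.tent_mem) auto
  have tp: "tent p ?x \<in> {1 - q..1}" using lo.tent_mem[OF x] pq by auto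
  have "\<bar>?x\<bar> \<le> 1" using x lo.a_le by auto
  then have e1: "\<bar>G (tent q ?x) - G (tent p ?x)\<bar> \<le> e0"
    using tent_param_lipschitz[of ?x q p] pq by (intro osc tq tp) simp
  have e2: "\<bar>G ?x - (1 - G (tent q ?x))\<bar> \<le> e0 / 2"
  proof (cases "q - 1 \<le> ?x")
    case True then show ?thesis using hi.F_high[of ?x] x1 e0_nonneg by simp
  next
    case False
    \<comment> \<open>Here \<open>p - 1 < ?x < q - 1\<close>, so the point has one preimage partner
      fewer for p than for q. Its image under \<open>tent q\<close> is within
      \<open>2 * (q - p)\<close> of the image of \<open>q - 1\<close>, where the two branches for G
      agree. This is the origin of the factor 2 in \<open>osc\<close>.\<close>
    have "\<bar>G (tent q ?x) - G (1 - q * (q - 1))\<bar> \<le> e0"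
    proof (rule osc[OF tq])
      show "1 - q * (q - 1) \<in> {1 - q..1}" using hi.c3_bounds hi.a_le by auto
      have "tent q ?x - (1 - q * (q - 1)) = q * (q - 1 - ?x)"
        using x1 lo.a_gt by (simp add: tent_def algebra_simps)
      then have "\<bar>tent q ?x - (1 - q * (q - 1))\<bar> = q * (q - 1 - ?x)"
        using False hi.a_gt by simp
      also have "\<dots> \<le> 2 * (q - p)" using False x1 hi.a_le hi.a_gt by (intro mult_mono) auto
      finally show "\<bar>tent q ?x - (1 - q * (q - 1))\<bar> \<le> 2 * (q - p)" .
    qed
    moreover have "G (tent q ?x) = 1 + 2 * G 0 - 2 * G ?x"
      using False x1 lo.a_gt by (intro hi.F_right) auto
    ultimately show ?thesis using hi.F_c3 by linarith
  qed
  have "\<bar>D w n\<bar> \<le> \<bar>D w (Suc n)\<bar> + 3 / 2 * e0"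
  proof -
    have "\<bar>(G ?x - (1 - G (tent q ?x))) - (G (tent q ?x) - G (tent p ?x)) + (F (tent p ?x) - G (tent p ?x))\<bar>
        \<le> e0 / 2 + e0 + \<bar>F (tent p ?x) - G (tent p ?x)\<bar>"
      by (rule order_trans[OF abs_triangle_ineq] add_mono order_trans[OF abs_triangle_ineq4] e1 e2 order_refl)+
    then show ?thesis using F by (simp add: D_def abs_minus_commute)
  qed
  then show ?thesis using mid by simp
qed

lemma cdf_close:
  assumes "w \<in> {1 - p..1}"
  shows "\<bar>G w - F w\<bar> \<le> 2 * \<bar>G 0 - F 0\<bar> + 6 * e0"
proof -
  have "\<bar>D w 0\<bar> \<le> 2 * \<bar>G 0 - F 0\<bar> + 4 * (3 / 2 * e0)"
  proof (rule orbit_difference_bound[where P = "\<lambda>n. \<bar>(tent p ^^ n) w\<bar> \<le> p - 1"])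
    show "\<exists>s. \<bar>s\<bar> \<le> 1 \<and> \<bar>D w n - (G 0 - F 0) - s / 2 * D w (Suc n)\<bar> \<le> 3 / 2 * e0"
      if "\<bar>(tent p ^^ n) w\<bar> \<le> p - 1" for n
      using D_mid[OF assms that] by (intro exI[of _ "- sgn ((tent p ^^ n) w)"]) (auto simp: sgn_if)
  qed (use D_bound[OF assms] D_high[OF assms] e0_nonneg in auto)
  then show ?thesis by (simp add: D_def)
qed

text \<open>At \<open>1 - p\<close> the function F vanishes and G is at most \<open>e0\<close>, so
  the orbit of \<open>1 - p\<close> has the form required by \<open>orbit_parameter_bound\<close>.
  The constant is 5/2 times 3/2.\<close>

lemma entropy_close: "\<bar>G 0 - F 0\<bar> \<le> 15 / 4 * e0"
proof -
  let ?w = "1 - p"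
  have w: "?w \<in> {1 - p..1}" using lo.a_gt by simp
  \<comment> \<open>\<open>G (1 - p)\<close> need not vanish, so the first term is replaced by \<open>0\<close>\<close>
  define D' where "D' n = (if n = 0 then 0 else D ?w n)" for n
  have G0: "\<bar>G ?w\<bar> \<le> e0"
    using osc[of ?w "1 - q"] pq lo.a_gt hi.a_gt hi.F_ends by simp
  have c2: "\<bar>(tent p ^^ 0) ?w\<bar> \<le> p - 1" using lo.a_gt by simp
  have P1: "\<bar>(tent p ^^ 1) ?w\<bar> \<le> p - 1"
    using lo.c3_bounds lo.a_gt by (simp add: tent_def abs_le_iff)
  have "G (tent q ?w) = 1 - 2 * G 0 + 2 * G ?w" using pq lo.a_gt by (intro hi.F_left) auto
  moreover have "F (tent p ?w) = 1 - 2 * F 0" using lo.F_left[of ?w] lo.a_gt lo.F_ends by simp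
  moreover have "\<bar>G (tent q ?w) - G (tent p ?w)\<bar> \<le> e0" 
  proof (rule osc)
    show "tent q ?w \<in> {1 - q..1}" using w pq by (intro hi.tent_mem) auto
    show "tent p ?w \<in> {1 - q..1}" using lo.tent_mem[OF w] pq by auto
    show "\<bar>tent q ?w - tent p ?w\<bar> \<le> 2 * (q - p)"
      using tent_param_lipschitz[of ?w q p] pq lo.a_gt lo.a_le by fastforce
  qed
  ultimately have first: "\<bar>D' 0 - (G 0 - F 0) - D' 1 / 2\<bar> \<le> 3 / 2 * e0"
    using G0 by (simp add: D'_def D_def abs_le_iff field_simps)
  have "\<bar>G 0 - F 0\<bar> \<le> 5 / 2 * (3 / 2 * e0)"
  proof (rule orbit_parameter_bound[where P = "\<lambda>n. \<bar>(tent p ^^ n) ?w\<bar> \<le> p - 1" and D = D' and B = 1])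
    show "\<bar>D' n\<bar> \<le> 1" for n using D_bound[OF w, of n] by (simp add: D'_def)
    show "\<exists>s. \<bar>s\<bar> \<le> 1 \<and> \<bar>D' n - (G 0 - F 0) - s / 2 * D' (Suc n)\<bar> \<le> 3 / 2 * e0"
      if "\<bar>(tent p ^^ n) ?w\<bar> \<le> p - 1" for n
    proof (cases n)
      case 0 then show ?thesis using first by (intro exI[of _ 1]) simp
    next
      case (Suc m) then show ?thesis using D_mid[OF w that] 
        by (intro exI[of _ "- sgn ((tent p ^^ n) ?w)"]) (auto simp: sgn_if D'_def)
    qed
    show "\<bar>(tent p ^^ Suc n) ?w\<bar> \<le> p - 1 \<and> \<bar>D' n\<bar> \<le> \<bar>D' (Suc n)\<bar> + 3 / 2 * e0"
      if "\<not> \<bar>(tent p ^^ n) ?w\<bar> \<le> p - 1" for n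
      using that c2 D_high[OF w that] by (cases n) (auto simp: D'_def)
  qed (use e0_nonneg first P1 in \<open>auto simp: D'_def\<close>)
  then show ?thesis by simp
qed

end

text \<open>For equal parameters the oscillation at scale 0 is 0, so the stability estimates become
  equalities.\<close>

lemma fair_cdf_unique:
  assumes "tent_cdf a F" "tent_cdf a G" "x \<in> {1 - a..1}"
  shows "F x = G x"
proof -
  interpret tent_cdf_pair a a F G 0
    by (intro tent_cdf_pair.intro tent_cdf_pair_axioms.intro assms) auto
  show ?thesis using cdf_close[OF assms(3)] entropy_close by simp
qed

text \<open>The dual of the Markov operator that averages a function over the preimages, in terms of
  distribution functions.  Its Cesaro averages stay distribution functions.\<close>

context tent_param
begin

definition dual :: "(real \<Rightarrow> real) \<Rightarrow> real \<Rightarrow> real" where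
  "dual G x = (if x \<le> 0 then (G (tent a x) - G (1 - a * (a - 1))) / 2
     else if x \<le> a - 1 then 1 - G (1 - a * (a - 1)) / 2 - G (tent a x) / 2
     else 1 - G (tent a x))"

definition is_cdf :: "(real \<Rightarrow> real) \<Rightarrow> bool" where
  "is_cdf G \<longleftrightarrow> mono_on {1 - a..1} G \<and> continuous_on {1 - a..1} G \<and> G (1 - a) = 0 \<and> G 1 = 1"

lemma is_cdf_range: "is_cdf G \<Longrightarrow> x \<in> {1 - a..1} \<Longrightarrow> G x \<in> {0..1}"
  unfolding is_cdf_def mono_on_def using a_gt
  by (metis atLeastAtMost_iff order_refl order_trans)

lemma c3_mem: "1 - a * (a - 1) \<in> {1 - a..1}"
  using c3_bounds a_le by auto

lemma tent_continuous: "continuous_on S (tent a)"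
  unfolding tent_def by (intro continuous_intros)

lemma is_cdf_dual:
  assumes G: "is_cdf G"
  shows "is_cdf (dual G)"
proof -
  let ?c = "G (1 - a * (a - 1))"
  have mono: "G u \<le> G v" if "u \<in> {1 - a..1}" "v \<in> {1 - a..1}" "u \<le> v" for u v
    using G that by (auto simp: is_cdf_def mono_on_def)
  have ends: "G (1 - a) = 0" "G 1 = 1" using G by (auto simp: is_cdf_def)
  have cont: "continuous_on {1 - a..1} (\<lambda>x. G (tent a x))"
    by (rule continuous_on_compose2[of "{1 - a..1}" G])
      (use G tent_mem in \<open>auto simp: is_cdf_def intro: tent_continuous\<close>)
  have at0: "tent a 0 = 1" and atc: "tent a (a - 1) = 1 - a * (a - 1)"
    and at1: "tent a 1 = 1 - a" and at2: "tent a (1 - a) = 1 - a * (a - 1)"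
    using a_gt by (auto simp: tent_def)
  have split: "{1 - a..1} = {1 - a..0} \<union> ({0..a - 1} \<union> {a - 1..1})"
    using a_gt a_le by auto
  have "continuous_on ({1 - a..0} \<union> ({0..a - 1} \<union> {a - 1..1})) (dual G)"
  proof (intro continuous_on_closed_Un closed_Un closed_atLeastAtMost)
    have "continuous_on {1 - a..0} (\<lambda>x. (G (tent a x) - ?c) / 2)"
      by (intro continuous_intros continuous_on_subset[OF cont]) (use a_gt in auto)
    then show "continuous_on {1 - a..0} (dual G)"
      by (rule continuous_on_eq) (simp add: dual_def)
    have "continuous_on {0..a - 1} (\<lambda>x. 1 - ?c / 2 - G (tent a x) / 2)"
      by (intro continuous_intros continuous_on_subset[OF cont]) (use a_gt a_le in auto)
    then show "continuous_on {0..a - 1} (dual G)"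
      by (rule continuous_on_eq) (auto simp: dual_def at0 ends field_simps)
    have "continuous_on {a - 1..1} (\<lambda>x. 1 - G (tent a x))"
      by (intro continuous_intros continuous_on_subset[OF cont]) (use a_gt in auto)
    then show "continuous_on {a - 1..1} (dual G)"
      by (rule continuous_on_eq) (use a_gt in \<open>auto simp: dual_def atc not_le dest: antisym\<close>)
  qed
  moreover have "dual G (1 - a) = 0" using a_gt by (simp add: dual_def at2)
  moreover have "dual G 1 = 1"
  \<comment> \<open>For \<open>a = 2\<close> the point 1 equals \<open>a - 1\<close> and is caught
    by the middle branch of \<open>dual\<close>.\<close>
  proof (cases "a = 2")
    case True
    have "?c = 0" using True ends by simp
    then show ?thesis unfolding dual_def at1 ends by simp
  next
    case False
    then show ?thesis using a_le by (simp add: dual_def at1 ends)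
  qed
  moreover have "dual G x \<le> dual G y" if xy: "x \<in> {1 - a..1}" "y \<in> {1 - a..1}" "x \<le> y" for x y
  proof -
    have r: "G (tent a x) \<in> {0..1}" "G (tent a y) \<in> {0..1}" "?c \<in> {0..1}"
      using xy tent_mem c3_mem G is_cdf_range by auto
    have neg: "G (tent a x) \<le> G (tent a y)" if "y \<le> 0"
      using that xy a_gt by (intro mono tent_mem) (simp_all add: tent_def)
    have pos: "G (tent a y) \<le> G (tent a x)" if "0 \<le> x"
      using that xy a_gt by (intro mono tent_mem) (simp_all add: tent_def)
    have hy: "G (tent a y) \<le> ?c" if "a - 1 \<le> y"
    proof (rule mono)
      show "tent a y \<le> 1 - a * (a - 1)" using tent_high[of y] that xy by auto
    qed (use xy tent_mem c3_mem in auto)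
    have mx: "?c \<le> G (tent a x)" if "0 \<le> x" "x \<le> a - 1"
    proof (rule mono)
      have "a * x \<le> a * (a - 1)" using that a_gt by (intro mult_left_mono) auto
      then show "1 - a * (a - 1) \<le> tent a x" using that a_gt by (simp add: tent_def)
    qed (use xy tent_mem c3_mem in auto)
    consider "y \<le> 0" | "x \<le> 0" "0 < y" "y \<le> a - 1" | "x \<le> 0" "a - 1 < y" |
      "0 < x" "y \<le> a - 1" | "0 < x" "x \<le> a - 1" "a - 1 < y" | "a - 1 < x"
      by linarith
    then show ?thesis
    proof cases
      case 1 then show ?thesis using neg xy by (simp add: dual_def)
    next
      case 2 then show ?thesis using r by (simp add: dual_def field_simps)
    next
      case 3 then show ?thesis using r hy a_gt by (simp add: dual_def field_simps)
    next
      case 4 then show ?thesis using pos xy by (simp add: dual_def)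
    next
      case 5 then show ?thesis using hy mx a_gt by (simp add: dual_def field_simps)
    next
      case 6 then show ?thesis using pos xy a_gt by (simp add: dual_def)
    qed
  qed
  ultimately show ?thesis unfolding is_cdf_def mono_on_def split[symmetric] by blast
qed

definition linear_cdf :: "real \<Rightarrow> real" where "linear_cdf x = (x - (1 - a)) / a"

lemma is_cdf_linear: "is_cdf linear_cdf"
  unfolding is_cdf_def linear_cdf_def mono_on_def using a_gt
  by (auto intro!: continuous_intros divide_right_mono)

definition cesaro_cdf :: "nat \<Rightarrow> real \<Rightarrow> real" where
  "cesaro_cdf N x = (\<Sum>k<Suc N. (dual ^^ k) linear_cdf x) / real (Suc N)"

lemma is_cdf_iterate: "is_cdf ((dual ^^ k) linear_cdf)"
  by (induction k) (simp_all add: is_cdf_linear is_cdf_dual)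

lemma is_cdf_cesaro: "is_cdf (cesaro_cdf N)"
proof -
  note it = is_cdf_iterate[unfolded is_cdf_def]
  have "mono_on {1 - a..1} (cesaro_cdf N)"
    unfolding mono_on_def cesaro_cdf_def
    using it by (auto intro!: divide_right_mono sum_mono simp: mono_on_def simp del: sum.lessThan_Suc)
  moreover have "continuous_on {1 - a..1} (cesaro_cdf N)"
    unfolding cesaro_cdf_def using it by (intro continuous_intros) auto
  moreover have "cesaro_cdf N (1 - a) = 0" "cesaro_cdf N 1 = 1"
    unfolding cesaro_cdf_def using it by (auto simp del: sum.lessThan_Suc)
  ultimately show ?thesis by (simp add: is_cdf_def)
qed

text \<open>At each point \<open>dual\<close> is affine in G, with the same coefficients for all G.
  It therefore commutes with averages, and the difference telescopes to two terms with values in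
  [0, 1].\<close>

lemma dual_cesaro:
  assumes x: "x \<in> {1 - a..1}"
  shows "\<bar>dual (cesaro_cdf N) x - cesaro_cdf N x\<bar> \<le> 1 / real (Suc N)"
proof -
  let ?n = "real (Suc N)" and ?g = "\<lambda>k. (dual ^^ k) linear_cdf"
  have "dual (cesaro_cdf N) x = (\<Sum>k<Suc N. dual (?g k) x) / ?n"
  proof -
    let ?c = "1 - a * (a - 1)"
    obtain A B C where lin: "\<And>G. dual G x = A + B * G (tent a x) + C * G ?c"
    proof -
      consider "x \<le> 0" | "0 < x" "x \<le> a - 1" | "0 < x" "a - 1 < x" by linarith
      then show thesis
      proof cases
        case 1 then show thesis by (intro that[of 0 "1 / 2" "- 1 / 2"]) (simp add: dual_def field_simps)
      next
        case 2 then show thesis by (intro that[of 1 "- 1 / 2" "- 1 / 2"]) (simp add: dual_def field_simps)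
      next
        case 3 then show thesis by (intro that[of 1 "- 1" 0]) (simp add: dual_def)
      qed
    qed
    have "(\<Sum>k<Suc N. dual (?g k) x) =
        ?n * A + B * (\<Sum>k<Suc N. ?g k (tent a x)) + C * (\<Sum>k<Suc N. ?g k ?c)"
      unfolding lin sum.distrib sum_distrib_left[symmetric] by simp
    then show ?thesis
      unfolding lin cesaro_cdf_def by (simp add: add_divide_distrib del: sum.lessThan_Suc)
  qed
  also have "(\<Sum>k<Suc N. dual (?g k) x) = (\<Sum>k<Suc N. ?g (Suc k) x)" by simp
  finally have "dual (cesaro_cdf N) x - cesaro_cdf N x = (\<Sum>k<Suc N. ?g (Suc k) x - ?g k x) / ?n"
    unfolding cesaro_cdf_def by (simp add: sum_subtractf diff_divide_distrib del: sum.lessThan_Suc funpow.simps)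
  also have "(\<Sum>k<Suc N. ?g (Suc k) x - ?g k x) = ?g (Suc N) x - ?g 0 x"
    by (rule sum_lessThan_telescope)
  finally have "\<bar>dual (cesaro_cdf N) x - cesaro_cdf N x\<bar> = \<bar>?g (Suc N) x - ?g 0 x\<bar> / ?n"
    by simp
  also have "\<dots> \<le> 1 / ?n"
    using is_cdf_range[OF is_cdf_iterate x, of "Suc N"] is_cdf_range[OF is_cdf_iterate x, of 0]
    by (intro divide_right_mono) (auto simp: abs_le_iff simp del: funpow.simps)
  finally show ?thesis .
qed

text \<open>This is the contraction along orbits used for uniqueness, with the value at
  \<open>1 - a * (a - 1)\<close> taking the part of the value at the turning point.\<close>

lemma almost_invariant_close:
  assumes G: "is_cdf G" "is_cdf G'"
    and inv: "\<And>x. x \<in> {1 - a..1} \<Longrightarrow> \<bar>dual G x - G x\<bar> \<le> d" "\<And>x. x \<in> {1 - a..1} \<Longrightarrow> \<bar>dual G' x - G' x\<bar> \<le> d'"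
    and x: "x \<in> {1 - a..1}"
  shows "\<bar>G x - G' x\<bar> \<le> \<bar>G (1 - a * (a - 1)) - G' (1 - a * (a - 1))\<bar> + 4 * (d + d')"
proof -
  let ?c = "1 - a * (a - 1)"
  define D where "D n = G ((tent a ^^ n) x) - G' ((tent a ^^ n) x)" for n
  define t where "t = - (G ?c - G' ?c) / 2"
  have mem: "(tent a ^^ n) x \<in> {1 - a..1}" for n by (rule funpow_tent_mem[OF x])
  have "\<bar>D 0\<bar> \<le> 2 * \<bar>t\<bar> + 4 * (d + d')"
  proof (rule orbit_difference_bound[where P = "\<lambda>n. \<bar>(tent a ^^ n) x\<bar> \<le> a - 1"])
    fix n
    let ?y = "(tent a ^^ n) x"
    have i: "\<bar>dual G ?y - G ?y\<bar> \<le> d" "\<bar>dual G' ?y - G' ?y\<bar> \<le> d'" using inv mem by auto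
    show "\<bar>D n\<bar> \<le> 1"
      using is_cdf_range[OF G(1) mem, of n] is_cdf_range[OF G(2) mem, of n] by (auto simp: D_def)
    show "\<exists>s. \<bar>s\<bar> \<le> 1 \<and> \<bar>D n - t - s / 2 * D (Suc n)\<bar> \<le> d + d'" if "\<bar>?y\<bar> \<le> a - 1"
    proof (rule exI[of _ "if ?y \<le> 0 then 1 else -1"], intro conjI)
      have "D n - t - (if ?y \<le> 0 then 1 else -1) / 2 * D (Suc n) = (dual G' ?y - G' ?y) - (dual G ?y - G ?y)"
        using that by (auto simp: D_def t_def dual_def field_simps)
      then show "\<bar>D n - t - (if ?y \<le> 0 then 1 else -1) / 2 * D (Suc n)\<bar> \<le> d + d'" using i by linarith
    qed auto
    show "\<bar>(tent a ^^ Suc n) x\<bar> \<le> a - 1 \<and> \<bar>D n\<bar> \<le> \<bar>D (Suc n)\<bar> + (d + d')" if "\<not> \<bar>?y\<bar> \<le> a - 1"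
    proof
      have y: "a - 1 < ?y" "?y \<le> 1" using that mem[of n] by auto
      then show "\<bar>(tent a ^^ Suc n) x\<bar> \<le> a - 1" using tent_high_mid[of ?y] by simp
      have "D n = - D (Suc n) + ((dual G' ?y - G' ?y) - (dual G ?y - G ?y))"
        using y a_gt by (auto simp: D_def dual_def)
      then show "\<bar>D n\<bar> \<le> \<bar>D (Suc n)\<bar> + (d + d')" using i by linarith
    qed
    show "0 \<le> d + d'" using i by linarith
  qed
  then show ?thesis by (simp add: D_def t_def)
qed

text \<open>Compactness is used only for the real sequence of values at
  \<open>1 - a * (a - 1)\<close>. By \<open>almost_invariant_close\<close> convergence there makes
  the averages uniformly Cauchy, so the limit is continuous, which is what excludes atoms
  later.\<close>

lemma fair_cdf_exists: "\<exists>F. fair_cdf a F"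
proof -
  let ?c = "1 - a * (a - 1)"
  have "bounded (range (\<lambda>N. cesaro_cdf N ?c))"
    using is_cdf_range[OF is_cdf_cesaro c3_mem] by (intro boundedI[of _ 1]) auto
  then obtain l r where r: "strict_mono (r :: nat \<Rightarrow> nat)" and l: "((\<lambda>N. cesaro_cdf N ?c) \<circ> r) \<longlonglongrightarrow> l"
    using bounded_imp_convergent_subsequence by blast
  define G where "G N = cesaro_cdf (r N)" for N
  have G: "is_cdf (G N)" for N by (simp add: G_def is_cdf_cesaro)
  have inv: "\<bar>dual (G N) x - G N x\<bar> \<le> 1 / real (Suc N)" if "x \<in> {1 - a..1}" for N x
  proof -
    have "1 / real (Suc (r N)) \<le> 1 / real (Suc N)"
      using seq_suble[OF r, of N] by (intro divide_left_mono) auto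
    then show ?thesis using dual_cesaro[OF that, of "r N"] by (simp add: G_def)
  qed
  have "Cauchy (\<lambda>N. G N ?c)" using l by (intro LIMSEQ_imp_Cauchy[of _ l]) (simp add: G_def o_def)
  have "uniformly_Cauchy_on {1 - a..1} G"
  proof (rule uniformly_Cauchy_onI)
    fix e :: real assume e: "0 < e"
    obtain M1 where M1: "\<And>m n. m \<ge> M1 \<Longrightarrow> n \<ge> M1 \<Longrightarrow> dist (G m ?c) (G n ?c) < e / 2"
      using metric_CauchyD[OF \<open>Cauchy (\<lambda>N. G N ?c)\<close>, of "e / 2"] e by auto
    obtain M2 :: nat where M2: "16 / e < real M2" using reals_Archimedean2 by blast
    have small: "1 / real (Suc n) \<le> e / 16" if "n \<ge> M2" for n
    proof -
      have "16 / e < real (Suc n)" using M2 that by linarith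
      then show ?thesis using e by (simp add: field_simps)
    qed
    show "\<exists>M. \<forall>x\<in>{1 - a..1}. \<forall>m\<ge>M. \<forall>n\<ge>M. dist (G m x) (G n x) < e"
    proof (intro exI[of _ "max M1 M2"] ballI allI impI)
      fix x m n assume x: "x \<in> {1 - a..1}" and mn: "max M1 M2 \<le> m" "max M1 M2 \<le> n"
      have "\<bar>G m x - G n x\<bar> \<le> \<bar>G m ?c - G n ?c\<bar> +
          4 * (1 / real (Suc m) + 1 / real (Suc n))"
        by (rule almost_invariant_close[OF G G inv inv x])
      moreover have "1 / real (Suc m) \<le> e / 16" "1 / real (Suc n) \<le> e / 16"
        using small mn by auto
      moreover have "\<bar>G m ?c - G n ?c\<bar> < e / 2" using M1[of m n] mn by (simp add: dist_real_def)
      ultimately show "dist (G m x) (G n x) < e"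
        unfolding dist_real_def by argo
    qed
  qed
  then obtain F where F: "uniform_limit {1 - a..1} G F sequentially"
    using Cauchy_uniformly_convergent uniformly_convergent_on_def by blast
  have lim: "(\<lambda>N. G N x) \<longlonglongrightarrow> F x" if "x \<in> {1 - a..1}" for x
    using tendsto_uniform_limitI[OF F that] .
  have cont: "continuous_on {1 - a..1} F"
    by (rule uniform_limit_theorem[OF _ F]) (use G in \<open>auto simp: is_cdf_def\<close>)
  have mono: "mono_on {1 - a..1} F"
  proof (rule mono_onI)
    fix x y assume "x \<in> {1 - a..1}" "y \<in> {1 - a..1}" "x \<le> y"
    then show "F x \<le> F y"
      using G by (intro LIMSEQ_le[OF lim lim]) (auto simp: is_cdf_def mono_on_def)
  qed
  have ends: "F (1 - a) = 0" "F 1 = 1"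
  proof -
    have "(\<lambda>N. G N (1 - a)) \<longlonglongrightarrow> F (1 - a)" "(\<lambda>N. G N 1) \<longlonglongrightarrow> F 1"
      using a_gt by (auto intro!: lim)
    then show "F (1 - a) = 0" "F 1 = 1"
      using G by (simp_all add: is_cdf_def LIMSEQ_const_iff)
  qed
  have fixp: "dual F x = F x" if x: "x \<in> {1 - a..1}" for x
  proof -
    have "(\<lambda>N. dual (G N) x) \<longlonglongrightarrow> dual F x"
      unfolding dual_def using lim[OF c3_mem] lim[OF tent_mem[OF x]]
      by (auto intro!: tendsto_intros)
    then have "(\<lambda>N. dual (G N) x - G N x) \<longlonglongrightarrow> dual F x - F x"
      by (rule tendsto_diff) (rule lim[OF x])
    moreover have "(\<lambda>N. dual (G N) x - G N x) \<longlonglongrightarrow> 0"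
      by (rule tendsto_rabs_zero_cancel, rule tendsto_sandwich[OF _ _ tendsto_const LIMSEQ_inverse_real_of_nat])
        (use inv[OF x] in \<open>auto simp: inverse_eq_divide\<close>)
    ultimately show ?thesis using LIMSEQ_unique by fastforce
  qed
  have F0: "F 0 = (1 - F ?c) / 2"
    using fixp[of 0] a_gt ends by (simp add: dual_def tent_def)
  have "fair_cdf a F"
    unfolding fair_cdf_def
  proof (intro conjI ballI mono cont ends)
    fix x assume "x \<in> {1 - a..0}"
    then show "F (tent a x) = 1 - 2 * F 0 + 2 * F x" using fixp[of x] F0 by (simp add: dual_def field_simps)
  next
    fix x assume x: "x \<in> {0..a - 1}"
    then show "F (tent a x) = 1 + 2 * F 0 - 2 * F x"
      using fixp[of x] F0 ends a_le by (cases "x = 0") (auto simp: dual_def tent_def field_simps)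
  next
    fix x assume x: "x \<in> {a - 1..1}"
    have "tent a (a - 1) = ?c" using a_gt by (simp add: tent_def)
    then show "F (tent a x) = 1 - F x"
      using x fixp[of x] a_gt by (cases "x = a - 1") (auto simp: dual_def)
  qed
  then show ?thesis by blast
qed

end

section \<open>The fair measure\<close>

context tent_param
begin

abbreviation "I \<equiv> tent_interval a"

lemma I_eq: "I = {1 - a..1}" by (simp add: tent_interval_def)

lemma tent_image_nonneg: "0 \<le> u \<Longrightarrow> tent a ` {u..v} = {1 - a * v..1 - a * u}"
proof (intro equalityI subsetI)
  fix y assume u: "0 \<le> u" and "y \<in> {1 - a * v..1 - a * u}"
  then have y: "a * u \<le> 1 - y" "1 - y \<le> a * v" by auto
  have "0 \<le> a * u" using u a_gt by simp
  then have "0 \<le> 1 - y" using y by linarith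
  then have "(1 - y) / a \<in> {u..v}" "tent a ((1 - y) / a) = y"
    using a_gt y by (auto simp: pos_le_divide_eq pos_divide_le_eq tent_def mult.commute)
  then show "y \<in> tent a ` {u..v}" by force
qed (use a_gt in \<open>auto simp: tent_def\<close>)

lemma tent_image_nonpos: "v \<le> 0 \<Longrightarrow> tent a ` {u..v} = {1 + a * u..1 + a * v}"
proof -
  assume "v \<le> 0"
  have "tent a ` {u..v} = tent a ` (uminus ` {u..v})" unfolding image_image by (simp add: tent_def)
  also have "uminus ` {u..v} = {- v..- u}" by simp
  finally show ?thesis using tent_image_nonneg[of "- v" "- u"] \<open>v \<le> 0\<close> by simp
qed

lemma preimage_count_eq:
  assumes "x \<in> I"
  shows "preimage_count a x = (if x = 0 \<or> a - 1 < x then 1 else 2)"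
proof -
  have "{y \<in> I. tent a y = tent a x} = {x, - x} \<inter> I"
    using a_gt assms by (auto simp: tent_def abs_if split: if_splits)
  also have "\<dots> = (if a - 1 < x then {x} else {x, - x})"
    using assms a_gt a_le by (auto simp: I_eq)
  finally show ?thesis using a_gt by (auto simp: preimage_count_def)
qed

lemma tent_inj_nonneg: "inj_on (tent a) {0..}" and tent_inj_nonpos: "inj_on (tent a) {..0}"
  using a_gt by (auto simp: inj_on_def tent_def)

end

section \<open>The distribution function of a fair measure\<close>

locale fair = tent_param +
  fixes M :: "real measure"
  assumes fair: "is_fair_measure a M"
begin

sublocale prob_space M
  using fair by (simp add: is_fair_measure_def)

lemma sets_M: "A \<in> sets M \<longleftrightarrow> A \<in> sets borel \<and> A \<subseteq> {1 - a..1}"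
  using fair by (auto simp: is_fair_measure_def sets_restrict_space_iff I_eq)

lemma space_M: "space M = {1 - a..1}"
proof -
  have "sets M = sets (restrict_space borel I)" using fair by (simp add: is_fair_measure_def)
  from sets_eq_imp_space_eq[OF this] show ?thesis by (simp add: space_restrict_space I_eq)
qed

lemma borel_measurable_M: "f \<in> borel_measurable borel \<Longrightarrow> f \<in> borel_measurable M"
proof -
  assume "f \<in> borel_measurable borel"
  then have "f \<in> borel_measurable (restrict_space borel I)" by (rule measurable_restrict_space1)
  moreover have "sets M = sets (restrict_space borel I)" using fair by (simp add: is_fair_measure_def)
  ultimately show ?thesis using measurable_cong_sets by blast
qed

lemma atomless: "{x} \<in> null_sets M" if "x \<in> {1 - a..1}"
  using fair that sets_M by (auto simp: is_fair_measure_def null_sets_def I_eq)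

lemma invariant: "A \<in> sets M \<Longrightarrow> measure M (tent a -` A \<inter> space M) = measure M A"
  using fair by (simp add: is_fair_measure_def measure_def space_M I_eq)

text \<open>The number of preimages may deviate at one point z, namely 0 or \<open>a - 1\<close>,
  because points are null sets.\<close>

lemma fair_image:
  assumes E: "E \<in> sets M" "inj_on (tent a) E" and n: "\<And>x. x \<in> E \<Longrightarrow> x \<noteq> z \<Longrightarrow> preimage_count a x = n"
    and z: "z \<in> {1 - a..1}"
  shows "measure M (tent a ` E) = n * measure M E"
proof -
  have "emeasure M (tent a ` E) = (\<integral>\<^sup>+x. of_nat (preimage_count a x) * indicator E x \<partial>M)"
    using fair E by (simp add: is_fair_measure_def)
  also have "\<dots> = (\<integral>\<^sup>+x. of_nat n * indicator E x \<partial>M)"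
  proof (rule nn_integral_cong_AE)
    show "AE x in M. of_nat (preimage_count a x) * indicator E x = (of_nat n * indicator E x :: ennreal)"
      using AE_not_in[OF atomless[OF z]] by eventually_elim (auto simp: n split: split_indicator)
  qed
  also have "\<dots> = of_nat n * emeasure M E" using E by (simp add: nn_integral_cmult_indicator)
  finally show ?thesis by (simp add: measure_def enn2real_mult)
qed

lemma measure_image_left:
  assumes "E \<in> sets M" "E \<subseteq> {1 - a..0}"
  shows "measure M (tent a ` E) = 2 * measure M E"
  using fair_image[of E 0 2] assms inj_on_subset[OF tent_inj_nonpos, of E] a_gt a_le
  by (force simp: preimage_count_eq I_eq)

lemma measure_image_right:
  assumes "E \<in> sets M" "E \<subseteq> {0..a - 1}"
  shows "measure M (tent a ` E) = 2 * measure M E"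
  using fair_image[of E 0 2] assms inj_on_subset[OF tent_inj_nonneg, of E] a_gt a_le
  by (force simp: preimage_count_eq I_eq)

lemma measure_image_high:
  assumes "E \<in> sets M" "E \<subseteq> {a - 1..1}"
  shows "measure M (tent a ` E) = measure M E"
proof -
  have "E \<subseteq> {0..}" using assms(2) a_gt by auto
  then show ?thesis
    using fair_image[of E "a - 1" 1] assms inj_on_subset[OF tent_inj_nonneg, of E] a_gt a_le
    by (force simp: preimage_count_eq I_eq)
qed

definition "cdf_M x = measure M {1 - a..x}"

lemma measure_Icc:
  assumes "1 - a \<le> u" "u \<le> v" "v \<le> 1"
  shows "measure M {u..v} = cdf_M v - cdf_M u"
proof -
  have s: "{1 - a..u} \<in> sets M" "{u<..v} \<in> sets M" "{u} \<in> sets M" using assms by (auto simp: sets_M)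
  have "measure M {1 - a..v} = measure M {1 - a..u} + measure M {u<..v}"
    using s assms by (subst finite_measure_Union[symmetric]) (auto intro!: arg_cong[where f = "measure M"])
  moreover have "measure M {u..v} = measure M {u} + measure M {u<..v}"
    using s assms by (subst finite_measure_Union[symmetric]) (auto intro!: arg_cong[where f = "measure M"])
  moreover have "measure M {u} = 0" using atomless[of u] assms by (simp add: measure_def null_sets_def)
  ultimately show ?thesis by (simp add: cdf_M_def)
qed

lemma cdf_M_ends: "cdf_M (1 - a) = 0" "cdf_M 1 = 1"
  using atomless[of "1 - a"] a_gt prob_space by (auto simp: cdf_M_def measure_def null_sets_def space_M)

text \<open>The intervals from \<open>1 - a\<close>, 0 and \<open>a - 1\<close> up to x are mapped
  injectively onto intervals. The fairness condition for them gives each equation up to a constant,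
  and the values at 0 and \<open>a - 1\<close> fix the constants.\<close>

lemma fair_cdf_M: "fair_cdf a cdf_M"
  unfolding fair_cdf_def
proof (intro conjI ballI cdf_M_ends)
  show mono: "mono_on {1 - a..1} cdf_M"
    unfolding cdf_M_def by (rule mono_onI) (auto intro!: finite_measure_mono simp: sets_M)
  have left: "cdf_M (tent a x) - cdf_M (1 - a * (a - 1)) = 2 * (cdf_M x - cdf_M (1 - a))" if "x \<in> {1 - a..0}" for x
  proof -
    have t: "tent a x \<in> {1 - a..1}" using that a_gt by (intro tent_mem) auto
    have "a * (1 - a) \<le> a * x" using that a_gt by (intro mult_left_mono) auto
    then have "1 - a * (a - 1) \<le> tent a x" using that by (simp add: tent_def algebra_simps)
    then have "measure M {1 - a * (a - 1)..tent a x} = cdf_M (tent a x) - cdf_M (1 - a * (a - 1))"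
      using t c3_bounds by (intro measure_Icc) auto
    moreover have "{1 - a * (a - 1)..tent a x} = tent a ` {1 - a..x}"
      using that by (subst tent_image_nonpos) (auto simp: tent_def algebra_simps)
    moreover have "measure M (tent a ` {1 - a..x}) = 2 * measure M {1 - a..x}"
      using that by (intro measure_image_left) (auto simp: sets_M)
    moreover have "measure M {1 - a..x} = cdf_M x - cdf_M (1 - a)"
      using that by (intro measure_Icc) auto
    ultimately show ?thesis by simp
  qed
  have right: "1 - cdf_M (tent a x) = 2 * (cdf_M x - cdf_M 0)" if "x \<in> {0..a - 1}" for x
  proof -
    have t: "tent a x \<in> {1 - a..1}" using that a_gt a_le by (intro tent_mem) auto
    then have "measure M {tent a x..1} = 1 - cdf_M (tent a x)"
      using measure_Icc[of "tent a x" 1] cdf_M_ends by auto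
    moreover have "{tent a x..1} = tent a ` {0..x}"
      using that by (subst tent_image_nonneg) (auto simp: tent_def)
    moreover have "measure M (tent a ` {0..x}) = 2 * measure M {0..x}"
      using that a_gt a_le by (intro measure_image_right) (auto simp: sets_M)
    moreover have "measure M {0..x} = cdf_M x - cdf_M 0"
      using that a_gt a_le by (intro measure_Icc) auto
    ultimately show ?thesis by simp
  qed
  have high: "cdf_M (1 - a * (a - 1)) - cdf_M (tent a x) = cdf_M x - cdf_M (a - 1)" if "x \<in> {a - 1..1}" for x
  proof -
    have t: "tent a x \<in> {1 - a..1 - a * (a - 1)}" using that by (intro tent_high) auto
    then have "measure M {tent a x..1 - a * (a - 1)} = cdf_M (1 - a * (a - 1)) - cdf_M (tent a x)"
      using c3_bounds a_le by (intro measure_Icc) auto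
    moreover have "{tent a x..1 - a * (a - 1)} = tent a ` {a - 1..x}"
      using that a_gt by (subst tent_image_nonneg) (auto simp: tent_def)
    moreover have "measure M (tent a ` {a - 1..x}) = measure M {a - 1..x}"
      using that a_gt a_le by (intro measure_image_high) (auto simp: sets_M)
    moreover have "measure M {a - 1..x} = cdf_M x - cdf_M (a - 1)"
      using that a_gt by (intro measure_Icc) auto
    ultimately show ?thesis by simp
  qed
  have c3: "cdf_M (1 - a * (a - 1)) = 1 - 2 * cdf_M 0"
    using left[of 0] a_gt cdf_M_ends by (simp add: tent_def)
  have c2: "cdf_M (a - 1) = 2 * cdf_M 0"
    using right[of "a - 1"] a_gt c3 by (simp add: tent_def)
  show "cdf_M (tent a x) = 1 - 2 * cdf_M 0 + 2 * cdf_M x" if "x \<in> {1 - a..0}" for x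
    using left[OF that] c3 cdf_M_ends by simp
  show "cdf_M (tent a x) = 1 + 2 * cdf_M 0 - 2 * cdf_M x" if "x \<in> {0..a - 1}" for x
    using right[OF that] by simp
  show "cdf_M (tent a x) = 1 - cdf_M x" if "x \<in> {a - 1..1}" for x
    using high[OF that] c2 c3 by simp
  show "continuous_on {1 - a..1} cdf_M"
  proof -
    have idm: "id \<in> borel_measurable M" by (rule borel_measurable_M) (simp add: id_def)
    interpret R: real_distribution "distr M borel id"
      by (rule real_distribution_distr[OF idm])
    have "isCont (cdf (distr M borel id)) x" for x
    proof -
      have "measure (distr M borel id) {x} = 0"
      proof (cases "x \<in> {1 - a..1}")
        case True
        then have "measure M {x} = 0" using atomless[OF True] by (simp add: measure_def null_sets_def)
        moreover have "id -` {x} \<inter> space M = {x}" using True by (auto simp: space_M)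
        ultimately show ?thesis by (subst measure_distr[OF idm]) auto
      next
        case False
        then show ?thesis by (subst measure_distr[OF idm]) (auto simp: space_M)
      qed
      then show ?thesis by (simp add: R.isCont_cdf)
    qed
    then have "continuous_on {1 - a..1} (cdf (distr M borel id))"
      by (simp add: continuous_at_imp_continuous_on)
    then show ?thesis
    proof (rule continuous_on_eq)
      fix x assume "x \<in> {1 - a..1}"
      then have "{..x} \<inter> {1 - a..1} = {1 - a..x}" by auto
      then show "cdf (distr M borel id) x = cdf_M x"
        unfolding cdf_def cdf_M_def by (subst measure_distr[OF idm]) (auto simp: space_M)
    qed
  qed
qed

end

text \<open>Extends a mass formula from intervals to Borel sets. The two finite measures
  \<open>m1\<close> and \<open>m2\<close>, a multiple of N on \<open>[u, v]\<close> and the pullback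
  of N under the affine map, agree on half-lines because end points are null, and hence
  everywhere.\<close>

lemma emeasure_affine_image:
  fixes N :: "real measure"
  assumes N: "finite_measure N" "sets N = sets borel" and atomless: "\<And>x. measure N {x} = 0"
    and q: "q \<noteq> 0" and c: "0 \<le> c"
    and Icc: "\<And>s. u \<le> s \<Longrightarrow> s \<le> v \<Longrightarrow> measure N ((\<lambda>x. p + q * x) ` {s..v}) = c * measure N {s..v}"
    and B: "B \<in> sets borel" "B \<subseteq> {u..v}"
  shows "measure N ((\<lambda>x. p + q * x) ` B) = c * measure N B"
proof -
  interpret finite_measure N by fact
  let ?h = "\<lambda>x. p + q * x" and ?g = "\<lambda>y. (y - p) / q"
  have im: "?h ` A = ?g -` A" for A
  proof
    show "?g -` A \<subseteq> ?h ` A" using q by (auto intro!: image_eqI[of _ _ "?g _"])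
  qed (use q in auto)
  have g: "?g \<in> borel_measurable borel" by simp
  have imB: "?h ` A \<in> sets borel" if "A \<in> sets borel" for A
    unfolding im using measurable_sets[OF g that] by simp
  define m1 where "m1 = density N (\<lambda>x. ennreal c * indicator {u..v} x)"
  define m2 where "m2 = distr (density N (indicator (?h ` {u..v}))) borel ?g"
  have m1: "emeasure m1 A = ennreal (c * measure N (A \<inter> {u..v}))" if "A \<in> sets borel" for A
  proof -
    have "emeasure m1 A = (\<integral>\<^sup>+x. ennreal c * indicator (A \<inter> {u..v}) x \<partial>N)"
      using that N by (subst m1_def, subst emeasure_density)
        (auto intro!: nn_integral_cong split: split_indicator)
    also have "\<dots> = ennreal c * emeasure N (A \<inter> {u..v})"
      using that N by (intro nn_integral_cmult_indicator) auto
    finally show ?thesis using c by (simp add: emeasure_eq_measure ennreal_mult)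
  qed
  have m2: "emeasure m2 A = ennreal (measure N (?h ` (A \<inter> {u..v})))" if "A \<in> sets borel" for A
  proof -
    have gA: "?g -` A \<in> sets N" using imB[OF that] N im by simp
    have huv: "?h ` {u..v} \<in> sets N" using imB[of "{u..v}"] N by simp
    have sp: "space N = UNIV" using sets_eq_imp_space_eq[OF N(2)] by simp
    have "emeasure m2 A = emeasure (density N (indicator (?h ` {u..v}))) (?g -` A)"
    proof -
      have "measurable (density N (indicator (?h ` {u..v}))) borel = measurable borel (borel :: real measure)"
        by (rule measurable_cong_sets) (simp_all add: N)
      then show ?thesis using that g by (subst m2_def, subst emeasure_distr) (simp_all add: sp)
    qed
    also have "\<dots> = (\<integral>\<^sup>+x. indicator (?h ` {u..v}) x * indicator (?g -` A) x \<partial>N)"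
      using gA huv by (subst emeasure_density) auto
    also have "\<dots> = (\<integral>\<^sup>+x. indicator (?h ` (A \<inter> {u..v})) x \<partial>N)"
      unfolding im by (intro nn_integral_cong) (auto split: split_indicator)
    also have "\<dots> = emeasure N (?h ` (A \<inter> {u..v}))"
      using imB[of "A \<inter> {u..v}"] that N by (intro nn_integral_indicator) auto
    finally show ?thesis by (simp add: emeasure_eq_measure)
  qed
  have "m1 = m2"
  proof (rule measure_eqI_lessThan)
    show "sets m1 = sets borel" "sets m2 = sets borel" by (simp_all add: m1_def m2_def N)
    fix x :: real
    show "emeasure m1 {x<..} < \<infinity>" by (simp add: m1)
    have null: "{x} \<in> null_sets N" for x
      using atomless[of x] N by (intro null_setsI) (auto simp: emeasure_eq_measure)
    consider "v < x" | "x < u" "u \<le> v" | "v < u" | "u \<le> x" "x \<le> v" by linarith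
    then have "measure N (?h ` ({x<..} \<inter> {u..v})) = c * measure N ({x<..} \<inter> {u..v})"
    proof cases
      case 1
      then have "{x<..} \<inter> {u..v} = {}" by auto
      then show ?thesis by simp
    next
      case 2
      then have "{x<..} \<inter> {u..v} = {u..v}" by auto
      then show ?thesis using Icc[of u] 2 by simp
    next
      case 3 then show ?thesis by simp
    next
      case 4
      then have eq: "{x<..} \<inter> {u..v} = {x..v} - {x}" by auto
      have "?h ` ({x..v} - {x}) = ?h ` {x..v} - {?h x}" using q by auto
      then show ?thesis
        using Icc[OF 4] measure_Diff_null_set[OF _ null, of "{x..v}" x] measure_Diff_null_set[OF _ null, of "?h ` {x..v}" "?h x"]
          N imB[of "{x..v}"] by (simp add: eq)
    qed
    then show "emeasure m1 {x<..} = emeasure m2 {x<..}" by (simp add: m1 m2)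
  qed
  then have "ennreal (c * measure N B) = ennreal (measure N (?h ` B))"
    using m1[OF B(1)] m2[OF B(1)] B(2) by (simp add: Int_absorb2)
  then show ?thesis using c by simp
qed

section \<open>The fair measure of a given distribution function\<close>

context tent_cdf
begin

text \<open>The constant continuation outside the interval keeps the Stieltjes measure concentrated
  on \<open>[1 - a, 1]\<close>.\<close>

definition "F_ext x = F (max (1 - a) (min 1 x))"

lemma F_ext: "x \<in> {1 - a..1} \<Longrightarrow> F_ext x = F x" by (simp add: F_ext_def)

lemma F_ext_mono: "x \<le> y \<Longrightarrow> F_ext x \<le> F_ext y"
  unfolding F_ext_def using a_gt by (intro F_mono) auto

lemma F_ext_cont: "continuous_on UNIV F_ext"
  unfolding F_ext_def
  by (rule continuous_on_compose2[OF F_cont]) (use a_gt in \<open>auto intro!: continuous_intros\<close>)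

definition "N = interval_measure F_ext"

lemma N_Icc: "s \<le> t \<Longrightarrow> emeasure N {s..t} = F_ext t - F_ext s"
  unfolding N_def by (rule emeasure_interval_measure_Icc) (auto intro: F_ext_mono F_ext_cont)

lemma sets_N: "sets N = sets borel" and space_N: "space N = UNIV"
  by (simp_all add: N_def)

lemma finite_N: "finite_measure N"
proof (rule finite_measureI)
  have right: "continuous (at_right x) F_ext" for x
    using F_ext_cont by (simp add: continuous_on_eq_continuous_within continuous_at_imp_continuous_within)
  have "(F_ext \<longlongrightarrow> 0) at_bot"
  proof (rule tendsto_eventually)
    have "\<forall>\<^sub>F x in at_bot. x \<le> 1 - a" by (rule eventually_le_at_bot)
    then show "\<forall>\<^sub>F x in at_bot. F_ext x = 0"
      by eventually_elim (use a_gt F_ends in \<open>auto simp: F_ext_def min_def max_def\<close>)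
  qed
  moreover have "(F_ext \<longlongrightarrow> 1) at_top"
  proof (rule tendsto_eventually)
    have "\<forall>\<^sub>F x in at_top. (1::real) \<le> x" by (rule eventually_ge_at_top)
    then show "\<forall>\<^sub>F x in at_top. F_ext x = 1"
      by eventually_elim (use a_gt F_ends in \<open>auto simp: F_ext_def min_def max_def\<close>)
  qed
  ultimately have "real_distribution N"
    unfolding N_def by (intro real_distribution_interval_measure) (auto intro: F_ext_mono right)
  then interpret D: real_distribution N .
  show "emeasure N (space N) \<noteq> \<infinity>" by simp
qed

sublocale N: finite_measure N by (rule finite_N)

lemma measure_N: "1 - a \<le> s \<Longrightarrow> s \<le> t \<Longrightarrow> t \<le> 1 \<Longrightarrow> measure N {s..t} = F t - F s"
  using N_Icc[of s t] F_ext_mono[of s t] by (simp add: measure_def F_ext)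

lemma N_atomless: "measure N {x} = 0"
  using N_Icc[of x x] by (simp add: measure_def)

lemma N_left: 
  assumes "B \<in> sets borel" "B \<subseteq> {1 - a..0}"
  shows "measure N (tent a ` B) = 2 * measure N B"
proof -
  have "measure N ((\<lambda>x. 1 + a * x) ` B) = 2 * measure N B"
  proof (rule emeasure_affine_image[OF finite_N sets_N N_atomless _ _ _ assms])
    fix s assume s: "1 - a \<le> s" "s \<le> 0"
    have "(\<lambda>x. 1 + a * x) ` {s..0} = tent a ` {s..0}"
      by (intro image_cong) (auto simp: tent_def)
    also have "\<dots> = {tent a s..tent a 0}"
      using s by (subst tent_image_nonpos) (auto simp: tent_def)
    finally show "measure N ((\<lambda>x. 1 + a * x) ` {s..0}) = 2 * measure N {s..0}"
      using s a_gt tent_mem[of s] F_left[of s] F_left[of 0]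
      by (simp add: measure_N tent_def)
  qed (use a_gt in auto)
  moreover have "(\<lambda>x. 1 + a * x) ` B = tent a ` B"
    using assms by (intro image_cong) (auto simp: tent_def)
  ultimately show ?thesis by simp
qed

lemma N_right: 
  assumes "B \<in> sets borel" "B \<subseteq> {0..a - 1}"
  shows "measure N (tent a ` B) = 2 * measure N B"
proof -
  have "measure N ((\<lambda>x. 1 + - a * x) ` B) = 2 * measure N B"
  proof (rule emeasure_affine_image[OF finite_N sets_N N_atomless _ _ _ assms])
    fix s assume s: "0 \<le> s" "s \<le> a - 1"
    have "(\<lambda>x. 1 + - a * x) ` {s..a - 1} = tent a ` {s..a - 1}"
      using s by (intro image_cong) (auto simp: tent_def)
    also have "\<dots> = {tent a (a - 1)..tent a s}"
      using s by (subst tent_image_nonneg) (auto simp: tent_def)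
    finally have im: "(\<lambda>x. 1 + - a * x) ` {s..a - 1} = {tent a (a - 1)..tent a s}" .
    have "a * s \<le> a * (a - 1)" using s a_gt by (intro mult_left_mono) auto
    then have "tent a (a - 1) \<le> tent a s" using s by (simp add: tent_def)
    moreover have "tent a (a - 1) \<in> {1 - a..1}" "tent a s \<in> {1 - a..1}"
      using s a_gt a_le by (auto intro!: tent_mem[unfolded atLeastAtMost_iff])
    ultimately have "measure N {tent a (a - 1)..tent a s} = F (tent a s) - F (tent a (a - 1))"
      by (intro measure_N) auto
    then show "measure N ((\<lambda>x. 1 + - a * x) ` {s..a - 1}) = 2 * measure N {s..a - 1}"
      using s a_gt a_le F_right[of s] F_right[of "a - 1"] unfolding im by (simp add: measure_N)
  qed (use a_gt in auto)
  moreover have "(\<lambda>x. 1 + - a * x) ` B = tent a ` B"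
    using assms by (intro image_cong) (auto simp: tent_def)
  ultimately show ?thesis by simp
qed

lemma N_high: 
  assumes "B \<in> sets borel" "B \<subseteq> {a - 1..1}"
  shows "measure N (tent a ` B) = measure N B"
proof -
  have "measure N ((\<lambda>x. 1 + - a * x) ` B) = 1 * measure N B"
  proof (rule emeasure_affine_image[OF finite_N sets_N N_atomless _ _ _ assms])
    fix s assume s: "a - 1 \<le> s" "s \<le> 1"
    have "(\<lambda>x. 1 + - a * x) ` {s..1} = tent a ` {s..1}"
      using s a_gt by (intro image_cong) (auto simp: tent_def)
    also have "\<dots> = {tent a 1..tent a s}"
      using s a_gt by (subst tent_image_nonneg) (auto simp: tent_def)
    finally have im: "(\<lambda>x. 1 + - a * x) ` {s..1} = {tent a 1..tent a s}" .
    have "a * s \<le> a * 1" using s a_gt by (intro mult_left_mono) auto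
    then have "tent a 1 \<le> tent a s" using s a_gt by (simp add: tent_def)
    moreover have "tent a 1 \<in> {1 - a..1}" "tent a s \<in> {1 - a..1}"
      using s a_gt a_le by (auto intro!: tent_mem[unfolded atLeastAtMost_iff])
    ultimately have "measure N {tent a 1..tent a s} = F (tent a s) - F (tent a 1)"
      by (intro measure_N) auto
    then show "measure N ((\<lambda>x. 1 + - a * x) ` {s..1}) = 1 * measure N {s..1}"
      using s a_gt a_le F_high[of s] F_high[of 1] unfolding im by (simp add: measure_N)
  qed (use a_gt in auto)
  moreover have "(\<lambda>x. 1 + - a * x) ` B = tent a ` B"
    using assms a_gt by (intro image_cong) (auto simp: tent_def)
  ultimately show ?thesis by simp
qed

definition "cdf_measure = restrict_space N I"

lemma sets_cdf_measure: "A \<in> sets cdf_measure \<longleftrightarrow> A \<in> sets borel \<and> A \<subseteq> {1 - a..1}"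
  by (auto simp: cdf_measure_def sets_restrict_space_iff sets_N I_eq space_N)

lemma measure_cdf_measure: "A \<subseteq> {1 - a..1} \<Longrightarrow> A \<in> sets borel \<Longrightarrow> emeasure cdf_measure A = ennreal (measure N A)"
  unfolding cdf_measure_def
  by (subst emeasure_restrict_space) (auto simp: sets_N space_N I_eq N.emeasure_eq_measure)

lemma tent_image_borel: 
  assumes B: "B \<in> sets borel"
  shows "tent a ` B \<in> sets borel"
proof -
  have "tent a ` B = {y. (y - 1) / a \<in> B \<inter> {..0}} \<union> {y. (1 - y) / a \<in> B \<inter> {0..}}"
  proof (intro equalityI subsetI)
    fix y assume "y \<in> tent a ` B"
    then obtain x where "x \<in> B" "y = tent a x" by auto
    then show "y \<in> {y. (y - 1) / a \<in> B \<inter> {..0}} \<union> {y. (1 - y) / a \<in> B \<inter> {0..}}"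
      using a_gt by (cases "x \<le> 0") (auto simp: tent_def)
  next
    fix y assume "y \<in> {y. (y - 1) / a \<in> B \<inter> {..0}} \<union> {y. (1 - y) / a \<in> B \<inter> {0..}}"
    then show "y \<in> tent a ` B"
    proof
      assume "y \<in> {y. (y - 1) / a \<in> B \<inter> {..0}}"
      then show ?thesis using a_gt by (intro image_eqI[of _ _ "(y - 1) / a"]) (auto simp: tent_def field_simps)
    next
      assume "y \<in> {y. (1 - y) / a \<in> B \<inter> {0..}}"
      then show ?thesis using a_gt by (intro image_eqI[of _ _ "(1 - y) / a"]) (auto simp: tent_def field_simps)
    qed
  qed
  also have "\<dots> \<in> sets borel"
  proof (rule sets.Un)
    have "(\<lambda>y. (y - 1) / a) -` (B \<inter> {..0}) \<inter> space borel \<in> sets borel"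
      by (rule measurable_sets[of _ borel borel]) (use B in auto)
    then show "{y. (y - 1) / a \<in> B \<inter> {..0}} \<in> sets borel" by (simp add: vimage_def)
    have "(\<lambda>y. (1 - y) / a) -` (B \<inter> {0..}) \<inter> space borel \<in> sets borel"
      by (rule measurable_sets[of _ borel borel]) (use B in auto)
    then show "{y. (1 - y) / a \<in> B \<inter> {0..}} \<in> sets borel" by (simp add: vimage_def)
  qed
  finally show ?thesis .
qed

lemma split_N:
  assumes "E \<in> sets borel" "E \<subseteq> {1 - a..1}"
  shows "measure N E = measure N (E \<inter> {1 - a..0}) + measure N (E \<inter> {0<..a - 1}) + measure N (E \<inter> {a - 1<..1})"
proof -
  have "E = (E \<inter> {1 - a..0}) \<union> (E \<inter> {0<..a - 1}) \<union> (E \<inter> {a - 1<..1})"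
    using assms a_gt by auto
  also have "measure N \<dots> = measure N (E \<inter> {1 - a..0} \<union> E \<inter> {0<..a - 1}) + measure N (E \<inter> {a - 1<..1})"
    using assms a_gt by (intro N.finite_measure_Union) (auto simp: sets_N)
  also have "measure N (E \<inter> {1 - a..0} \<union> E \<inter> {0<..a - 1}) = measure N (E \<inter> {1 - a..0}) + measure N (E \<inter> {0<..a - 1})"
    using assms a_gt by (intro N.finite_measure_Union) (auto simp: sets_N)
  finally show ?thesis .
qed

end

context tent_cdf
begin

lemma N_image_mid:
  assumes "E \<in> sets borel"
  shows "measure N (tent a ` (E \<inter> {1 - a..0})) = 2 * measure N (E \<inter> {1 - a..0})"
    and "measure N (tent a ` (E \<inter> {0<..a - 1})) = 2 * measure N (E \<inter> {0<..a - 1})"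
    and "measure N (tent a ` (E \<inter> {a - 1<..1})) = measure N (E \<inter> {a - 1<..1})"
proof -
  show "measure N (tent a ` (E \<inter> {1 - a..0})) = 2 * measure N (E \<inter> {1 - a..0})"
    using assms by (intro N_left) auto
  show "measure N (tent a ` (E \<inter> {0<..a - 1})) = 2 * measure N (E \<inter> {0<..a - 1})"
    using assms by (intro N_right) auto
  show "measure N (tent a ` (E \<inter> {a - 1<..1})) = measure N (E \<inter> {a - 1<..1})"
    using assms by (intro N_high) auto
qed

lemma N_total: "measure N {1 - a..1} = 1"
  using measure_N[of "1 - a" 1] a_gt F_ends by simp

lemma tent_image_preimage:
  assumes "E \<subseteq> {1 - a..1}"
  shows "tent a ` (tent a -` E \<inter> {1 - a..0}) = E \<inter> {1 - a * (a - 1)..1}"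
    and "tent a ` (tent a -` E \<inter> {0<..a - 1}) = E \<inter> {1 - a * (a - 1)..<1}"
    and "tent a ` (tent a -` E \<inter> {a - 1<..1}) = E \<inter> {1 - a..<1 - a * (a - 1)}"
proof -
  have inv: "tent a ((1 - y) / a) = y" "tent a ((y - 1) / a) = y" if "y \<le> 1" for y
    using that a_gt by (auto simp: tent_def field_simps)
  have le: "a * x \<le> a * y \<longleftrightarrow> x \<le> y" "a * x < a * y \<longleftrightarrow> x < y" for x y using a_gt by auto
  show "tent a ` (tent a -` E \<inter> {1 - a..0}) = E \<inter> {1 - a * (a - 1)..1}"
  proof (intro equalityI subsetI)
    fix y assume "y \<in> tent a ` (tent a -` E \<inter> {1 - a..0})"
    then obtain x where "y = tent a x" "tent a x \<in> E" "1 - a \<le> x" "x \<le> 0" by auto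
    then show "y \<in> E \<inter> {1 - a * (a - 1)..1}"
      using assms le(1)[of "1 - a" x] by (auto simp: tent_def algebra_simps)
  next
    fix y assume y: "y \<in> E \<inter> {1 - a * (a - 1)..1}"
    then have "(y - 1) / a \<in> tent a -` E \<inter> {1 - a..0}"
      using inv[of y] a_gt by (auto simp: field_simps)
    then show "y \<in> tent a ` (tent a -` E \<inter> {1 - a..0})"
      using inv[of y] y by (intro image_eqI[of _ _ "(y - 1) / a"]) auto
  qed
  show "tent a ` (tent a -` E \<inter> {0<..a - 1}) = E \<inter> {1 - a * (a - 1)..<1}"
  proof (intro equalityI subsetI)
    fix y assume "y \<in> tent a ` (tent a -` E \<inter> {0<..a - 1})"
    then obtain x where "y = tent a x" "tent a x \<in> E" "0 < x" "x \<le> a - 1" by auto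
    then show "y \<in> E \<inter> {1 - a * (a - 1)..<1}"
      using assms le(1)[of x "a - 1"] a_gt by (auto simp: tent_def)
  next
    fix y assume y: "y \<in> E \<inter> {1 - a * (a - 1)..<1}"
    then have "(1 - y) / a \<in> tent a -` E \<inter> {0<..a - 1}"
      using inv[of y] a_gt by (auto simp: field_simps)
    then show "y \<in> tent a ` (tent a -` E \<inter> {0<..a - 1})"
      using inv[of y] y by (intro image_eqI[of _ _ "(1 - y) / a"]) auto
  qed
  show "tent a ` (tent a -` E \<inter> {a - 1<..1}) = E \<inter> {1 - a..<1 - a * (a - 1)}"
  proof (intro equalityI subsetI)
    fix y assume "y \<in> tent a ` (tent a -` E \<inter> {a - 1<..1})"
    then obtain x where "y = tent a x" "tent a x \<in> E" "a - 1 < x" "x \<le> 1" by auto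
    then show "y \<in> E \<inter> {1 - a..<1 - a * (a - 1)}"
      using assms le(1)[of x 1] le(2)[of "a - 1" x] a_gt by (auto simp: tent_def)
  next
    fix y assume y: "y \<in> E \<inter> {1 - a..<1 - a * (a - 1)}"
    have y1: "y \<le> 1" using y c3_bounds a_le by auto
    then have "(1 - y) / a \<in> tent a -` E \<inter> {a - 1<..1}"
      using inv[of y] y a_gt by (auto simp: field_simps)
    then show "y \<in> tent a ` (tent a -` E \<inter> {a - 1<..1})"
      using inv[of y] y1 by (intro image_eqI[of _ _ "(1 - y) / a"]) auto
  qed
qed

lemma tent_borel: "tent a \<in> borel_measurable borel"
  unfolding tent_def by simp

text \<open>Up to the null point 1, a point from \<open>1 - a * (a - 1)\<close> upwards has two
  preimages, and each branch carries half of the mass there. A point below has one preimage, whose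
  branch carries all of it.\<close>

lemma N_invariant:
  assumes E: "E \<in> sets borel" "E \<subseteq> {1 - a..1}"
  shows "measure N (tent a -` E \<inter> {1 - a..1}) = measure N E"
proof -
  let ?P = "tent a -` E" and ?c = "1 - a * (a - 1)"
  have P: "?P \<in> sets borel" using measurable_sets[OF tent_borel E(1)] by simp
  have null: "{1} \<in> null_sets N"
    using N_atomless[of 1] by (intro null_setsI) (auto simp: N.emeasure_eq_measure sets_N)
  have "measure N (?P \<inter> {1 - a..1}) = measure N (?P \<inter> {1 - a..0}) + measure N (?P \<inter> {0<..a - 1}) + measure N (?P \<inter> {a - 1<..1})"
  proof -
    have "?P \<inter> {1 - a..1} \<inter> {1 - a..0} = ?P \<inter> {1 - a..0}"
      "?P \<inter> {1 - a..1} \<inter> {0<..a - 1} = ?P \<inter> {0<..a - 1}"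
      "?P \<inter> {1 - a..1} \<inter> {a - 1<..1} = ?P \<inter> {a - 1<..1}"
      using a_gt a_le by auto
    then show ?thesis using split_N[of "?P \<inter> {1 - a..1}"] P by simp
  qed
  moreover have "2 * measure N (?P \<inter> {1 - a..0}) = measure N (E \<inter> {?c..1})"
    using N_image_mid(1)[OF P] by (simp add: tent_image_preimage[OF E(2)])
  moreover have "2 * measure N (?P \<inter> {0<..a - 1}) = measure N (E \<inter> {?c..1})"
  proof -
    have "E \<inter> {?c..<1} = E \<inter> {?c..1} - {1}" by auto
    then have "measure N (E \<inter> {?c..<1}) = measure N (E \<inter> {?c..1})"
      using measure_Diff_null_set[OF _ null, of "E \<inter> {?c..1}"] E by (simp add: sets_N)
    then show ?thesis using N_image_mid(2)[OF P] by (simp add: tent_image_preimage[OF E(2)])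
  qed
  moreover have "measure N (?P \<inter> {a - 1<..1}) = measure N (E \<inter> {1 - a..<?c})"
    using N_image_mid(3)[OF P] by (simp add: tent_image_preimage[OF E(2)])
  moreover have "measure N E = measure N (E \<inter> {?c..1}) + measure N (E \<inter> {1 - a..<?c})"
  proof -
    have "E = E \<inter> {?c..1} \<union> E \<inter> {1 - a..<?c}" using E by auto
    also have "measure N \<dots> = measure N (E \<inter> {?c..1}) + measure N (E \<inter> {1 - a..<?c})"
      using E by (intro N.finite_measure_Union) (auto simp: sets_N)
    finally show ?thesis .
  qed
  ultimately show ?thesis by simp
qed

lemma N_fair:
  assumes E: "E \<in> sets borel" "E \<subseteq> {1 - a..1}" and inj: "inj_on (tent a) E"
  shows "measure N (tent a ` E) = 2 * measure N (E \<inter> {1 - a..0}) + 2 * measure N (E \<inter> {0<..a - 1})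
    + measure N (E \<inter> {a - 1<..1})"
proof -
  let ?L = "E \<inter> {1 - a..0}" and ?R = "E \<inter> {0<..a - 1}" and ?H = "E \<inter> {a - 1<..1}"
  have b: "tent a ` ?L \<in> sets N" "tent a ` ?R \<in> sets N" "tent a ` ?H \<in> sets N"
    using E by (auto intro!: tent_image_borel simp: sets_N)
  have "E = ?L \<union> ?R \<union> ?H" using E a_gt by auto
  then have "tent a ` E = tent a ` ?L \<union> tent a ` ?R \<union> tent a ` ?H" by (metis image_Un)
  also have "measure N \<dots> = measure N (tent a ` ?L \<union> tent a ` ?R) + measure N (tent a ` ?H)"
    using b inj a_gt by (intro N.finite_measure_Union) (auto dest!: inj_onD)
  also have "measure N (tent a ` ?L \<union> tent a ` ?R) = measure N (tent a ` ?L) + measure N (tent a ` ?R)"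
    using b inj by (intro N.finite_measure_Union) (auto dest!: inj_onD)
  finally show ?thesis by (simp add: N_image_mid[OF E(1)])
qed

lemma is_fair_cdf_measure: "is_fair_measure a cdf_measure"
  unfolding is_fair_measure_def
proof (intro conjI ballI impI)
  have sp: "space cdf_measure = {1 - a..1}"
    by (simp add: cdf_measure_def space_restrict_space space_N I_eq)
  show "prob_space cdf_measure"
    by (rule prob_spaceI) (simp add: sp measure_cdf_measure N_total)
  show "sets cdf_measure = sets (restrict_space borel I)"
    unfolding cdf_measure_def by (rule sets_restrict_space_cong) (rule sets_N)
  show "emeasure cdf_measure {x} = 0" if "x \<in> I" for x
    using that measure_cdf_measure[of "{x}"] by (simp add: N_atomless I_eq)
  fix E assume "E \<in> sets cdf_measure"
  then have E: "E \<in> sets borel" "E \<subseteq> {1 - a..1}" by (auto simp: sets_cdf_measure)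
  have "tent a -` E \<in> sets borel" using measurable_sets[OF tent_borel E(1)] by simp
  then show "emeasure cdf_measure (tent a -` E \<inter> I) = emeasure cdf_measure E"
    using E by (simp add: I_eq measure_cdf_measure N_invariant)
  assume inj: "inj_on (tent a) E"
  let ?L = "E \<inter> {1 - a..0}" and ?R = "E \<inter> {0<..a - 1}" and ?H = "E \<inter> {a - 1<..1}"
  have m: "?L \<in> sets cdf_measure" "?R \<in> sets cdf_measure" "?H \<in> sets cdf_measure"
    using E by (auto simp: sets_cdf_measure)
  have im: "emeasure cdf_measure (tent a ` E) = ennreal (measure N (tent a ` E))"
    using E tent_mem by (intro measure_cdf_measure tent_image_borel) auto
  have "{0} \<in> null_sets cdf_measure"
    using measure_cdf_measure[of "{0}"] a_gt by (auto simp: N_atomless null_sets_def sets_cdf_measure)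
  then have "(\<integral>\<^sup>+x\<in>E. of_nat (preimage_count a x) \<partial>cdf_measure) =
     (\<integral>\<^sup>+x. 2 * indicator ?L x + (2 * indicator ?R x + indicator ?H x) \<partial>cdf_measure)"
    by (intro nn_integral_cong_AE AE_mp[OF AE_not_in AE_I2])
      (use E a_gt in \<open>auto simp: preimage_count_eq I_eq split: split_indicator\<close>)
  also have "\<dots> = 2 * emeasure cdf_measure ?L + (2 * emeasure cdf_measure ?R + emeasure cdf_measure ?H)"
    using m by (simp add: nn_integral_add nn_integral_cmult)
  also have "\<dots> = ennreal (measure N (tent a ` E))"
    using E a_gt
    by (simp add: N_fair[OF E inj] measure_cdf_measure le_infI1 ennreal_plus ennreal_mult add.assoc)
  finally show "emeasure cdf_measure (tent a ` E) = (\<integral>\<^sup>+x\<in>E. of_nat (preimage_count a x) \<partial>cdf_measure)"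
    using im by simp
qed

end

lemma fair_measure_unique:
  assumes "fair a M" "fair a M'"
  shows "M = M'"
proof -
  interpret A: fair a M by fact
  interpret B: fair a M' by fact
  have F: "A.cdf_M x = B.cdf_M x" if "x \<in> {1 - a..1}" for x
    by (rule fair_cdf_unique[OF _ _ that])
      (intro tent_cdf.intro tent_cdf_axioms.intro A.tent_param_axioms A.fair_cdf_M B.fair_cdf_M)+
  have ida: "id \<in> borel_measurable M" and idb: "id \<in> borel_measurable M'"
    by (auto intro!: A.borel_measurable_M B.borel_measurable_M simp: id_def)
  have "cdf (distr M borel id) x = cdf (distr M' borel id) x" for x
  proof -
    consider "x < 1 - a" | "x \<in> {1 - a..1}" | "1 < x" by force
    then have "measure M ({..x} \<inter> {1 - a..1}) = measure M' ({..x} \<inter> {1 - a..1})"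
    proof cases
      case 1
      then have "{..x} \<inter> {1 - a..1} = {}" by auto
      then show ?thesis by simp
    next
      case 2
      then have eq: "{..x} \<inter> {1 - a..1} = {1 - a..x}" by auto
      show ?thesis unfolding eq using F[OF 2] by (simp add: A.cdf_M_def B.cdf_M_def)
    next
      case 3
      then have eq: "{..x} \<inter> {1 - a..1} = {1 - a..1}" by auto
      show ?thesis unfolding eq using A.cdf_M_ends B.cdf_M_ends by (simp add: A.cdf_M_def B.cdf_M_def)
    qed
    then show ?thesis
      unfolding cdf_def by (simp add: measure_distr[OF ida] measure_distr[OF idb] A.space_M B.space_M)
  qed
  then have eq: "distr M borel id = distr M' borel id"
    by (intro cdf_unique ext A.real_distribution_distr[OF ida] B.real_distribution_distr[OF idb])
  show ?thesis
  proof (rule measure_eqI)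
    show "sets M = sets M'" using A.sets_M B.sets_M by blast
    fix S assume S: "S \<in> sets M"
    then have S': "S \<in> sets borel" "S \<subseteq> {1 - a..1}" by (auto simp: A.sets_M)
    have "emeasure M S = emeasure (distr M borel id) S"
      using S' by (subst emeasure_distr[OF ida]) (auto simp: A.space_M Int_absorb2)
    also have "\<dots> = emeasure M' S"
      unfolding eq using S' by (subst emeasure_distr[OF idb]) (auto simp: B.space_M Int_absorb2)
    finally show "emeasure M S = emeasure M' S" .
  qed
qed

context tent_param
begin

lemma fair_fair_measure: "fair a (fair_measure a)"
proof -
  obtain F where "fair_cdf a F" using fair_cdf_exists by blast
  then interpret tent_cdf a F by unfold_locales
  have ex: "fair a cdf_measure" by unfold_locales (rule is_fair_cdf_measure)
  have "\<exists>!M. is_fair_measure a M"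
  proof (rule ex1I)
    show "is_fair_measure a cdf_measure" by (rule is_fair_cdf_measure)
    fix M assume "is_fair_measure a M"
    then have "fair a M" by unfold_locales
    then show "M = cdf_measure" using ex by (rule fair_measure_unique)
  qed
  then show ?thesis unfolding fair_measure_def by unfold_locales (rule theI')
qed

end

section \<open>Entropy of random variables with finitely many values\<close>

text \<open>Finite partitions are handled as functions with finitely many values: the join of two
  partitions becomes a pair, and refinement becomes a factorization
  \<open>X x = g (T x)\<close>.\<close>

definition pmass :: "'a measure \<Rightarrow> ('a \<Rightarrow> 'b) \<Rightarrow> 'b \<Rightarrow> real" where
  "pmass M X v = measure M {x \<in> space M. X x = v}"

definition ent :: "'a measure \<Rightarrow> ('a \<Rightarrow> 'b) \<Rightarrow> real" where
  "ent M X = - (\<Sum>v\<in>X ` space M. pmass M X v * ln (pmass M X v))"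

lemma pmass_nonneg: "0 \<le> pmass M X v"
  by (simp add: pmass_def)

lemma simple_function_level: "simple_function M X \<Longrightarrow> {x \<in> space M. X x = v} \<in> sets M"
proof -
  assume "simple_function M X"
  then have "X -` {v} \<inter> space M \<in> sets M" by (rule simple_functionD)
  also have "X -` {v} \<inter> space M = {x \<in> space M. X x = v}" by auto
  finally show ?thesis .
qed

lemma simple_function_finite_range: "simple_function M X \<Longrightarrow> finite (X ` space M)"
  by (rule simple_functionD)

lemma ent_superset:
  assumes "finite S" "X ` space M \<subseteq> S"
  shows "ent M X = - (\<Sum>v\<in>S. pmass M X v * ln (pmass M X v))"
proof -
  have "pmass M X v = 0" if "v \<notin> X ` space M" for v
  proof -
    have "{x \<in> space M. X x = v} = {}" using that by auto
    then show ?thesis unfolding pmass_def by (simp only: measure_empty)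
  qed
  then show ?thesis unfolding ent_def using assms by (auto intro!: sum.mono_neutral_left)
qed

context prob_space
begin

lemma measure_eq_sum_levels:
  assumes X: "simple_function M X" and E: "E \<in> sets M"
  shows "measure M E = (\<Sum>v\<in>X ` space M. measure M {x \<in> E. X x = v})"
proof -
  have sub: "E \<subseteq> space M" using E by (rule sets.sets_into_space)
  have m: "{x \<in> E. X x = v} \<in> sets M" for v
  proof -
    have "{x \<in> E. X x = v} = E \<inter> {x \<in> space M. X x = v}" using sub by auto
    then show ?thesis using E simple_function_level[OF X] by simp
  qed
  have "E = (\<Union>v\<in>X ` space M. {x \<in> E. X x = v})" using sub by auto
  also have "measure M \<dots> = (\<Sum>v\<in>X ` space M. measure M {x \<in> E. X x = v})"
    using m by (intro finite_measure_finite_Union simple_function_finite_range[OF X])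
      (auto simp: disjoint_family_on_def)
  finally show ?thesis .
qed

lemma pmass_le_1: "pmass M X v \<le> 1"
  by (simp add: pmass_def)

lemma pmass_refine_le:
  assumes T: "simple_function M T" and X: "simple_function M X"
    and g: "\<And>x. x \<in> space M \<Longrightarrow> X x = g (T x)"
  shows "pmass M T t \<le> pmass M X (g t)"
  unfolding pmass_def
  by (intro finite_measure_mono simple_function_level[OF X]) (auto simp: g)

text \<open>Writes the entropy of a coarser function as a sum over the values of a finer one, so
  that several entropies can be compared term by term.\<close>

lemma ent_refine:
  assumes T: "simple_function M T" and X: "simple_function M X"
    and g: "\<And>x. x \<in> space M \<Longrightarrow> X x = g (T x)"
  shows "ent M X = - (\<Sum>t\<in>T ` space M. pmass M T t * ln (pmass M X (g t)))"
proof -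
  let ?V = "T ` space M"
  have fin: "finite ?V" by (rule simple_function_finite_range[OF T])
  have "X ` space M = g ` ?V" using g by force
  have "(\<Sum>t\<in>?V. pmass M T t * ln (pmass M X (g t)))
      = (\<Sum>v\<in>X ` space M. \<Sum>t\<in>{t\<in>?V. g t = v}. pmass M T t * ln (pmass M X (g t)))"
    using fin g by (intro sum.group[symmetric] simple_function_finite_range[OF X]) auto
  also have "\<dots> = (\<Sum>v\<in>X ` space M. pmass M X v * ln (pmass M X v))"
  proof (rule sum.cong[OF refl])
    fix v
    have "pmass M X v = (\<Sum>t\<in>?V. measure M {x \<in> {x \<in> space M. X x = v}. T x = t})"
      unfolding pmass_def by (rule measure_eq_sum_levels[OF T simple_function_level[OF X]])
    also have "\<dots> = (\<Sum>t\<in>?V. if g t = v then pmass M T t else 0)"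
    proof (rule sum.cong[OF refl])
      fix t
      have "{x \<in> {x \<in> space M. X x = v}. T x = t} = (if g t = v then {x \<in> space M. T x = t} else {})"
        using g by auto
      then show "measure M {x \<in> {x \<in> space M. X x = v}. T x = t} = (if g t = v then pmass M T t else 0)"
        by (simp add: pmass_def)
    qed
    also have "\<dots> = (\<Sum>t\<in>{t\<in>?V. g t = v}. pmass M T t)"
      using fin by (simp add: sum.inter_filter)
    finally have "(\<Sum>t\<in>{t\<in>?V. g t = v}. pmass M T t) = pmass M X v" by simp
    then show "(\<Sum>t\<in>{t\<in>?V. g t = v}. pmass M T t * ln (pmass M X (g t))) = pmass M X v * ln (pmass M X v)"
      by (simp add: sum_distrib_right[symmetric])
  qed
  finally show ?thesis by (simp add: ent_def)
qed

lemma ent_mono: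
  assumes T: "simple_function M T" and X: "simple_function M X"
    and g: "\<And>x. x \<in> space M \<Longrightarrow> X x = g (T x)"
  shows "ent M X \<le> ent M T"
proof -
  have "(\<Sum>t\<in>T ` space M. pmass M T t * ln (pmass M T t)) \<le> (\<Sum>t\<in>T ` space M. pmass M T t * ln (pmass M X (g t)))"
  proof (rule sum_mono)
    fix t
    have "0 < pmass M T t \<Longrightarrow> ln (pmass M T t) \<le> ln (pmass M X (g t))"
      using pmass_refine_le[OF T X g, of t] by simp
    then show "pmass M T t * ln (pmass M T t) \<le> pmass M T t * ln (pmass M X (g t))"
      using pmass_nonneg[of M T t] by (cases "pmass M T t = 0") (auto intro!: mult_left_mono)
  qed
  then show ?thesis using ent_refine[OF T X g] by (simp add: ent_def)
qed

lemma ent_nonneg: "simple_function M X \<Longrightarrow> 0 \<le> ent M X"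
proof -
  have "pmass M X v * ln (pmass M X v) \<le> 0" for v
    using pmass_nonneg[of M X v] pmass_le_1[of X v]
    by (cases "pmass M X v = 0") (auto intro!: mult_nonneg_nonpos)
  then show ?thesis unfolding ent_def by (simp add: sum_nonpos)
qed

text \<open>Submodularity, from \<open>ln x \<le> x - 1\<close> applied to the ratio of \<open>P(a,b) P(b,c)\<close> and
  \<open>P(b) P(a,b,c)\<close>.\<close>

lemma ent_submodular:
  assumes A: "simple_function M A" and B: "simple_function M B" and C: "simple_function M C"
  shows "ent M (\<lambda>x. (A x, B x, C x)) + ent M B \<le> ent M (\<lambda>x. (A x, B x)) + ent M (\<lambda>x. (B x, C x))"
proof -
  let ?T = "\<lambda>x. (A x, B x, C x)" and ?AB = "\<lambda>x. (A x, B x)" and ?BC = "\<lambda>x. (B x, C x)"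
  have BC: "simple_function M ?BC" and AB: "simple_function M ?AB"
    using A B C by (auto intro: simple_function_Pair)
  have T: "simple_function M ?T" by (rule simple_function_Pair[OF A BC])
  let ?V = "?T ` space M"
  let ?p = "pmass M ?T" and ?pAB = "\<lambda>a b. pmass M ?AB (a, b)" and ?pBC = "\<lambda>b c. pmass M ?BC (b, c)"
    and ?pB = "pmass M B"
  let ?SA = "A ` space M" and ?SB = "B ` space M" and ?SC = "C ` space M"
  have fin: "finite ?SA" "finite ?SB" "finite ?SC" "finite ?V"
    using simple_function_finite_range A B C by auto (rule simple_function_finite_range[OF T])
  have eB: "ent M B = - (\<Sum>(a, b, c)\<in>?V. ?p (a, b, c) * ln (?pB b))"
    using ent_refine[OF T B, of "\<lambda>(a, b, c). b"] by (simp add: split_beta)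
  have eAB: "ent M ?AB = - (\<Sum>(a, b, c)\<in>?V. ?p (a, b, c) * ln (?pAB a b))"
    using ent_refine[OF T AB, of "\<lambda>(a, b, c). (a, b)"] by (simp add: split_beta)
  have eBC: "ent M ?BC = - (\<Sum>(a, b, c)\<in>?V. ?p (a, b, c) * ln (?pBC b c))"
    using ent_refine[OF T BC, of "\<lambda>(a, b, c). (b, c)"] by (simp add: split_beta)
  have eT: "ent M ?T = - (\<Sum>(a, b, c)\<in>?V. ?p (a, b, c) * ln (?p (a, b, c)))"
    by (simp add: ent_def split_beta)
  have le: "?p (a, b, c) \<le> ?pB b" "?p (a, b, c) \<le> ?pAB a b" "?p (a, b, c) \<le> ?pBC b c" for a b c
    using pmass_refine_le[OF T B, of "\<lambda>(a, b, c). b" "(a, b, c)"]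
      pmass_refine_le[OF T AB, of "\<lambda>(a, b, c). (a, b)" "(a, b, c)"]
      pmass_refine_le[OF T BC, of "\<lambda>(a, b, c). (b, c)" "(a, b, c)"] by auto
  have gibbs: "?p (a, b, c) * ln (?pAB a b) + ?p (a, b, c) * ln (?pBC b c) - ?p (a, b, c) * ln (?pB b)
      - ?p (a, b, c) * ln (?p (a, b, c)) \<le> ?pAB a b * ?pBC b c / ?pB b - ?p (a, b, c)" for a b c
  proof (cases "?p (a, b, c) = 0")
    case True then show ?thesis by (simp add: pmass_nonneg)
  next
    case False
    then have pos: "0 < ?p (a, b, c)" using pmass_nonneg[of M ?T "(a, b, c)"] by simp
    then have pos': "0 < ?pAB a b" "0 < ?pBC b c" "0 < ?pB b" using le[of a b c] by auto
    let ?r = "?pAB a b * ?pBC b c / (?pB b * ?p (a, b, c))"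
    have "ln ?r \<le> ?r - 1" using pos pos' by (intro ln_le_minus_one) simp
    moreover have "ln ?r = ln (?pAB a b) + ln (?pBC b c) - ln (?pB b) - ln (?p (a, b, c))"
      using pos pos' by (simp add: ln_div ln_mult)
    ultimately have "?p (a, b, c) * (ln (?pAB a b) + ln (?pBC b c) - ln (?pB b) - ln (?p (a, b, c)))
        \<le> ?p (a, b, c) * (?r - 1)" using pos by (intro mult_left_mono) auto
    also have "\<dots> = ?pAB a b * ?pBC b c / ?pB b - ?p (a, b, c)" using pos pos' by (simp add: field_simps)
    finally show ?thesis by (simp add: algebra_simps)
  qed
  have sumAB: "(\<Sum>a\<in>?SA. ?pAB a b) = ?pB b" for b
    using measure_eq_sum_levels[OF A simple_function_level[OF B], of b]
    by (simp add: pmass_def conj_commute conj_left_commute)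
  have sumBC: "(\<Sum>c\<in>?SC. ?pBC b c) = ?pB b" for b
    using measure_eq_sum_levels[OF C simple_function_level[OF B], of b]
    by (simp add: pmass_def conj_commute conj_left_commute)
  have sumT: "(\<Sum>(a, b, c)\<in>?V. ?p (a, b, c)) = 1"
  proof -
    have "measure M (space M) = (\<Sum>t\<in>?V. measure M {x \<in> space M. ?T x = t})"
      by (rule measure_eq_sum_levels[OF T]) simp
    then have "(\<Sum>t\<in>?V. ?p t) = 1" unfolding pmass_def by (simp only: prob_space)
    then show ?thesis by (simp add: split_beta)
  qed
  have sumB: "(\<Sum>b\<in>?SB. ?pB b) = 1"
    using measure_eq_sum_levels[OF B, of "space M"] prob_space by (simp add: pmass_def)
  \<comment> \<open>Enlarging the index set to the full product lets the sum factor: for fixed b the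
    sums over a and over c are both P(b), so the total is the sum of all P(b).\<close>
  have "(\<Sum>(a, b, c)\<in>?V. ?pAB a b * ?pBC b c / ?pB b) \<le> (\<Sum>(a, b, c)\<in>?SA \<times> ?SB \<times> ?SC. ?pAB a b * ?pBC b c / ?pB b)"
    using fin by (intro sum_mono2) (auto simp: pmass_nonneg)
  also have "\<dots> = (\<Sum>a\<in>?SA. \<Sum>b\<in>?SB. \<Sum>c\<in>?SC. ?pAB a b * ?pBC b c / ?pB b)"
    by (simp add: sum.cartesian_product split_beta)
  also have "\<dots> = (\<Sum>b\<in>?SB. \<Sum>a\<in>?SA. \<Sum>c\<in>?SC. ?pAB a b * ?pBC b c / ?pB b)"
    by (rule sum.swap)
  also have "\<dots> = (\<Sum>b\<in>?SB. (\<Sum>a\<in>?SA. ?pAB a b) * (\<Sum>c\<in>?SC. ?pBC b c) / ?pB b)"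
    by (simp add: sum_product sum_divide_distrib)
  also have "\<dots> = 1" by (simp add: sumAB sumBC sumB)
  finally have "(\<Sum>(a, b, c)\<in>?V. ?pAB a b * ?pBC b c / ?pB b - ?p (a, b, c)) \<le> 0"
    using sumT by (simp add: split_beta sum_subtractf)
  moreover have "(\<Sum>(a, b, c)\<in>?V. ?p (a, b, c) * ln (?pAB a b) + ?p (a, b, c) * ln (?pBC b c) - ?p (a, b, c) * ln (?pB b)
      - ?p (a, b, c) * ln (?p (a, b, c))) \<le> (\<Sum>(a, b, c)\<in>?V. ?pAB a b * ?pBC b c / ?pB b - ?p (a, b, c))"
    unfolding split_beta by (intro sum_mono) (use gibbs in auto)
  ultimately show ?thesis
    unfolding eB eAB eBC eT by (simp add: split_beta sum_subtractf sum.distrib)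
qed

text \<open>Submodularity with a constant in the middle.\<close>

lemma ent_pair_le:
  assumes A: "simple_function M A" and C: "simple_function M C"
  shows "ent M (\<lambda>x. (A x, C x)) \<le> ent M A + ent M C"
proof -
  let ?B = "\<lambda>x. ()"
  have B: "simple_function M ?B" by simp
  have AC: "simple_function M (\<lambda>x. (A x, C x))" "simple_function M (\<lambda>x. (A x, ?B x, C x))"
    "simple_function M (\<lambda>x. (A x, ?B x))" "simple_function M (\<lambda>x. (?B x, C x))"
    using A B C by (auto intro!: simple_function_Pair)
  have "ent M (\<lambda>x. (A x, C x)) \<le> ent M (\<lambda>x. (A x, ?B x, C x))"
    by (rule ent_mono[OF AC(2,1), of "\<lambda>(a, b, c). (a, c)"]) simp
  moreover have "ent M (\<lambda>x. (A x, ?B x)) \<le> ent M A"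
    by (rule ent_mono[OF A AC(3), of "\<lambda>a. (a, ())"]) simp
  moreover have "ent M (\<lambda>x. (?B x, C x)) \<le> ent M C"
    by (rule ent_mono[OF C AC(4), of "\<lambda>a. ((), a)"]) simp
  ultimately show ?thesis using ent_submodular[OF A B C] ent_nonneg[OF B] by linarith
qed

end

section \<open>Subadditivity and entropy rates of itineraries\<close>

lemma fekete_convergent:
  fixes u :: "nat \<Rightarrow> real"
  assumes sub: "\<And>m n. u (m + n) \<le> u m + u n" and nonneg: "\<And>n. 0 \<le> u n"
  shows "convergent (\<lambda>n. u n / real n)"
proof -
  let ?S = "(\<lambda>n. u n / real n) ` {1..}"
  define L where "L = Inf ?S"
  have bdd: "bdd_below ?S" using nonneg by (intro bdd_belowI[of _ 0]) auto
  have mult: "u (q * k) \<le> real q * u k" if "0 < q" for q k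
    using that
  proof (induction q rule: nat_induct_non_zero)
    case (Suc q)
    then show ?case using sub[of k "q * k"] by (simp add: algebra_simps)
  qed simp
  have "(\<lambda>n. u n / real n) \<longlonglongrightarrow> L"
  proof (rule LIMSEQ_I)
    fix e :: real assume e: "0 < e"
    have "\<exists>s\<in>?S. s < L + e / 2"
      using cInf_lessD[of ?S "L + e / 2"] e by (auto simp: L_def)
    then obtain k where k: "1 \<le> k" "u k / real k < L + e / 2" by auto
    define C where "C = (\<Sum>r<k. u r) + u k"
    obtain n0 :: nat where n0: "C / (e / 2) < real n0" using reals_Archimedean2 by blast
    show "\<exists>no. \<forall>n\<ge>no. norm (u n / real n - L) < e"
    proof (intro exI[of _ "Suc (max n0 k)"] allI impI)
      fix n assume n: "Suc (max n0 k) \<le> n"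
      let ?q = "n div k" and ?r = "n mod k"
      have q: "0 < ?q" using n k by (simp add: div_greater_zero_iff)
      have "u n \<le> u (?q * k) + u ?r" using sub[of "?q * k" ?r] by simp
      also have "u ?r \<le> C"
        using member_le_sum[of ?r "{..<k}" u] nonneg k by (simp add: C_def add_increasing2)
      also have "u (?q * k) \<le> real ?q * u k" by (rule mult[OF q])
      also have "real ?q * u k \<le> real n / real k * u k"
      proof (rule mult_right_mono[OF _ nonneg])
        have "real ?q * real k \<le> real n" by (metis div_times_less_eq_dividend of_nat_le_iff of_nat_mult)
        then show "real ?q \<le> real n / real k" using k by (simp add: field_simps)
      qed
      finally have "u n \<le> real n * (u k / real k) + C" by simp
      also have "real n * (u k / real k) \<le> real n * (L + e / 2)"
        using k by (intro mult_left_mono) auto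
      finally have "u n / real n \<le> L + e / 2 + C / real n" using n by (simp add: field_simps)
      also have "C / real n < e / 2"
      proof -
        have "C / (e / 2) < real n" using n0 n by linarith
        then show ?thesis using e n by (simp add: field_simps)
      qed
      finally have "u n / real n < L + e" by simp
      moreover have "L \<le> u n / real n"
        unfolding L_def using n by (intro cInf_lower[OF _ bdd]) auto
      ultimately show "norm (u n / real n - L) < e" by simp
    qed
  qed
  then show ?thesis by (rule convergentI)
qed

definition itin :: "('a \<Rightarrow> 'a) \<Rightarrow> ('a \<Rightarrow> 'b) \<Rightarrow> nat \<Rightarrow> 'a \<Rightarrow> 'b list" where
  "itin f X n x = map (\<lambda>i. X ((f ^^ i) x)) [0..<n]"

lemma itin_add: "itin f X (m + n) x = itin f X m x @ itin f X n ((f ^^ m) x)"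
  by (rule nth_equalityI) (auto simp: itin_def nth_append funpow_add[symmetric] comp_def
      simp flip: fun_cong[OF funpow_add, unfolded comp_def])

lemma itin_Suc: "itin f X (Suc n) x = itin f X n x @ [X ((f ^^ n) x)]"
  by (simp add: itin_def)

lemma length_itin: "length (itin f X n x) = n"
  by (simp add: itin_def)

lemma itin_eq_iff: "itin f X n x = itin f X n y \<longleftrightarrow> (\<forall>i<n. X ((f ^^ i) x) = X ((f ^^ i) y))"
  by (auto simp: itin_def)

locale measure_preserving = prob_space M for M :: "'a measure" +
  fixes f :: "'a \<Rightarrow> 'a"
  assumes f_meas: "f \<in> measurable M M"
    and f_inv: "\<And>A. A \<in> sets M \<Longrightarrow> measure M (f -` A \<inter> space M) = measure M A"
begin

lemma f_space: "x \<in> space M \<Longrightarrow> f x \<in> space M"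
  using measurable_space[OF f_meas] .

lemma funpow_meas: "f ^^ n \<in> measurable M M"
proof (induction n)
  case (Suc n)
  then show ?case using measurable_comp[OF Suc f_meas] by (simp only: funpow.simps)
qed (simp add: id_def)

lemma funpow_space: "x \<in> space M \<Longrightarrow> (f ^^ n) x \<in> space M"
  using measurable_space[OF funpow_meas] .

lemma funpow_inv: "A \<in> sets M \<Longrightarrow> measure M ((f ^^ n) -` A \<inter> space M) = measure M A"
proof (induction n)
  case 0
  then show ?case using sets.sets_into_space[of A M] by (simp add: Int_absorb2)
next
  case (Suc n)
  have "(f ^^ Suc n) -` A \<inter> space M = f -` ((f ^^ n) -` A \<inter> space M) \<inter> space M"
    using f_space by (auto simp: funpow_swap1)
  then show ?case using Suc f_inv[of "(f ^^ n) -` A \<inter> space M"] measurable_sets[OF funpow_meas Suc.prems, of n]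
    by (simp only:)
qed

lemma simple_shift:
  assumes X: "simple_function M X"
  shows "simple_function M (\<lambda>x. X ((f ^^ n) x))"
  unfolding simple_function_def
proof (intro conjI ballI)
  have "(\<lambda>x. X ((f ^^ n) x)) ` space M \<subseteq> X ` space M" using funpow_space by auto
  then show "finite ((\<lambda>x. X ((f ^^ n) x)) ` space M)"
    using simple_function_finite_range[OF X] finite_subset by blast
  fix v
  have "(\<lambda>x. X ((f ^^ n) x)) -` {v} \<inter> space M = (f ^^ n) -` {x \<in> space M. X x = v} \<inter> space M"
    using funpow_space by auto
  then show "(\<lambda>x. X ((f ^^ n) x)) -` {v} \<inter> space M \<in> sets M"
    using measurable_sets[OF funpow_meas simple_function_level[OF X]] by simp
qed

lemma ent_shift:
  assumes X: "simple_function M X"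
  shows "ent M (\<lambda>x. X ((f ^^ n) x)) = ent M X"
proof -
  have "pmass M (\<lambda>x. X ((f ^^ n) x)) v = pmass M X v" for v
  proof -
    have "{x \<in> space M. X ((f ^^ n) x) = v} = (f ^^ n) -` {x \<in> space M. X x = v} \<inter> space M"
      using funpow_space by auto
    then show ?thesis unfolding pmass_def using funpow_inv[OF simple_function_level[OF X]] by simp
  qed
  moreover have "(\<lambda>x. X ((f ^^ n) x)) ` space M \<subseteq> X ` space M" using funpow_space by auto
  ultimately show ?thesis
    using ent_superset[OF simple_function_finite_range[OF X], of "\<lambda>x. X ((f ^^ n) x)" M]
    by (simp add: ent_def[of M X])
qed

lemma simple_itin: "simple_function M X \<Longrightarrow> simple_function M (itin f X n)"
proof (induction n)
  case 0
  have "itin f X 0 = (\<lambda>_. [])" by (auto simp: itin_def)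
  then show ?case by simp
next
  case (Suc n)
  have eq: "itin f X (Suc n) = (\<lambda>(l, v). l @ [v]) \<circ> (\<lambda>x. (itin f X n x, X ((f ^^ n) x)))"
    by (auto simp: itin_Suc)
  have "simple_function M (\<lambda>x. (itin f X n x, X ((f ^^ n) x)))"
    using Suc by (intro simple_function_Pair simple_shift) auto
  then show ?case unfolding eq by (rule simple_function_compose)
qed

lemma ent_itin_add:
  assumes X: "simple_function M X"
  shows "ent M (itin f X (m + n)) \<le> ent M (itin f X m) + ent M (itin f X n)"
proof -
  let ?Y = "\<lambda>x. (itin f X m x, itin f X n ((f ^^ m) x))"
  note s = simple_itin[OF X]
  have Y: "simple_function M ?Y" using s simple_shift[OF s] by (rule simple_function_Pair)
  have "ent M (itin f X (m + n)) \<le> ent M ?Y"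
    by (rule ent_mono[OF Y s, where g = "\<lambda>(l, k). l @ k"]) (simp add: itin_add)
  also have "\<dots> \<le> ent M (itin f X m) + ent M (\<lambda>x. itin f X n ((f ^^ m) x))"
    by (rule ent_pair_le[OF s simple_shift[OF s]])
  finally show ?thesis by (simp add: ent_shift[OF s])
qed

lemma ent_itin_convergent:
  assumes X: "simple_function M X"
  shows "convergent (\<lambda>n. ent M (itin f X n) / real n)"
  by (rule fekete_convergent) (auto intro: ent_itin_add ent_nonneg simple_itin X)

text \<open>In terms of conditional entropies, which are written here as differences:
  \<open>H(X-word | Y-word) \<le> n * H(X | Y)\<close>. Each new X-symbol is conditioned on the
  Y-symbol of the same time alone.\<close>

lemma ent_itin_conditional:
  assumes X: "simple_function M X" and Y: "simple_function M Y"
  shows "ent M (\<lambda>x. (itin f X n x, itin f Y n x)) - ent M (itin f Y n)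
    \<le> real n * (ent M (\<lambda>x. (X x, Y x)) - ent M Y)"
proof (induction n)
  case 0
  have "ent M (\<lambda>x. (itin f X 0 x, itin f Y 0 x)) \<le> ent M (itin f Y 0)"
    by (rule ent_mono[where g = "\<lambda>l. ([], l)"])
      (auto simp: itin_def[of f X] intro!: simple_itin Y simple_function_Pair)
  then show ?case by simp
next
  case (Suc n)
  let ?A = "itin f X n" and ?B = "itin f Y n" and ?C = "\<lambda>x. X ((f ^^ n) x)" and ?D = "\<lambda>x. Y ((f ^^ n) x)"
  note sA = simple_itin[OF X, of n] and sB = simple_itin[OF Y, of n]
    and sC = simple_shift[OF X, of n] and sD = simple_shift[OF Y, of n]
  note P = simple_function_Pair
  have 1: "ent M (\<lambda>x. (itin f X (Suc n) x, itin f Y (Suc n) x)) \<le> ent M (\<lambda>x. ((?A x, ?B x), ?D x, ?C x))"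
    by (rule ent_mono[OF P[OF P[OF sA sB] P[OF sD sC]] P[OF simple_itin[OF X] simple_itin[OF Y]],
          where g = "\<lambda>((a, b), d, c). (a @ [c], b @ [d])"]) (simp add: itin_Suc)
  \<comment> \<open>\<open>H(C | A, B, D) \<le> H(C | D)\<close>.\<close>
  have 2: "ent M (\<lambda>x. ((?A x, ?B x), ?D x, ?C x)) + ent M ?D
      \<le> ent M (\<lambda>x. ((?A x, ?B x), ?D x)) + ent M (\<lambda>x. (?D x, ?C x))"
    by (intro ent_submodular P sA sB sC sD)
  \<comment> \<open>\<open>H(A | B, D) \<le> H(A | B)\<close>.\<close>
  have 3: "ent M (\<lambda>x. (?A x, ?B x, ?D x)) + ent M ?B
      \<le> ent M (\<lambda>x. (?A x, ?B x)) + ent M (\<lambda>x. (?B x, ?D x))"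
    by (intro ent_submodular P sA sB sC sD)
  have 4: "ent M (\<lambda>x. ((?A x, ?B x), ?D x)) \<le> ent M (\<lambda>x. (?A x, ?B x, ?D x))"
    by (rule ent_mono[where g = "\<lambda>(a, b, d). ((a, b), d)"]) (auto intro!: P sA sB sD)
  have 5: "ent M (\<lambda>x. (?B x, ?D x)) \<le> ent M (itin f Y (Suc n))"
    by (rule ent_mono[OF simple_itin[OF Y] P[OF sB sD], where g = "\<lambda>l. (butlast l, last l)"])
      (simp add: itin_Suc)
  have "ent M (\<lambda>x. (?D x, ?C x)) = ent M (\<lambda>x. (Y x, X x))"
    using ent_shift[OF P[OF Y X], of n] by simp
  also have "\<dots> \<le> ent M (\<lambda>x. (X x, Y x))"
    by (rule ent_mono[where g = "\<lambda>(a, b). (b, a)"]) (auto intro!: P X Y)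
  finally have 6: "ent M (\<lambda>x. (?D x, ?C x)) \<le> ent M (\<lambda>x. (X x, Y x))" .
  have 7: "ent M ?D = ent M Y" by (rule ent_shift[OF Y])
  show ?case using 1 2 3 4 5 6 7 Suc by (simp add: algebra_simps)
qed

lemma ent_itin_le:
  assumes X: "simple_function M X" and Y: "simple_function M Y"
  shows "ent M (itin f X n) \<le> ent M (itin f Y n) + real n * (ent M (\<lambda>x. (X x, Y x)) - ent M Y)"
proof -
  have "ent M (itin f X n) \<le> ent M (\<lambda>x. (itin f X n x, itin f Y n x))"
    by (rule ent_mono[where g = fst]) (auto intro!: simple_function_Pair simple_itin X Y)
  then show ?thesis using ent_itin_conditional[OF X Y, of n] by simp
qed

text \<open>A word of n + k symbols contains the n windows of length k that determine the word of Y,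
  so coding by blocks costs only the fixed length k.\<close>

lemma ent_itin_block:
  assumes s: "simple_function M s" and Y: "simple_function M Y"
    and g: "\<And>x. x \<in> space M \<Longrightarrow> Y x = g (itin f s k x)"
  shows "ent M (itin f Y n) \<le> ent M (itin f s (n + k))"
proof (rule ent_mono[where g = "\<lambda>l. map (\<lambda>i. g (take k (drop i l))) [0..<n]"])
  fix x assume x: "x \<in> space M"
  have "take k (drop i (itin f s (n + k) x)) = itin f s k ((f ^^ i) x)" if "i < n" for i
  proof -
    have "itin f s (n + k) x = itin f s i x @ itin f s k ((f ^^ i) x) @ itin f s (n - i) ((f ^^ (i + k)) x)"
    proof -
      have "n + k = (i + k) + (n - i)" using that by simp
      then show ?thesis by (simp only: itin_add append_assoc)
    qed
    then show ?thesis by (simp add: length_itin)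
  qed
  then show "itin f Y n x = map (\<lambda>i. g (take k (drop i (itin f s (n + k) x)))) [0..<n]"
    using g[OF funpow_space[OF x]] by (auto simp: itin_def[of f Y])
qed (auto intro: simple_itin s Y)

section \<open>Finite partitions as functions\<close>

definition partition_index :: "'a set set \<Rightarrow> 'a \<Rightarrow> 'a set" where
  "partition_index \<xi> x = (THE A. A \<in> \<xi> \<and> x \<in> A)"

lemma partition_index:
  assumes "partition_on (space M) \<xi>" "x \<in> space M"
  shows "partition_index \<xi> x \<in> \<xi>" "x \<in> partition_index \<xi> x"
    and "A \<in> \<xi> \<Longrightarrow> x \<in> A \<longleftrightarrow> A = partition_index \<xi> x"
proof -
  have "\<exists>!A. A \<in> \<xi> \<and> x \<in> A"
    using assms by (auto simp: partition_on_def disjoint_def)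
  from theI'[OF this] show 1: "partition_index \<xi> x \<in> \<xi>" "x \<in> partition_index \<xi> x"
    by (auto simp: partition_index_def)
  show "A \<in> \<xi> \<Longrightarrow> x \<in> A \<longleftrightarrow> A = partition_index \<xi> x"
    using \<open>\<exists>!A. A \<in> \<xi> \<and> x \<in> A\<close> 1 by auto
qed

lemma simple_partition_index:
  assumes \<xi>: "partition_on (space M) \<xi>" "finite \<xi>" "\<xi> \<subseteq> sets M"
  shows "simple_function M (partition_index \<xi>)"
  unfolding simple_function_def
proof (intro conjI ballI)
  show "finite (partition_index \<xi> ` space M)"
    using partition_index(1)[OF \<xi>(1)] by (intro finite_subset[OF _ \<xi>(2)]) auto
  fix A assume "A \<in> partition_index \<xi> ` space M"
  then have A: "A \<in> \<xi>" using partition_index(1)[OF \<xi>(1)] by auto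
  have "A \<subseteq> space M" using A \<xi>(3) sets.sets_into_space by blast
  have "partition_index \<xi> -` {A} \<inter> space M = A"
  proof (intro equalityI subsetI)
    fix x assume "x \<in> partition_index \<xi> -` {A} \<inter> space M"
    then show "x \<in> A" using partition_index(2)[OF \<xi>(1), of x] by simp
  next
    fix x assume "x \<in> A"
    then show "x \<in> partition_index \<xi> -` {A} \<inter> space M"
      using \<open>A \<subseteq> space M\<close> partition_index(3)[OF \<xi>(1) _ A, of x] by auto
  qed
  then show "partition_index \<xi> -` {A} \<inter> space M \<in> sets M" using A \<xi> by auto
qed

text \<open>A cell of the refinement is a nonempty intersection given by a choice function, and any
  point of the cell determines that choice through its itinerary. For n = 0 the intersection is over
  the empty family, hence all of the type and not the space of M.\<close>

lemma dynamical_refinement_eq: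
  assumes \<xi>: "partition_on (space M) \<xi>" and n: "0 < n"
  shows "dynamical_refinement M f \<xi> n =
    (\<lambda>v. {x \<in> space M. itin f (partition_index \<xi>) n x = v}) ` itin f (partition_index \<xi>) n ` space M"
proof -
  let ?X = "partition_index \<xi>"
  let ?Q = "\<lambda>i. (\<lambda>A. (f ^^ i) -` A \<inter> space M) ` \<xi>"
  let ?\<P> = "?Q ` {..<n}"
  let ?cell = "\<lambda>x. {y \<in> space M. itin f ?X n y = itin f ?X n x}"
  have cell: "\<Inter> (g ` ?\<P>) = ?cell x"
    if x: "x \<in> space M" and g: "\<And>P. P \<in> ?\<P> \<Longrightarrow> g P \<in> P" "\<And>P. P \<in> ?\<P> \<Longrightarrow> x \<in> g P" for g x
  proof -
    have gQ: "g (?Q i) = (f ^^ i) -` (?X ((f ^^ i) x)) \<inter> space M" if "i < n" for i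
    proof -
      have "?Q i \<in> ?\<P>" using that by auto
      then obtain A where A: "A \<in> \<xi>" "g (?Q i) = (f ^^ i) -` A \<inter> space M" "x \<in> (f ^^ i) -` A"
        using g[of "?Q i"] by auto
      then show ?thesis using partition_index(3)[OF \<xi> funpow_space[OF x], of A i] by auto
    qed
    have "\<Inter> (g ` ?\<P>) = (\<Inter>i<n. g (?Q i))" by auto
    also have "\<dots> = (\<Inter>i<n. (f ^^ i) -` (?X ((f ^^ i) x)) \<inter> space M)"
      by (intro INF_cong refl) (use gQ in auto)
    also have "\<dots> = ?cell x"
    proof (rule set_eqI)
      fix y
      have iff: "(f ^^ i) y \<in> ?X ((f ^^ i) x) \<longleftrightarrow> ?X ((f ^^ i) y) = ?X ((f ^^ i) x)" if "y \<in> space M" for i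
        using partition_index(3)[OF \<xi> funpow_space[OF that], of "?X ((f ^^ i) x)"]
          partition_index(1)[OF \<xi> funpow_space[OF x]] by auto
      show "y \<in> (\<Inter>i<n. (f ^^ i) -` (?X ((f ^^ i) x)) \<inter> space M) \<longleftrightarrow> y \<in> ?cell x"
        using n iff by (cases "y \<in> space M") (auto simp: itin_eq_iff)
    qed
    finally show ?thesis .
  qed
  show ?thesis
    unfolding dynamical_refinement_def
  proof (intro equalityI subsetI)
    fix W assume "W \<in> common_refinement ?\<P>"
    then obtain g where g: "g \<in> (\<Pi>\<^sub>E P\<in>?\<P>. P)" "W = \<Inter> (g ` ?\<P>)" and ne: "W \<noteq> {}"
      unfolding common_refinement_def by blast
    then obtain x where x: "x \<in> W" by blast
    have gP: "g P \<in> P" "x \<in> g P" if "P \<in> ?\<P>" for P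
    proof -
      show "g P \<in> P" by (rule PiE_mem[OF g(1) that])
      show "x \<in> g P" using x unfolding g(2) by (rule InterD) (rule imageI[OF that])
    qed
    have "?Q 0 \<in> ?\<P>" using n by (intro imageI) simp
    from gP[OF this] have xs: "x \<in> space M" by blast
    have "W = ?cell x" unfolding g(2) by (rule cell[OF xs gP])
    then show "W \<in> (\<lambda>v. {x \<in> space M. itin f ?X n x = v}) ` itin f ?X n ` space M"
      using xs by (simp only: image_image) (rule imageI)
  next
    fix W assume "W \<in> (\<lambda>v. {x \<in> space M. itin f ?X n x = v}) ` itin f ?X n ` space M"
    then obtain x where x: "x \<in> space M" "W = ?cell x" by (elim imageE) simp
    have ex: "\<exists>A. A \<in> P \<and> x \<in> A" if mem: "P \<in> ?\<P>" for P
    proof -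
      from mem obtain i where P: "P = ?Q i" by (elim imageE)
      let ?A = "(f ^^ i) -` ?X ((f ^^ i) x) \<inter> space M"
      have "?A \<in> P" unfolding P by (rule imageI) (rule partition_index(1)[OF \<xi> funpow_space[OF x(1)]])
      moreover have "x \<in> ?A" using x(1) partition_index(2)[OF \<xi> funpow_space[OF x(1)]] by simp
      ultimately show ?thesis by blast
    qed
    define g where "g P = (SOME A. A \<in> P \<and> x \<in> A)" for P
    have g: "g P \<in> P \<and> x \<in> g P" if "P \<in> ?\<P>" for P
      unfolding g_def by (rule someI_ex[OF ex[OF that]])
    have W: "\<Inter> (g ` ?\<P>) = W"
      unfolding x(2) by (rule cell[OF x(1) g[THEN conjunct1] g[THEN conjunct2]])
    have "x \<in> W" using x by simp
    then have "W \<noteq> {}" by blast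
    moreover have "g \<in> (\<Pi> P\<in>?\<P>. P)" by (rule Pi_I) (rule g[THEN conjunct1])
    ultimately show "W \<in> common_refinement ?\<P>"
      unfolding common_refinement W[symmetric] by blast
  qed
qed

lemma partition_entropy_refinement:
  assumes \<xi>: "partition_on (space M) \<xi>" and n: "0 < n"
  shows "partition_entropy M (dynamical_refinement M f \<xi> n) = ent M (itin f (partition_index \<xi>) n)"
proof -
  let ?X = "itin f (partition_index \<xi>) n"
  have "inj_on (\<lambda>v. {x \<in> space M. ?X x = v}) (?X ` space M)"
  proof (rule inj_onI)
    fix v w
    assume v: "v \<in> ?X ` space M" and eq: "{x \<in> space M. ?X x = v} = {x \<in> space M. ?X x = w}"
    obtain x where "x \<in> space M" "?X x = v" using v by auto
    then have "x \<in> {x \<in> space M. ?X x = w}" unfolding eq[symmetric] by simp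
    then show "v = w" using \<open>?X x = v\<close> by simp
  qed
  then show ?thesis
    unfolding partition_entropy_def dynamical_refinement_eq[OF \<xi> n] ent_def pmass_def
    by (simp add: sum.reindex)
qed

end

section \<open>Entropy of nearby functions and the generator theorem\<close>

lemma abs_x_ln_x_le: "0 \<le> x \<Longrightarrow> x \<le> 1 \<Longrightarrow> \<bar>x * ln x\<bar> \<le> 2 * sqrt (x::real)"
proof (cases "x = 0")
  case False
  assume "0 \<le> x" "x \<le> 1"
  with False have x: "0 < x" "x \<le> 1" by auto
  have "ln (1 / sqrt x) \<le> 1 / sqrt x" using ln_le_minus_one[of "1 / sqrt x"] x by simp
  then have "- ln x \<le> 2 / sqrt x" using x by (simp add: ln_div ln_sqrt)
  then have "x * (- ln x) \<le> x * (2 / sqrt x)" using x by (intro mult_left_mono) auto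
  also have "\<dots> = 2 * sqrt x" using x by (simp add: field_simps)
  finally show ?thesis using x by (simp add: abs_mult)
qed simp

lemma continuous_x_ln_x: "continuous_on {0..} (\<lambda>x::real. x * ln x)"
  unfolding continuous_on_eq_continuous_within
proof
  fix x :: real assume "x \<in> {0..}"
  show "continuous (at x within {0..}) (\<lambda>x. x * ln x)"
  proof (cases "x = 0")
    case False
    then show ?thesis using \<open>x \<in> {0..}\<close> by (intro continuous_intros) auto
  next
    case True
    have "((\<lambda>x::real. x * ln x) \<longlongrightarrow> 0) (at 0 within {0..})"
    proof (rule tendsto_rabs_zero_cancel, rule tendsto_sandwich[OF _ _ tendsto_const])
      show "\<forall>\<^sub>F x::real in at 0 within {0..}. \<bar>x * ln x\<bar> \<le> 2 * sqrt x"
        unfolding eventually_at by (rule exI[of _ 1]) (auto simp: dist_real_def intro!: abs_x_ln_x_le)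
      have "((\<lambda>x::real. 2 * sqrt x) \<longlongrightarrow> 2 * sqrt 0) (at 0 within {0..})"
        by (intro tendsto_intros)
      then show "((\<lambda>x::real. 2 * sqrt x) \<longlongrightarrow> 0) (at 0 within {0..})" by simp
    qed auto
    then show ?thesis using True by (simp add: continuous_within)
  qed
qed

lemma tendsto_x_ln_x:
  assumes "u \<longlonglongrightarrow> l" "\<And>n. 0 \<le> u n" 
  shows "(\<lambda>n. u n * ln (u n :: real)) \<longlonglongrightarrow> l * ln l"
proof -
  have "0 \<le> l" by (rule LIMSEQ_le_const[OF assms(1)]) (use assms(2) in auto)
  then show ?thesis
    using continuous_on_tendsto_compose[OF continuous_x_ln_x assms(1)] assms(2) by simp
qed

text \<open>The masses of the pairs converge to those of \<open>(X, X)\<close>, since all deviations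
  are bounded by the mass of the set where X and \<open>Y k\<close> differ. All values lie in one
  finite set, so the entropies are fixed finite sums of continuous functions of these
  masses.\<close>

lemma (in prob_space) ent_perturbation:
  assumes X: "simple_function M X" and Y: "\<And>k. simple_function M (Y k)" "\<And>k. Y k ` space M \<subseteq> X ` space M"
    and lim: "(\<lambda>k. measure M {x \<in> space M. X x \<noteq> Y k x}) \<longlonglongrightarrow> 0"
  shows "(\<lambda>k. ent M (\<lambda>x. (X x, Y k x)) - ent M (Y k)) \<longlonglongrightarrow> 0"
proof -
  let ?S = "X ` space M" and ?e = "\<lambda>k. measure M {x \<in> space M. X x \<noteq> Y k x}"
  let ?p = "\<lambda>k a b. pmass M (\<lambda>x. (X x, Y k x)) (a, b)"
  have fin: "finite ?S" by (rule simple_function_finite_range[OF X])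
  have diff: "{x \<in> space M. X x \<noteq> Y k x} \<in> sets M" for k
  proof -
    have "{x \<in> space M. X x \<noteq> Y k x} = (\<Union>v\<in>?S. {x \<in> space M. X x = v} - {x \<in> space M. Y k x = v})" by auto
    also have "\<dots> \<in> sets M"
      by (intro sets.finite_UN fin sets.Diff simple_function_level[OF X] simple_function_level[OF Y(1)])
    finally show ?thesis .
  qed
  have XY: "simple_function M (\<lambda>x. (X x, Y k x))" for k by (rule simple_function_Pair[OF X Y(1)])
  have near: "\<bar>measure M A - measure M B\<bar> \<le> ?e k"
    if "A \<in> sets M" "B \<in> sets M" "A - B \<subseteq> {x \<in> space M. X x \<noteq> Y k x}" "B - A \<subseteq> {x \<in> space M. X x \<noteq> Y k x}" for A B k
  proof -
    have "measure M A \<le> measure M B + ?e k"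
      by (rule order_trans[OF finite_measure_mono measure_Un_le]) (use that diff in auto)
    moreover have "measure M B \<le> measure M A + ?e k"
      by (rule order_trans[OF finite_measure_mono measure_Un_le]) (use that diff in auto)
    ultimately show ?thesis by linarith
  qed
  have to: "u \<longlonglongrightarrow> l" if "\<And>k. \<bar>u k - l\<bar> \<le> ?e k" for u and l :: real
  proof (rule LIM_zero_cancel, rule Lim_null_comparison[OF _ lim])
    show "\<forall>\<^sub>F k in sequentially. norm (u k - l) \<le> ?e k" using that by simp
  qed
  have limY: "(\<lambda>k. pmass M (Y k) b) \<longlonglongrightarrow> pmass M X b" for b
    unfolding pmass_def
    by (rule to, rule near) (auto intro: simple_function_level X Y)
  have limp: "(\<lambda>k. ?p k a b) \<longlonglongrightarrow> (if a = b then pmass M X b else 0)" for a b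
  proof (rule to)
    fix k
    have "(if a = b then pmass M X b else 0) = measure M (if a = b then {x \<in> space M. X x = b} else {})"
      by (simp add: pmass_def)
    moreover have "\<bar>?p k a b - measure M (if a = b then {x \<in> space M. X x = b} else {})\<bar> \<le> ?e k"
      unfolding pmass_def
      by (rule near[OF simple_function_level[OF XY]]) (auto intro: simple_function_level[OF X])
    ultimately show "\<bar>?p k a b - (if a = b then pmass M X b else 0)\<bar> \<le> ?e k"
      by (simp only:)
  qed
  have e1: "ent M (\<lambda>x. (X x, Y k x)) = - (\<Sum>a\<in>?S. \<Sum>b\<in>?S. ?p k a b * ln (?p k a b))" for k
  proof -
    have "ent M (\<lambda>x. (X x, Y k x)) = - (\<Sum>v\<in>?S \<times> ?S. pmass M (\<lambda>x. (X x, Y k x)) v * ln (pmass M (\<lambda>x. (X x, Y k x)) v))"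
      using fin Y(2) by (intro ent_superset) auto
    then show ?thesis by (simp add: sum.cartesian_product split_beta)
  qed
  have e2: "ent M (Y k) = - (\<Sum>b\<in>?S. pmass M (Y k) b * ln (pmass M (Y k) b))" for k
    using fin Y(2) by (intro ent_superset) auto
  let ?q = "\<lambda>a b. if a = b then pmass M X b else 0"
  have "(\<lambda>k. ent M (\<lambda>x. (X x, Y k x)) - ent M (Y k)) \<longlonglongrightarrow>
      - (\<Sum>a\<in>?S. \<Sum>b\<in>?S. ?q a b * ln (?q a b)) - - (\<Sum>b\<in>?S. pmass M X b * ln (pmass M X b))"
    unfolding e1 e2
    by (intro tendsto_diff tendsto_minus tendsto_sum tendsto_x_ln_x limp limY pmass_nonneg)
  also have "(\<Sum>a\<in>?S. \<Sum>b\<in>?S. ?q a b * ln (?q a b)) = (\<Sum>a\<in>?S. \<Sum>b\<in>?S. if a = b then pmass M X b * ln (pmass M X b) else 0)"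
    by (intro sum.cong refl) simp
  also have "\<dots> = (\<Sum>b\<in>?S. pmass M X b * ln (pmass M X b))"
    using fin by (intro sum.cong refl) (simp add: sum.delta')
  finally show ?thesis by simp
qed

locale real_measure_preserving = measure_preserving M f for M :: "real measure" and f +
  assumes sets_borel: "A \<in> sets M \<Longrightarrow> A \<in> sets borel" and id_meas: "id \<in> borel_measurable M"
begin

lemma borel_sets: "A \<in> sets borel \<Longrightarrow> A \<subseteq> space M \<Longrightarrow> A \<in> sets M"
  using measurable_sets[OF id_meas, of A] by (simp add: Int_absorb2)

lemma inner_compact:
  assumes A: "A \<in> sets M" and e: "0 < e"
  obtains K where "compact K" "K \<subseteq> A" "K \<in> sets M" "measure M (A - K) < e"
proof -
  have sub: "A \<subseteq> space M" using A by (rule sets.sets_into_space)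
  interpret D: prob_space "distr M borel id" by (rule prob_space_distr[OF id_meas])
  have D: "emeasure (distr M borel id) B = measure M B" if "B \<subseteq> space M" "B \<in> sets borel" for B
    using that by (simp add: emeasure_distr[OF id_meas] Int_absorb2 emeasure_eq_measure)
  show thesis
  proof (cases "measure M A < e")
    case True
    then show thesis using that[of "{}"] by auto
  next
    case False
    have "ennreal (measure M A - e) < emeasure (distr M borel id) A"
      using D[OF sub sets_borel[OF A]] e False by (simp add: ennreal_less_iff)
    also have "\<dots> = (SUP K \<in> {K. K \<subseteq> A \<and> compact K}. emeasure (distr M borel id) K)"
      by (rule inner_regular) (use sets_borel[OF A] in auto)
    finally obtain K where K: "K \<subseteq> A" "compact K" "ennreal (measure M A - e) < emeasure (distr M borel id) K"
      by (auto simp: less_SUP_iff)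
    have KM: "K \<in> sets M" using K sub by (intro borel_sets borel_compact) auto
    have "measure M A - e < measure M K"
      using K(3) D[of K] K(1) sub sets_borel[OF KM] False by (simp add: ennreal_less_iff)
    then have "measure M (A - K) < e" using finite_measure_Diff[OF A KM K(1)] by simp
    then show thesis using that[of K] K KM by simp
  qed
qed

text \<open>The level sets of X are exhausted by disjoint compact sets up to small mass. These have
  positive mutual distances, so a sufficiently long itinerary meets at most one of them and g can
  read off its label.\<close>

lemma generator_approx:
  assumes s: "simple_function M s"
    and gen: "\<And>d. 0 < d \<Longrightarrow> \<exists>n. \<forall>x\<in>space M. \<forall>y\<in>space M. itin f s n x = itin f s n y \<longrightarrow> dist x y < d"
    and X: "simple_function M X" and e: "0 < e"
  shows "\<exists>n g. simple_function M (\<lambda>x. g (itin f s n x)) \<and> (\<forall>x\<in>space M. g (itin f s n x) \<in> X ` space M) \<and>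
    measure M {x \<in> space M. X x \<noteq> g (itin f s n x)} < e"
proof -
  let ?S = "X ` space M" and ?A = "\<lambda>v. {x \<in> space M. X x = v}"
  have fin: "finite ?S" by (rule simple_function_finite_range[OF X])
  have ne: "?S \<noteq> {}" using not_empty by simp
  define e' where "e' = e / (real (card ?S) + 1)"
  have e': "0 < e'" using e by (simp add: e'_def)
  have "\<exists>K. compact K \<and> K \<subseteq> ?A v \<and> K \<in> sets M \<and> measure M (?A v - K) < e'" for v
    by (rule inner_compact[OF simple_function_level[OF X] e', of v]) blast
  then have "\<exists>K. \<forall>v. compact (K v) \<and> K v \<subseteq> ?A v \<and> K v \<in> sets M \<and> measure M (?A v - K v) < e'"
    by (intro choice allI)
  then obtain K where K0: "\<forall>v. compact (K v) \<and> K v \<subseteq> ?A v \<and> K v \<in> sets M \<and> measure M (?A v - K v) < e'"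
    by (rule exE)
  note K = K0[rule_format, THEN conjunct1] K0[rule_format, THEN conjunct2, THEN conjunct1]
    K0[rule_format, THEN conjunct2, THEN conjunct2, THEN conjunct1]
    K0[rule_format, THEN conjunct2, THEN conjunct2, THEN conjunct2]
  have "\<exists>d>0. \<forall>x\<in>K v. \<forall>y\<in>K w. v \<noteq> w \<longrightarrow> d \<le> dist x y" for v w
  proof (cases "v = w")
    case True then show ?thesis by (intro exI[of _ 1]) simp
  next
    case False
    then have "K v \<inter> K w = {}" using K(2)[of v] K(2)[of w] by blast
    then show ?thesis
      using separate_compact_closed[OF K(1)[of v] compact_imp_closed[OF K(1)[of w]]] by blast
  qed
  then have "\<exists>d. \<forall>v w. 0 < d v w \<and> (\<forall>x\<in>K v. \<forall>y\<in>K w. v \<noteq> w \<longrightarrow> d v w \<le> dist x y)"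
    by (intro choice allI)
  then obtain d where d0: "\<forall>v w. 0 < d v w \<and> (\<forall>x\<in>K v. \<forall>y\<in>K w. v \<noteq> w \<longrightarrow> d v w \<le> dist x y)"
    by (rule exE)
  note d = d0[rule_format, THEN conjunct1] d0[rule_format, THEN conjunct2, rule_format]
  define d0 where "d0 = Min ((\<lambda>(v, w). d v w) ` (?S \<times> ?S))"
  have "0 < d0" unfolding d0_def using fin ne d(1) by (subst Min_gr_iff) auto
  then obtain n where n: "\<And>x y. x \<in> space M \<Longrightarrow> y \<in> space M \<Longrightarrow> itin f s n x = itin f s n y \<Longrightarrow> dist x y < d0"
    using gen by blast
  obtain v0 where v0: "v0 \<in> ?S" using ne by blast
  define g where "g l = (if \<exists>v\<in>?S. \<exists>x\<in>K v. itin f s n x = l then SOME v. v \<in> ?S \<and> (\<exists>x\<in>K v. itin f s n x = l) else v0)" for l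
  have gS: "g l \<in> ?S" for l
  proof (cases "\<exists>v\<in>?S. \<exists>x\<in>K v. itin f s n x = l")
    case True
    then have "\<exists>v. v \<in> ?S \<and> (\<exists>x\<in>K v. itin f s n x = l)" by blast
    from someI_ex[OF this] show ?thesis using True by (simp add: g_def)
  next
    case False then show ?thesis unfolding g_def using v0 by (simp only: if_False)
  qed
  have gK: "g (itin f s n x) = v" if v: "v \<in> ?S" and x: "x \<in> K v" for v x
  proof -
    let ?Q = "\<lambda>w. w \<in> ?S \<and> (\<exists>y\<in>K w. itin f s n y = itin f s n x)"
    have "?Q v" using v x by blast
    then have "?Q (SOME w. ?Q w)" by (rule someI)
    moreover have "g (itin f s n x) = (SOME w. ?Q w)" using \<open>?Q v\<close> unfolding g_def by (intro if_P) blast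
    ultimately have "?Q (g (itin f s n x))" by simp
    then obtain w y where w: "w = g (itin f s n x)" "w \<in> ?S" "y \<in> K w" "itin f s n y = itin f s n x" by blast
    have "dist y x < d0" using n[of y x] w x K(2) by blast
    moreover have "d0 \<le> d w v" unfolding d0_def using fin v w(2) by (intro Min_le) auto
    ultimately show ?thesis using d(2)[OF w(3) x] w(1) by force
  qed
  have Y: "simple_function M (\<lambda>x. g (itin f s n x))"
    using simple_function_compose[OF simple_itin[OF s], of g n] by (simp add: o_def)
  have "measure M {x \<in> space M. X x \<noteq> g (itin f s n x)} \<le> measure M (\<Union>v\<in>?S. ?A v - K v)"
  proof (rule finite_measure_mono)
    show "{x \<in> space M. X x \<noteq> g (itin f s n x)} \<subseteq> (\<Union>v\<in>?S. ?A v - K v)"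
    proof
      fix x assume x: "x \<in> {x \<in> space M. X x \<noteq> g (itin f s n x)}"
      then have "x \<notin> K (X x)" using gK[of "X x" x] by auto
      then show "x \<in> (\<Union>v\<in>?S. ?A v - K v)" using x by (intro UN_I[of "X x"]) auto
    qed
    show "(\<Union>v\<in>?S. ?A v - K v) \<in> sets M"
      by (intro sets.finite_UN fin sets.Diff simple_function_level[OF X] K(3))
  qed
  also have "\<dots> \<le> (\<Sum>v\<in>?S. measure M (?A v - K v))"
    by (intro measure_UNION_le fin sets.Diff simple_function_level[OF X] K(3))
  also have "\<dots> \<le> (\<Sum>v\<in>?S. e')" using K(4) by (intro sum_mono) (auto intro: less_imp_le)
  also have "\<dots> < e" using e by (simp add: e'_def field_simps)
  finally show ?thesis using Y gS by blast
qed

text \<open>For the upper bound, X is approximated by functions \<open>Y k\<close> of finitely many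
  symbols of s. The entropy rate of X is at most that of s plus \<open>H(X | Y k)\<close>, and the
  last term tends to 0.\<close>

theorem kolmogorov_sinai_generator:
  assumes s: "simple_function M s"
    and gen: "\<And>d. 0 < d \<Longrightarrow> \<exists>n. \<forall>x\<in>space M. \<forall>y\<in>space M. itin f s n x = itin f s n y \<longrightarrow> dist x y < d"
    and lim: "(\<lambda>n. ent M (itin f s n) / real n) \<longlonglongrightarrow> h"
  shows "measure_entropy M f = ereal h"
proof -
  have lim_eq: "(\<lambda>n. partition_entropy M (dynamical_refinement M f \<xi> n) / real n) \<longlonglongrightarrow> l
      \<longleftrightarrow> (\<lambda>n. ent M (itin f (partition_index \<xi>) n) / real n) \<longlonglongrightarrow> l"
    if "partition_on (space M) \<xi>" for \<xi> l
  proof (rule filterlim_cong[OF refl refl])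
    show "\<forall>\<^sub>F n in sequentially. partition_entropy M (dynamical_refinement M f \<xi> n) / real n
        = ent M (itin f (partition_index \<xi>) n) / real n"
      using eventually_gt_at_top[of 0] by eventually_elim (simp add: partition_entropy_refinement[OF that])
  qed
  have upper: "l \<le> h" if X: "simple_function M X" and l: "(\<lambda>n. ent M (itin f X n) / real n) \<longlonglongrightarrow> l" for X :: "real \<Rightarrow> real set" and l
  proof -
    let ?\<Phi> = "\<lambda>k n g. simple_function M (\<lambda>x. g (itin f s n x)) \<and> (\<forall>x\<in>space M. g (itin f s n x) \<in> X ` space M) \<and>
        measure M {x \<in> space M. X x \<noteq> g (itin f s n x)} < 1 / real (Suc k)"
    have "\<exists>n g. ?\<Phi> k n g" for k
      by (rule generator_approx[OF s gen X]) auto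
    then have "\<exists>N. \<forall>k. \<exists>g. ?\<Phi> k (N k) g" by (intro choice allI)
    then obtain N where "\<forall>k. \<exists>g. ?\<Phi> k (N k) g" by (rule exE)
    then have "\<exists>g. \<forall>k. ?\<Phi> k (N k) (g k)" by (rule choice)
    then obtain g where "\<forall>k. ?\<Phi> k (N k) (g k)" by (rule exE)
    note Ng = this[rule_format, THEN conjunct1] this[rule_format, THEN conjunct2, THEN conjunct1, rule_format]
      this[rule_format, THEN conjunct2, THEN conjunct2]
    define Y where "Y k x = g k (itin f s (N k) x)" for k x
    have Y: "simple_function M (Y k)" for k using Ng(1)[of k] by (simp add: Y_def[abs_def])
    have "(\<lambda>k. measure M {x \<in> space M. X x \<noteq> Y k x}) \<longlonglongrightarrow> 0"
      by (rule tendsto_sandwich[OF _ _ tendsto_const LIMSEQ_inverse_real_of_nat])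
        (use Ng(3) in \<open>auto simp: Y_def inverse_eq_divide less_imp_le\<close>)
    then have "(\<lambda>k. ent M (\<lambda>x. (X x, Y k x)) - ent M (Y k)) \<longlonglongrightarrow> 0"
      by (intro ent_perturbation X Y) (use Ng(2) in \<open>auto simp: Y_def\<close>)
    then have lim2: "(\<lambda>k. h + (ent M (\<lambda>x. (X x, Y k x)) - ent M (Y k))) \<longlonglongrightarrow> h + 0"
      by (intro tendsto_intros)
    have "l \<le> h + (ent M (\<lambda>x. (X x, Y k x)) - ent M (Y k))" for k
    \<comment> \<open>The code of \<open>Y k\<close> reads \<open>N k\<close> symbols ahead; the
      extra length is negligible after division by n.\<close>
    proof (rule LIMSEQ_le[OF l])
      let ?D = "ent M (\<lambda>x. (X x, Y k x)) - ent M (Y k)"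
      have "(\<lambda>n. ent M (itin f s (n + N k)) / real (n + N k)) \<longlonglongrightarrow> h"
        by (rule LIMSEQ_ignore_initial_segment[OF lim])
      moreover have "(\<lambda>n. real (n + N k) / real n) \<longlonglongrightarrow> 1"
      proof -
        have "(\<lambda>n. 1 + real (N k) * (1 / real n)) \<longlonglongrightarrow> 1 + real (N k) * 0"
          by (intro tendsto_intros lim_1_over_n)
        moreover have "\<forall>\<^sub>F n in sequentially. 1 + real (N k) * (1 / real n) = real (n + N k) / real n"
          using eventually_gt_at_top[of 0] by eventually_elim (simp add: field_simps)
        ultimately show ?thesis by (simp add: Lim_transform_eventually)
      qed
      ultimately have "(\<lambda>n. ent M (itin f s (n + N k)) / real (n + N k) * (real (n + N k) / real n) + ?D) \<longlonglongrightarrow> h * 1 + ?D"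
        by (intro tendsto_intros)
      moreover have "\<forall>\<^sub>F n in sequentially. ent M (itin f s (n + N k)) / real (n + N k) * (real (n + N k) / real n) + ?D
          = ent M (itin f s (n + N k)) / real n + ?D"
        using eventually_gt_at_top[of 0] by eventually_elim simp
      ultimately show "(\<lambda>n. ent M (itin f s (n + N k)) / real n + ?D) \<longlonglongrightarrow> h + ?D"
        by (simp add: Lim_transform_eventually)
      show "\<exists>M'. \<forall>n\<ge>M'. ent M (itin f X n) / real n \<le> ent M (itin f s (n + N k)) / real n + ?D"
      proof (intro exI[of _ 1] allI impI)
        fix n :: nat assume "1 \<le> n"
        have "ent M (itin f X n) \<le> ent M (itin f (Y k) n) + real n * ?D"
          by (rule ent_itin_le[OF X Y])
        also have "ent M (itin f (Y k) n) \<le> ent M (itin f s (n + N k))"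
          by (rule ent_itin_block[OF s Y, of _ "g k"]) (simp add: Y_def)
        finally show "ent M (itin f X n) / real n \<le> ent M (itin f s (n + N k)) / real n + ?D"
          using \<open>1 \<le> n\<close> by (simp add: field_simps)
      qed
    qed
    then show ?thesis using LIMSEQ_le_const[OF lim2] by simp
  qed
  let ?\<Xi> = "{\<xi>. finite \<xi> \<and> partition_on (space M) \<xi> \<and> \<xi> \<subseteq> sets M}"
  let ?H = "\<lambda>\<xi>. ereal (lim (\<lambda>n. partition_entropy M (dynamical_refinement M f \<xi> n) / real n))"
  have "?H \<xi> \<le> ereal h" if "\<xi> \<in> ?\<Xi>" for \<xi>
  proof -
    have \<xi>: "partition_on (space M) \<xi>" "finite \<xi>" "\<xi> \<subseteq> sets M" using that by auto
    note X = simple_partition_index[OF \<xi>]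
    obtain l where l: "(\<lambda>n. ent M (itin f (partition_index \<xi>) n) / real n) \<longlonglongrightarrow> l"
      using ent_itin_convergent[OF X] by (auto simp: convergent_def)
    then have "lim (\<lambda>n. partition_entropy M (dynamical_refinement M f \<xi> n) / real n) = l"
      using lim_eq[OF \<xi>(1)] by (intro limI) simp
    then show ?thesis using upper[OF X l] by simp
  qed
  \<comment> \<open>The supremum is attained by the partition into the level sets of s.\<close>
  moreover have "\<exists>\<xi>\<in>?\<Xi>. ?H \<xi> = ereal h"
  proof -
    define \<xi> where "\<xi> = (\<lambda>v. {x \<in> space M. s x = v}) ` s ` space M"
    have \<xi>: "partition_on (space M) \<xi>" "finite \<xi>" "\<xi> \<subseteq> sets M"
      using simple_function_finite_range[OF s] simple_function_level[OF s]
      by (auto simp: \<xi>_def partition_on_def disjoint_def)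
    have idx: "partition_index \<xi> x = {y \<in> space M. s y = s x}" if "x \<in> space M" for x
      using partition_index(3)[OF \<xi>(1) that, of "{y \<in> space M. s y = s x}"] that by (auto simp: \<xi>_def)
    have "ent M (itin f (partition_index \<xi>) n) = ent M (itin f s n)" for n
    proof (rule antisym)
      show "ent M (itin f (partition_index \<xi>) n) \<le> ent M (itin f s n)"
        by (rule ent_mono[where g = "map (\<lambda>v. {y \<in> space M. s y = v})"])
          (auto intro!: simple_itin s simple_partition_index \<xi> simp: itin_def idx funpow_space)
      show "ent M (itin f s n) \<le> ent M (itin f (partition_index \<xi>) n)"
      proof (rule ent_mono[where g = "map (\<lambda>A. s (SOME y. y \<in> A))"])
        fix x assume x: "x \<in> space M"
        have "s (SOME y. y \<in> {y \<in> space M. s y = s z}) = s z" if "z \<in> space M" for z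
          using someI[of "\<lambda>y. y \<in> {y \<in> space M. s y = s z}" z] that by simp
        then show "itin f s n x = map (\<lambda>A. s (SOME y. y \<in> A)) (itin f (partition_index \<xi>) n x)"
          using x by (simp add: itin_def idx funpow_space)
      qed (auto intro!: simple_itin s simple_partition_index \<xi>)
    qed
    then have "lim (\<lambda>n. partition_entropy M (dynamical_refinement M f \<xi> n) / real n) = h"
      using lim lim_eq[OF \<xi>(1)] by (intro limI) simp
    then show ?thesis using \<xi> by (intro bexI[of _ \<xi>]) auto
  qed
  ultimately show ?thesis
    unfolding measure_entropy_def by (intro antisym SUP_least) (auto intro: SUP_upper2)
qed

end

section \<open>The fair entropy\<close>

lemma average_of_convergent_increments:
  fixes u :: "nat \<Rightarrow> real"
  assumes "(\<lambda>n. u (Suc n) - u n) \<longlonglongrightarrow> L"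
  shows "(\<lambda>n. u n / real n) \<longlonglongrightarrow> L"
proof (rule LIMSEQ_I)
  fix e :: real assume e: "0 < e"
  obtain N where N: "\<And>n. N \<le> n \<Longrightarrow> \<bar>u (Suc n) - u n - L\<bar> < e / 2"
    using LIMSEQ_D[OF assms, of "e / 2"] e by auto
  have step: "\<bar>u (N + k) - real (N + k) * L\<bar> \<le> \<bar>u N - real N * L\<bar> + real k * (e / 2)" for k
  proof (induction k)
    case (Suc k)
    have "u (N + Suc k) - real (N + Suc k) * L
        = (u (N + k) - real (N + k) * L) + (u (Suc (N + k)) - u (N + k) - L)" by (simp add: algebra_simps)
    then have "\<bar>u (N + Suc k) - real (N + Suc k) * L\<bar>
        \<le> \<bar>u (N + k) - real (N + k) * L\<bar> + \<bar>u (Suc (N + k)) - u (N + k) - L\<bar>" by (simp only: abs_triangle_ineq)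
    also have "\<dots> \<le> (\<bar>u N - real N * L\<bar> + real k * (e / 2)) + e / 2"
      using Suc N[of "N + k"] by (intro add_mono) auto
    finally show ?case by (simp add: field_simps)
  qed simp
  define C where "C = \<bar>u N - real N * L\<bar>"
  obtain n0 :: nat where n0: "C / (e / 2) < real n0" using reals_Archimedean2 by blast
  show "\<exists>no. \<forall>n\<ge>no. norm (u n / real n - L) < e"
  proof (intro exI[of _ "Suc (max N n0)"] allI impI)
    fix n assume n: "Suc (max N n0) \<le> n"
    define k where "k = n - N"
    have k: "n = N + k" using n by (simp add: k_def)
    have "C / (e / 2) < real n" using n0 n by linarith
    then have "C < real n * (e / 2)" using e by (simp add: field_simps)
    moreover have "real k * (e / 2) \<le> real n * (e / 2)" using k e by simp
    moreover have "\<bar>u n - real n * L\<bar> \<le> C + real k * (e / 2)" using step[of k] by (simp add: k C_def)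
    ultimately have "\<bar>u n - real n * L\<bar> < real n * (e / 2) + real n * (e / 2)" by linarith
    then have "\<bar>u n - real n * L\<bar> < real n * e" by (simp add: mult.commute)
    moreover have "\<bar>u n / real n - L\<bar> = \<bar>u n - real n * L\<bar> / real n"
    proof -
      have "u n / real n - L = (u n - real n * L) / real n" using n by (simp add: diff_divide_distrib)
      then show ?thesis by simp
    qed
    ultimately show "norm (u n / real n - L) < e" using n by (simp add: field_simps)
  qed
qed

text \<open>\<open>d\<close> is the gain of entropy when a cell of mass p splits into masses
  \<open>m / 2\<close> and \<open>p - m / 2\<close>. It lies between 0 and \<open>p * ln 2\<close>,
  as does \<open>m * ln 2\<close>. The two agree when nothing splits off or when the cell is
  halved.\<close>

lemma split_entropy:
  fixes p m :: real
  assumes m: "0 \<le> m" "m \<le> p"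
  defines "d \<equiv> p * ln p - m / 2 * ln (m / 2) - (p - m / 2) * ln (p - m / 2)"
  shows "\<bar>d - m * ln 2\<bar> \<le> p * ln 2"
    and "m = 0 \<or> m = p \<Longrightarrow> d = m * ln 2"
proof -
  define l where "l = m / 2"
  have d: "d = p * ln p - l * ln l - (p - l) * ln (p - l)" by (simp add: d_def l_def)
  have l: "0 \<le> l" "l \<le> p / 2" using m by (auto simp: l_def)
  have bound: "x * ln p - x * ln x \<in> {0..x * ln 2 + (p / 2 - x)}" if x: "0 \<le> x" "x \<le> p" for x
  proof (cases "x = 0")
    case True then show ?thesis using x by simp
  next
    case False
    then have x: "0 < x" "x \<le> p" using that by auto
    have "ln (p / (2 * x)) \<le> p / (2 * x) - 1" using x by (intro ln_le_minus_one) auto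
    then have "x * ln (p / (2 * x)) \<le> x * (p / (2 * x) - 1)" using x by (intro mult_left_mono) auto
    also have "\<dots> = p / 2 - x" using x by (simp add: field_simps)
    finally have "x * ln p - x * ln x \<le> x * ln 2 + (p / 2 - x)"
      using x by (simp add: ln_div ln_mult algebra_simps)
    moreover have "x * ln x \<le> x * ln p" using x by (intro mult_left_mono) auto
    ultimately show ?thesis by simp
  qed
  have "p * ln p = l * ln p + (p - l) * ln p" by (simp add: algebra_simps)
  then have "d = (l * ln p - l * ln l) + ((p - l) * ln p - (p - l) * ln (p - l))" by (simp add: d)
  then have "0 \<le> d" "d \<le> l * ln 2 + (p / 2 - l) + ((p - l) * ln 2 + (p / 2 - (p - l)))"
    using bound[of l] bound[of "p - l"] l m by auto
  then have "0 \<le> d" "d \<le> p * ln 2" by (auto simp: algebra_simps)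
  moreover have "0 \<le> m * ln 2" "m * ln 2 \<le> p * ln 2" using m by (auto intro!: mult_right_mono)
  ultimately show "\<bar>d - m * ln 2\<bar> \<le> p * ln 2" by linarith
  show "d = m * ln 2" if "m = 0 \<or> m = p"
  proof (cases "p = 0")
    case True then show ?thesis using m by (simp add: d_def)
  next
    case False
    then have "0 < p" using m by linarith
    then show ?thesis using that by (auto simp: d_def ln_div algebra_simps)
  qed
qed

section \<open>The entropy of the fair measure from the sign code\<close>

context fair
begin

lemma tent_meas: "tent a \<in> measurable M M"
proof (rule measurableI)
  show "tent a x \<in> space M" if "x \<in> space M" for x using that tent_mem by (simp add: space_M)
  fix A assume "A \<in> sets M"
  then have "A \<in> sets borel" by (simp add: sets_M)
  have "tent a \<in> borel_measurable borel" unfolding tent_def by simp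
  from measurable_sets[OF borel_measurable_M[OF this] \<open>A \<in> sets borel\<close>]
  show "tent a -` A \<inter> space M \<in> sets M" .
qed

sublocale real_measure_preserving M "tent a"
  by unfold_locales (auto intro: tent_meas invariant borel_measurable_M simp: sets_M id_def)

abbreviation sgn_code :: "real \<Rightarrow> bool" where "sgn_code x \<equiv> 0 \<le> x"

lemma simple_sgn_code: "simple_function M sgn_code"
  unfolding simple_function_def
proof (intro conjI ballI)
  fix v
  have eq: "(\<lambda>x::real. 0 \<le> x) -` {v} = (if v then {0..} else {..<0})"
    by (cases v) (simp_all add: set_eq_iff not_le)
  show "(\<lambda>x. 0 \<le> x) -` {v} \<inter> space M \<in> sets M"
    unfolding eq sets_M space_M by (cases v) simp_all
qed (rule finite)

lemma same_code_expand:
  assumes "itin (tent a) sgn_code n x = itin (tent a) sgn_code n y"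
  shows "\<bar>(tent a ^^ n) x - (tent a ^^ n) y\<bar> = a ^ n * \<bar>x - y\<bar>"
  using assms
proof (induction n)
  case (Suc n)
  let ?u = "(tent a ^^ n) x" and ?v = "(tent a ^^ n) y"
  have "(0 \<le> ?u) = (0 \<le> ?v)" and IH: "\<bar>?u - ?v\<bar> = a ^ n * \<bar>x - y\<bar>"
    using Suc by (auto simp: itin_Suc)
  then have "\<bar>tent a ?u - tent a ?v\<bar> = \<bar>a * (?u - ?v)\<bar>"
    by (cases "0 \<le> ?u") (simp_all add: tent_def algebra_simps abs_minus_commute)
  then show ?case using IH a_gt by (simp add: abs_mult)
qed simp

lemma same_code_close:
  assumes "x \<in> space M" "y \<in> space M" "itin (tent a) sgn_code n x = itin (tent a) sgn_code n y"
  shows "\<bar>x - y\<bar> \<le> 2 / a ^ n"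
proof -
  have "(tent a ^^ n) x \<in> {1 - a..1}" "(tent a ^^ n) y \<in> {1 - a..1}"
    using assms by (auto simp: space_M intro!: funpow_tent_mem[unfolded atLeastAtMost_iff])
  then have "a ^ n * \<bar>x - y\<bar> \<le> 2" using same_code_expand[OF assms(3)] a_le by auto
  then show ?thesis using a_gt by (simp add: field_simps)
qed

lemma diameter_tendsto: "(\<lambda>n. 2 / a ^ n) \<longlonglongrightarrow> 0"
proof -
  have "(\<lambda>n. inverse (a ^ n)) \<longlonglongrightarrow> 0" by (rule LIMSEQ_inverse_realpow_zero) (use a_gt in simp)
  then have "(\<lambda>n. 2 * inverse (a ^ n)) \<longlonglongrightarrow> 2 * 0" by (intro tendsto_intros)
  then show ?thesis by (simp add: divide_inverse)
qed

lemma code_generates: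
  assumes "0 < d"
  shows "\<exists>n. \<forall>x\<in>space M. \<forall>y\<in>space M.
    itin (tent a) sgn_code n x = itin (tent a) sgn_code n y \<longrightarrow> dist x y < d"
proof -
  have "\<forall>\<^sub>F n in sequentially. 2 / a ^ n < d" using diameter_tendsto assms by (rule order_tendstoD)
  then obtain n where "2 / a ^ n < d" by (auto simp: eventually_sequentially)
  then show ?thesis
    unfolding dist_real_def by (intro exI[of _ n] ballI impI) (rule le_less_trans[OF same_code_close])
qed

definition "c3 = 1 - a * (a - 1)"

lemma small_interval_tendsto:
  "(\<lambda>n. measure M ({c3 - 2 / a ^ n..c3 + 2 / a ^ n} \<inter> {1 - a..1})) \<longlonglongrightarrow> 0"
proof (rule LIMSEQ_I)
  fix e :: real assume e: "0 < e"
  have c3: "c3 \<in> {1 - a..1}" using c3_bounds a_le by (auto simp: c3_def)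
  have "continuous_on {1 - a..1} cdf_M" using fair_cdf_M by (simp add: fair_cdf_def)
  then obtain d where d: "0 < d" "\<And>x. x \<in> {1 - a..1} \<Longrightarrow> \<bar>x - c3\<bar> < d \<Longrightarrow> \<bar>cdf_M x - cdf_M c3\<bar> < e / 2"
    using c3 e unfolding continuous_on_iff dist_real_def by (meson half_gt_zero)
  have "\<forall>\<^sub>F n in sequentially. 2 / a ^ n < d" using diameter_tendsto d(1) by (rule order_tendstoD)
  then obtain n0 where n0: "\<And>n. n0 \<le> n \<Longrightarrow> 2 / a ^ n < d" by (auto simp: eventually_sequentially)
  show "\<exists>no. \<forall>n\<ge>no. norm (measure M ({c3 - 2 / a ^ n..c3 + 2 / a ^ n} \<inter> {1 - a..1}) - 0) < e"
  proof (intro exI[of _ n0] allI impI)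
    fix n assume "n0 \<le> n"
    define h where "h = 2 / a ^ n"
    have h: "h < d" "0 < h" using n0[OF \<open>n0 \<le> n\<close>] a_gt by (auto simp: h_def)
    let ?u = "max (1 - a) (c3 - h)" and ?v = "min 1 (c3 + h)"
    have uv: "?u \<in> {1 - a..1}" "?v \<in> {1 - a..1}" "\<bar>?u - c3\<bar> < d" "\<bar>?v - c3\<bar> < d" "?u \<le> ?v"
      using h c3 by auto
    have eq: "{c3 - h..c3 + h} \<inter> {1 - a..1} = {?u..?v}" by auto
    have "measure M {?u..?v} = cdf_M ?v - cdf_M ?u" using uv by (intro measure_Icc) auto
    moreover have "\<bar>cdf_M ?u - cdf_M c3\<bar> < e / 2" by (rule d(2)[OF uv(1) uv(3)])
    moreover have "\<bar>cdf_M ?v - cdf_M c3\<bar> < e / 2" by (rule d(2)[OF uv(2) uv(4)])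
    ultimately have "measure M {?u..?v} < e" by linarith
    then show "norm (measure M ({c3 - 2 / a ^ n..c3 + 2 / a ^ n} \<inter> {1 - a..1}) - 0) < e"
      unfolding h_def[symmetric] eq by simp
  qed
qed

text \<open>Prefixing a symbol splits the preimage of a cell of mass p, with mass m above
  \<open>c3\<close>, into a left part \<open>m / 2\<close> and a right part
  \<open>p - m / 2\<close>. Cells on one side of \<open>c3\<close> thus contribute exactly
  \<open>m * ln 2\<close>, and the masses m add up to the mass above \<open>c3\<close>, which is
  \<open>2 * cdf_M 0\<close>. A cell with points on both sides causes an error, but lies within
  \<open>2 / a ^ n\<close> of \<open>c3\<close>.\<close>

lemma entropy_increment:
  "\<bar>ent M (itin (tent a) sgn_code (Suc n)) - ent M (itin (tent a) sgn_code n) - 2 * cdf_M 0 * ln 2\<bar>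
    \<le> ln 2 * measure M ({c3 - 2 / a ^ n..c3 + 2 / a ^ n} \<inter> {1 - a..1})"
proof -
  let ?C = "itin (tent a) sgn_code n"
  define p where "p v = pmass M ?C v" for v
  define m where "m v = measure M {x \<in> {c3..<1}. ?C x = v}" for v
  let ?V = "?C ` space M"
  have C: "simple_function M ?C" by (rule simple_itin[OF simple_sgn_code])
  have fin: "finite ?V" by (rule simple_function_finite_range[OF C])
  note Cf = simple_shift[OF C, of 1, simplified]
  have sC: "simple_function M (\<lambda>x. (sgn_code x, ?C (tent a x)))"
    by (rule simple_function_Pair[OF simple_sgn_code Cf])
  have c3m: "1 - a \<le> c3" "c3 \<le> 1" using c3_bounds a_le by (auto simp: c3_def)
  have im: "{x \<in> {c3..<1}. ?C x = v} \<in> sets M" for v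
  proof -
    have "{x \<in> {c3..<1}. ?C x = v} = {c3..<1} \<inter> {x \<in> space M. ?C x = v}"
      using c3m by (auto simp: space_M)
    moreover have "{c3..<1} \<in> sets M" using c3m by (auto simp: sets_M)
    ultimately show ?thesis using simple_function_level[OF C] by simp
  qed
  have m_le: "0 \<le> m v" "m v \<le> p v" for v
  proof -
    have "{x \<in> {c3..<1}. ?C x = v} \<subseteq> {x \<in> space M. ?C x = v}" using c3m by (auto simp: space_M)
    then show "m v \<le> p v" unfolding m_def p_def pmass_def
      by (rule finite_measure_mono) (rule simple_function_level[OF C])
  qed (simp add: m_def)
  have left: "pmass M (\<lambda>x. (sgn_code x, ?C (tent a x))) (False, v) = m v / 2" for v
  proof -
    let ?E = "{x \<in> space M. sgn_code x = False \<and> ?C (tent a x) = v}"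
    have E: "?E \<in> sets M" using simple_function_level[OF sC, of "(False, v)"] by simp
    have "tent a ` ?E = {x \<in> {c3..<1}. ?C x = v}"
    proof (intro equalityI subsetI)
      fix y assume "y \<in> tent a ` ?E"
      then obtain x where x: "1 - a \<le> x" "x < 0" "?C (tent a x) = v" "y = tent a x"
        by (auto simp: space_M)
      have "a * (1 - a) \<le> a * x" using x a_gt by (intro mult_left_mono) auto
      moreover have "a * x < 0" using x a_gt by (simp add: mult_pos_neg)
      ultimately show "y \<in> {x \<in> {c3..<1}. ?C x = v}" using x by (simp add: tent_def c3_def algebra_simps)
    next
      fix y assume y: "y \<in> {x \<in> {c3..<1}. ?C x = v}"
      have t: "tent a ((y - 1) / a) = y" using y a_gt by (simp add: tent_def field_simps)
      have "1 - a \<le> (y - 1) / a" "(y - 1) / a < 0"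
        using y a_gt by (auto simp: c3_def field_simps)
      then show "y \<in> tent a ` ?E"
        using y t a_gt by (intro image_eqI[of _ _ "(y - 1) / a"]) (auto simp: space_M)
    qed
    moreover have "measure M (tent a ` ?E) = 2 * measure M ?E"
      by (rule measure_image_left[OF E]) (auto simp: space_M)
    moreover have "pmass M (\<lambda>x. (sgn_code x, ?C (tent a x))) (False, v) = measure M ?E"
      by (simp add: pmass_def)
    ultimately show ?thesis by (simp add: m_def)
  qed
  have pf: "pmass M (\<lambda>x. ?C (tent a x)) v = p v" for v
  proof -
    have "{x \<in> space M. ?C (tent a x) = v} = tent a -` {x \<in> space M. ?C x = v} \<inter> space M"
      using f_space by auto
    then show ?thesis using f_inv[OF simple_function_level[OF C]] by (simp add: p_def pmass_def)
  qed
  have right: "pmass M (\<lambda>x. (sgn_code x, ?C (tent a x))) (True, v) = p v - m v / 2" for v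
  proof -
    have "measure M {x \<in> space M. ?C (tent a x) = v}
        = (\<Sum>s\<in>sgn_code ` space M. measure M {x \<in> {x \<in> space M. ?C (tent a x) = v}. sgn_code x = s})"
      by (rule measure_eq_sum_levels[OF simple_sgn_code simple_function_level[OF Cf]])
    also have "sgn_code ` space M = {True, False}"
    proof -
      have "(1 - a) \<in> space M" "0 \<in> space M" "\<not> 0 \<le> 1 - a" using a_gt by (auto simp: space_M)
      then have "sgn_code 0 \<in> sgn_code ` space M" "sgn_code (1 - a) \<in> sgn_code ` space M" by blast+
      moreover have "sgn_code 0 = True" "sgn_code (1 - a) = False" using \<open>\<not> 0 \<le> 1 - a\<close> by auto
      ultimately show ?thesis by auto
    qed
    also have "(\<Sum>s\<in>{True, False}. measure M {x \<in> {x \<in> space M. ?C (tent a x) = v}. sgn_code x = s}) =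
        pmass M (\<lambda>x. (sgn_code x, ?C (tent a x))) (True, v) + pmass M (\<lambda>x. (sgn_code x, ?C (tent a x))) (False, v)"
      by (simp add: pmass_def conj_ac)
    finally show ?thesis using pf[of v] left[of v] by (simp add: pmass_def[of M "\<lambda>x. ?C (tent a x)"])
  qed
  have shift: "itin (tent a) sgn_code (Suc n) x = sgn_code x # ?C (tent a x)" for x
  proof -
    have "itin (tent a) sgn_code 1 x = [sgn_code x]" by (simp add: itin_def)
    then show ?thesis using itin_add[of "tent a" sgn_code 1 n x] by simp
  qed
  have "ent M (itin (tent a) sgn_code (Suc n)) = ent M (\<lambda>x. (sgn_code x, ?C (tent a x)))"
  proof (rule antisym)
    show "ent M (itin (tent a) sgn_code (Suc n)) \<le> ent M (\<lambda>x. (sgn_code x, ?C (tent a x)))"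
      by (rule ent_mono[OF sC simple_itin[OF simple_sgn_code], where g = "\<lambda>(b, l). b # l"]) (simp add: shift)
    show "ent M (\<lambda>x. (sgn_code x, ?C (tent a x))) \<le> ent M (itin (tent a) sgn_code (Suc n))"
      by (rule ent_mono[OF simple_itin[OF simple_sgn_code] sC, where g = "\<lambda>l. (hd l, tl l)"]) (simp add: shift)
  qed
  also have "\<dots> = - (\<Sum>w\<in>{True, False} \<times> ?V. pmass M (\<lambda>x. (sgn_code x, ?C (tent a x))) w
      * ln (pmass M (\<lambda>x. (sgn_code x, ?C (tent a x))) w))"
    using fin f_space by (intro ent_superset) auto
  also have "\<dots> = - (\<Sum>v\<in>?V. (p v - m v / 2) * ln (p v - m v / 2)) - (\<Sum>v\<in>?V. m v / 2 * ln (m v / 2))"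
    unfolding sum.cartesian_product' by (simp add: left right)
  finally have "ent M (itin (tent a) sgn_code (Suc n)) - ent M ?C =
      (\<Sum>v\<in>?V. p v * ln (p v) - m v / 2 * ln (m v / 2) - (p v - m v / 2) * ln (p v - m v / 2))"
    by (simp add: ent_def[of M ?C] p_def[symmetric] sum_subtractf)
  moreover have "2 * cdf_M 0 = (\<Sum>v\<in>?V. m v)"
  proof -
    have "measure M {c3..<1} = (\<Sum>v\<in>?V. m v)"
      unfolding m_def using c3m by (intro measure_eq_sum_levels[OF C]) (auto simp: sets_M)
    moreover have "measure M {c3..<1} = measure M {c3..1}"
    proof -
      have "{c3..<1} = {c3..1} - {1}" by auto
      then show ?thesis
        using measure_Diff_null_set[of "{c3..1}" M "{1}"] atomless[of 1] c3m a_gt by (simp add: sets_M)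
    qed
    moreover have "measure M {c3..1} = 1 - cdf_M c3" using measure_Icc[of c3 1] c3m cdf_M_ends by simp
    moreover have "cdf_M c3 = 1 - 2 * cdf_M 0"
    proof -
      interpret T: tent_cdf a cdf_M by unfold_locales (rule fair_cdf_M)
      show ?thesis using T.F_c3 by (simp add: c3_def)
    qed
    ultimately show ?thesis by simp
  qed
  ultimately have eq: "ent M (itin (tent a) sgn_code (Suc n)) - ent M ?C - 2 * cdf_M 0 * ln 2 =
      (\<Sum>v\<in>?V. p v * ln (p v) - m v / 2 * ln (m v / 2) - (p v - m v / 2) * ln (p v - m v / 2) - m v * ln 2)"
    by (simp add: sum_subtractf sum_distrib_right)
  have "\<bar>ent M (itin (tent a) sgn_code (Suc n)) - ent M ?C - 2 * cdf_M 0 * ln 2\<bar>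
      \<le> (\<Sum>v\<in>?V. if m v = 0 \<or> m v = p v then 0 else p v * ln 2)"
    unfolding eq
  proof (rule order_trans[OF sum_abs], rule sum_mono)
    fix v
    show "\<bar>p v * ln (p v) - m v / 2 * ln (m v / 2) - (p v - m v / 2) * ln (p v - m v / 2) - m v * ln 2\<bar>
        \<le> (if m v = 0 \<or> m v = p v then 0 else p v * ln 2)"
      using split_entropy[OF m_le, of v] by auto
  qed
  also have "\<dots> \<le> (\<Sum>v\<in>?V. ln 2 * measure M {x \<in> {c3 - 2 / a ^ n..c3 + 2 / a ^ n} \<inter> {1 - a..1}. ?C x = v})"
  proof (rule sum_mono)
    fix v
    let ?J = "{c3 - 2 / a ^ n..c3 + 2 / a ^ n} \<inter> {1 - a..1}"
    show "(if m v = 0 \<or> m v = p v then 0 else p v * ln 2) \<le> ln 2 * measure M {x \<in> ?J. ?C x = v}"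
    proof (cases "m v = 0 \<or> m v = p v")
      \<comment> \<open>Such a cell has points on both sides of \<open>c3\<close>, so by the bound
        on its diameter it lies in \<open>?J\<close>.\<close>
      case False
      have "{x \<in> {c3..<1}. ?C x = v} \<noteq> {}"
      proof
        assume "{x \<in> {c3..<1}. ?C x = v} = {}"
        then have "m v = 0" unfolding m_def by (simp only: measure_empty)
        then show False using False by simp
      qed
      then obtain y where y: "c3 \<le> y" "y < 1" "?C y = v" by auto
      have "\<exists>x\<in>space M. ?C x = v \<and> x < c3"
      proof (rule ccontr)
        assume none: "\<not> (\<exists>x\<in>space M. ?C x = v \<and> x < c3)"
        have "{x \<in> {c3..<1}. ?C x = v} = {x \<in> space M. ?C x = v} - {1}"
          using none c3m by (force simp: space_M)
        then have "m v = p v"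
          unfolding m_def p_def pmass_def
          using measure_Diff_null_set[OF simple_function_level[OF C] atomless[of 1], of v] a_gt by simp
        then show False using False by simp
      qed
      then obtain x where x: "x \<in> space M" "?C x = v" "x < c3" by auto
      have ys: "y \<in> space M" using y c3m by (simp add: space_M)
      have "{z \<in> space M. ?C z = v} \<subseteq> {z \<in> ?J. ?C z = v}"
      proof
        fix z assume "z \<in> {z \<in> space M. ?C z = v}"
        then have z: "z \<in> space M" "?C z = v" by auto
        have "\<bar>z - x\<bar> \<le> 2 / a ^ n" "\<bar>z - y\<bar> \<le> 2 / a ^ n"
          using same_code_close[OF z(1) x(1), of n] same_code_close[OF z(1) ys, of n] z x y by auto
        then show "z \<in> {z \<in> ?J. ?C z = v}" using x y z by (auto simp: space_M)
      qed
      moreover have "{z \<in> ?J. ?C z = v} \<in> sets M"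
      proof -
        have "{z \<in> ?J. ?C z = v} = ?J \<inter> {z \<in> space M. ?C z = v}" by (auto simp: space_M)
        moreover have "?J \<in> sets M" by (auto simp: sets_M)
        ultimately show ?thesis using simple_function_level[OF C] by simp
      qed
      ultimately have "p v \<le> measure M {z \<in> ?J. ?C z = v}"
        unfolding p_def pmass_def by (rule finite_measure_mono)
      then show ?thesis using False by (simp add: mult.commute)
    qed simp
  qed
  also have "\<dots> = ln 2 * measure M ({c3 - 2 / a ^ n..c3 + 2 / a ^ n} \<inter> {1 - a..1})"
    unfolding sum_distrib_left[symmetric]
  proof -
    have "{c3 - 2 / a ^ n..c3 + 2 / a ^ n} \<inter> {1 - a..1} \<in> sets M" by (simp add: sets_M)
    from measure_eq_sum_levels[OF C this] show "ln 2 * (\<Sum>v\<in>?V. measure M {x \<in> {c3 - 2 / a ^ n..c3 + 2 / a ^ n} \<inter> {1 - a..1}. ?C x = v})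
      = ln 2 * measure M ({c3 - 2 / a ^ n..c3 + 2 / a ^ n} \<inter> {1 - a..1})" by (simp only:)
  qed
  finally show ?thesis .
qed

lemma measure_entropy_tent: "measure_entropy M (tent a) = ereal (2 * cdf_M 0 * ln 2)"
proof (rule kolmogorov_sinai_generator[OF simple_sgn_code code_generates])
  let ?e = "\<lambda>n. ent M (itin (tent a) sgn_code n)"
  have "(\<lambda>n. ?e (Suc n) - ?e n - 2 * cdf_M 0 * ln 2) \<longlonglongrightarrow> 0"
  proof (rule Lim_null_comparison)
    show "\<forall>\<^sub>F n in sequentially. norm (?e (Suc n) - ?e n - 2 * cdf_M 0 * ln 2)
        \<le> ln 2 * measure M ({c3 - 2 / a ^ n..c3 + 2 / a ^ n} \<inter> {1 - a..1})"
      using entropy_increment by simp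
    show "(\<lambda>n. ln 2 * measure M ({c3 - 2 / a ^ n..c3 + 2 / a ^ n} \<inter> {1 - a..1})) \<longlonglongrightarrow> 0"
      using tendsto_mult_right_zero[OF small_interval_tendsto, of "ln 2"] by (simp add: mult.commute)
  qed
  then have "(\<lambda>n. ?e (Suc n) - ?e n) \<longlonglongrightarrow> 2 * cdf_M 0 * ln 2" by (rule LIM_zero_cancel)
  then show "(\<lambda>n. ?e n / real n) \<longlonglongrightarrow> 2 * cdf_M 0 * ln 2" by (rule average_of_convergent_increments)
qed

end

theorem normalized_fair_entropy_cdf:
  assumes "tent_cdf a F"
  shows "normalized_fair_entropy a = F 0"
proof -
  interpret tent_cdf a F by fact
  interpret M: fair a "fair_measure a" by (rule fair_fair_measure)
  have "M.cdf_M 0 = F 0"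
    by (rule fair_cdf_unique[of a]) 
      (use a_gt in \<open>auto intro!: tent_cdf.intro tent_cdf_axioms.intro tent_param_axioms M.fair_cdf_M cdf\<close>)
  then show ?thesis
    by (simp add: normalized_fair_entropy_def M.measure_entropy_tent)
qed

section \<open>The parameters of the turning orbits\<close>

text \<open>The value of \<open>c\<^sub>n\<close> as long as \<open>c\<^sub>2, \<dots>, c\<^bsub>n-1\<^esub>\<close> are not positive.\<close>

definition neg_orbit :: "real \<Rightarrow> nat \<Rightarrow> real" where
  "neg_orbit a n = (a ^ (n - 1) * (2 - a) - 1) / (a - 1)"

lemma sqrt2_bounds: "1.414 < sqrt (2::real)" "sqrt (2::real) < 1.415"
  by (rule real_less_rsqrt real_less_lsqrt; simp add: power2_eq_square)+

lemma neg_orbit_2: "1 < a \<Longrightarrow> neg_orbit a 2 = 1 - a"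
  by (simp add: neg_orbit_def field_simps)

lemma neg_orbit_Suc: "1 < a \<Longrightarrow> 2 \<le> n \<Longrightarrow> neg_orbit a (Suc n) = 1 + a * neg_orbit a n"
proof -
  assume "1 < a" "2 \<le> n"
  then obtain m where "n = Suc m" by (cases n) auto
  then show ?thesis using \<open>1 < a\<close> by (simp add: neg_orbit_def field_simps)
qed

lemma neg_orbit_mono:
  assumes "1 < a" "a \<le> 2" "2 \<le> m" "m \<le> n"
  shows "neg_orbit a m \<le> neg_orbit a n"
  unfolding neg_orbit_def
  using assms by (intro divide_right_mono diff_right_mono mult_right_mono power_increasing) auto

lemma neg_orbit_strict_mono:
  assumes "1 < a" "a < 2" "2 \<le> m" "m < n"
  shows "neg_orbit a m < neg_orbit a n"
  unfolding neg_orbit_def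
  using assms by (intro divide_strict_right_mono diff_strict_right_mono mult_strict_right_mono power_strict_increasing) auto

lemma turning_orbit_Suc: "turning_orbit a (Suc n) = tent a (turning_orbit a n)"
  by (simp add: turning_orbit_def)

lemma turning_orbit_0_1_2: "turning_orbit a 0 = 0" "turning_orbit a 1 = 1" "turning_orbit a 2 = 1 - a"
  by (simp_all add: turning_orbit_def tent_def numeral_2_eq_2)

lemma turning_orbit_eq_neg_orbit:
  assumes "1 < a" "2 \<le> n" "\<And>i. 2 \<le> i \<Longrightarrow> i < n \<Longrightarrow> turning_orbit a i \<le> 0"
  shows "turning_orbit a n = neg_orbit a n"
  using assms(2,3)
proof (induction n rule: dec_induct)
  case base
  then show ?case using assms(1) by (simp add: turning_orbit_0_1_2 neg_orbit_2)
next
  case (step n)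
  have "turning_orbit a n = neg_orbit a n" using step by auto
  moreover have "turning_orbit a n \<le> 0" using step.prems[of n] step.hyps by simp
  ultimately have "turning_orbit a n = neg_orbit a n" "neg_orbit a n \<le> 0" by auto
  then show ?case
    using assms(1) step(1) by (simp add: turning_orbit_Suc neg_orbit_Suc tent_def abs_of_nonpos)
qed

lemma turning_orbit_neg_orbit:
  assumes a: "1 < a" "a \<le> 2" and n: "neg_orbit a n \<le> 0" "2 \<le> i" "i \<le> Suc n"
  shows "turning_orbit a i = neg_orbit a i"
  using n(2,3)
proof (induction i rule: less_induct)
  case (less i)
  show ?case
  proof (rule turning_orbit_eq_neg_orbit[OF a(1) less(2)])
    fix j assume "2 \<le> j" "j < i"
    then show "turning_orbit a j \<le> 0"
      using less(1)[of j] less(3) neg_orbit_mono[OF a, of j n] n(1) by auto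
  qed
qed

text \<open>The difference obeys \<open>E (n + 1) = a * E n + (a' - a) * neg_orbit a' n\<close>.
  Both terms are nonpositive while the orbit for a' is, so the initial difference
  \<open>- (a' - a)\<close> is never reduced in size.\<close>

lemma neg_orbit_antimono_param:
  assumes "1 < a" "a < a'" "2 \<le> n" "\<And>i. 2 \<le> i \<Longrightarrow> i < n \<Longrightarrow> neg_orbit a' i \<le> 0"
  shows "neg_orbit a' n - neg_orbit a n \<le> - (a' - a)"
  using assms(3,4)
proof (induction n rule: dec_induct)
  case base
  then show ?case using assms by (simp add: neg_orbit_2)
next
  case (step n)
  have IH: "neg_orbit a' n - neg_orbit a n \<le> - (a' - a)" "neg_orbit a' n \<le> 0" using step by auto
  have "neg_orbit a' (Suc n) - neg_orbit a (Suc n)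
      = a * (neg_orbit a' n - neg_orbit a n) + (a' - a) * neg_orbit a' n"
    using assms step(1) by (simp add: neg_orbit_Suc algebra_simps)
  also have "a * (neg_orbit a' n - neg_orbit a n) \<le> a * (- (a' - a))"
    using IH assms by (intro mult_left_mono) auto
  also have "\<dots> \<le> 1 * (- (a' - a))" using assms by (intro mult_right_mono_neg) auto
  also have "(a' - a) * neg_orbit a' n \<le> 0" using IH assms by (intro mult_nonneg_nonpos) auto
  finally show ?case by simp
qed

section \<open>The special parameters\<close>

definition is_special :: "nat \<Rightarrow> real \<Rightarrow> bool" where
  "is_special r a \<longleftrightarrow> a \<in> {sqrt 2..2} \<and> neg_orbit a (Suc r) = a - 1"

lemma is_special_neg:
  assumes "is_special r a" "2 \<le> r"
  shows "a < 2" "neg_orbit a r = - ((2 - a) / a)" "2 \<le> i \<Longrightarrow> i \<le> r \<Longrightarrow> neg_orbit a i < 0"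
proof -
  have a: "1 < a" "a \<le> 2" using assms(1) sqrt2_bounds by (auto simp: is_special_def)
  have eq: "neg_orbit a (Suc r) = a - 1" using assms(1) by (simp add: is_special_def)
  show "a < 2" using a eq by (cases "a = 2") (auto simp: neg_orbit_def)
  have "1 + a * neg_orbit a r = a - 1" using eq a assms(2) by (simp add: neg_orbit_Suc)
  then show "neg_orbit a r = - ((2 - a) / a)" using a by (simp add: field_simps)
  then have "neg_orbit a r < 0" using a \<open>a < 2\<close> by simp
  then show "2 \<le> i \<Longrightarrow> i \<le> r \<Longrightarrow> neg_orbit a i < 0" using neg_orbit_mono[OF a, of i r] by simp
qed

text \<open>One equation replaces all the sign and order conditions: it makes the value at r equal
  to \<open>- (2 - a) / a < 0\<close>, and for \<open>a < 2\<close> the formula is strictly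
  increasing in the index, so the earlier values are negative and increasing as well.\<close>

lemma is_special_iff:
  assumes "2 \<le> r"
  shows "is_special r a \<longleftrightarrow> a \<in> {sqrt 2..2} \<and>
     (\<forall>i\<in>{2..<r}. turning_orbit a i < turning_orbit a (Suc i)) \<and>
     turning_orbit a r < 0 \<and> 0 < turning_orbit a (Suc r) \<and>
     turning_orbit a (Suc r) = - turning_orbit a 2" (is "_ \<longleftrightarrow> ?R")
proof
  assume s: "is_special r a"
  have a: "1 < a" "a \<le> 2" "a < 2" using s sqrt2_bounds is_special_neg(1)[OF s assms] by (auto simp: is_special_def)
  have c: "turning_orbit a i = neg_orbit a i" if "2 \<le> i" "i \<le> Suc r" for i
    using turning_orbit_neg_orbit[OF a(1,2) _ that] is_special_neg(3)[OF s assms, of r] assms by simp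
  show ?R
    using s c[of r] c[of "Suc r"] assms is_special_neg(3)[OF s assms, of r] a
    by (auto simp: is_special_def turning_orbit_0_1_2 c intro!: neg_orbit_strict_mono)
next
  assume R: ?R
  then have a: "1 < a" "a \<le> 2" using sqrt2_bounds by auto
  have neg: "turning_orbit a i \<le> turning_orbit a r" if "2 \<le> i" "i \<le> r" for i
    using that(2,1)
  proof (induction i rule: inc_induct)
    case (step n)
    then have "turning_orbit a n < turning_orbit a (Suc n)" using R by auto
    then show ?case using step by auto
  qed simp
  have "turning_orbit a (Suc r) = neg_orbit a (Suc r)"
  proof (rule turning_orbit_eq_neg_orbit[OF a(1)])
    fix i assume "2 \<le> i" "i < Suc r"
    then show "turning_orbit a i \<le> 0" using neg[of i] R by auto
  qed (use assms in simp)
  then show "is_special r a" using R by (simp add: is_special_def turning_orbit_0_1_2)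
qed

lemma is_special_unique:
  assumes "is_special r a" "is_special r a'" "2 \<le> r"
  shows "a = a'"
proof -
  have False if "is_special r a" "is_special r a'" "a < a'" for a a'
  proof -
    have "neg_orbit a' (Suc r) - neg_orbit a (Suc r) \<le> - (a' - a)"
      using that sqrt2_bounds assms(3) is_special_neg(3)[OF that(2) assms(3)]
      by (intro neg_orbit_antimono_param) (auto simp: is_special_def less_imp_le)
    then show False using that by (simp add: is_special_def)
  qed
  then show ?thesis using assms by (meson linorder_neqE_linordered_idom)
qed

lemma neg_orbit_sqrt2_3: "neg_orbit (sqrt 2) 3 = sqrt 2 - 1"
proof -
  have "neg_orbit (sqrt 2) (Suc 2) = 1 + sqrt 2 * (1 - sqrt 2)"
  proof -
    have "1 < sqrt (2::real)" using sqrt2_bounds by simp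
    then show ?thesis by (simp only: neg_orbit_Suc neg_orbit_2 order_refl)
  qed
  then show ?thesis by (simp add: algebra_simps)
qed

lemma is_special_exists:
  assumes "2 \<le> r"
  shows "\<exists>a. is_special r a"
proof -
  let ?g = "\<lambda>a. neg_orbit a (Suc r) - (a - 1)"
  have "continuous_on {sqrt 2..2} ?g"
    unfolding neg_orbit_def using sqrt2_bounds by (intro continuous_intros) auto
  moreover have "?g 2 \<le> 0" by (simp add: neg_orbit_def)
  moreover have "0 \<le> ?g (sqrt 2)"
    using neg_orbit_mono[of "sqrt 2" 3 "Suc r"] neg_orbit_sqrt2_3 sqrt2_bounds assms by auto
  moreover have "sqrt 2 \<le> (2::real)" using sqrt2_bounds by simp
  ultimately obtain a where "sqrt 2 \<le> a" "a \<le> 2" "?g a = 0"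
    using IVT2'[of ?g 2 0 "sqrt 2"] by auto
  then show ?thesis by (auto simp: is_special_def)
qed

lemma is_special_special_param: "2 \<le> r \<Longrightarrow> is_special r (special_param r)"
  unfolding special_param_def is_special_iff[symmetric]
  by (rule theI') (use is_special_exists is_special_unique in blast)

lemma special_param_2: "special_param 2 = sqrt 2"
proof (rule is_special_unique)
  show "is_special 2 (sqrt 2)"
    using neg_orbit_sqrt2_3 sqrt2_bounds by (simp add: is_special_def numeral_eq_Suc)
qed (simp_all add: is_special_special_param)

lemma special_param_bounds:
  assumes "2 \<le> r"
  shows "sqrt 2 \<le> special_param r" "special_param r < 2"
  using is_special_special_param[OF assms] is_special_neg(1)[OF _ assms] by (auto simp: is_special_def)

text \<open>A lower bound, uniform above \<open>special_param r\<close>, for the distance of \<open>c\<^sub>2, \<dots>, c\<^sub>r\<close> from \<open>0\<close>.\<close>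

definition neg_gap :: "nat \<Rightarrow> real" where
  "neg_gap r = (2 - special_param r) / special_param r"

lemma neg_gap_pos: "2 \<le> r \<Longrightarrow> 0 < neg_gap r"
  using special_param_bounds[of r] sqrt2_bounds by (simp add: neg_gap_def)

text \<open>By induction on the index: while the earlier values are negative, raising the parameter
  lowers the next one. The values at a are therefore bounded by those at
  \<open>special_param r\<close>, the largest negative one being \<open>- neg_gap r\<close>.\<close>

lemma above_special_param:
  assumes r: "2 \<le> r" and a: "special_param r \<le> a" "a \<le> 2"
  shows "2 \<le> i \<Longrightarrow> i \<le> r \<Longrightarrow> turning_orbit a i \<le> - neg_gap r"
    and "turning_orbit a (Suc r) \<le> special_param r - 1"
    and "2 \<le> i \<Longrightarrow> i \<le> Suc r \<Longrightarrow> turning_orbit a i = neg_orbit a i"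
proof -
  let ?s = "special_param r"
  have s: "is_special r ?s" by (rule is_special_special_param[OF r])
  have s1: "1 < ?s" using special_param_bounds[OF r] sqrt2_bounds by simp
  have a1: "1 < a" using s1 a by simp
  have le: "neg_orbit a n \<le> neg_orbit ?s n \<and> (n \<le> r \<longrightarrow> neg_orbit a n \<le> - neg_gap r)" if "2 \<le> n" "n \<le> Suc r" for n
    using that
  proof (induction n rule: less_induct)
    case (less n)
    have 1: "neg_orbit a n \<le> neg_orbit ?s n"
    proof (cases "a = ?s")
      case False
      have "neg_orbit a n - neg_orbit ?s n \<le> - (a - ?s)"
      proof (rule neg_orbit_antimono_param[OF s1])
        fix i assume "2 \<le> i" "i < n"
        then have "neg_orbit a i \<le> - neg_gap r" using less by auto
        then show "neg_orbit a i \<le> 0" using neg_gap_pos[OF r] by simp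
      qed (use False a less in auto)
      then show ?thesis using a by simp
    qed simp
    have "neg_orbit ?s n \<le> - neg_gap r" if "n \<le> r"
      using neg_orbit_mono[OF s1, of n r] special_param_bounds[OF r] that less(2)
        is_special_neg(2)[OF s r] by (simp add: neg_gap_def)
    then show ?case using 1 by auto
  qed
  have "neg_orbit a r \<le> 0" using le[of r] r neg_gap_pos[OF r] by auto
  then show eq: "2 \<le> i \<Longrightarrow> i \<le> Suc r \<Longrightarrow> turning_orbit a i = neg_orbit a i" for i
    by (intro turning_orbit_neg_orbit[OF a1 a(2)])
  show "2 \<le> i \<Longrightarrow> i \<le> r \<Longrightarrow> turning_orbit a i \<le> - neg_gap r" using eq[of i] le[of i] by simp
  show "turning_orbit a (Suc r) \<le> ?s - 1"
    using eq[of "Suc r"] le[of "Suc r"] r s by (simp add: is_special_def)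
qed

text \<open>The same monotonicity, applied up to \<open>special_param (Suc r)\<close>, where the
  value at index r + 2 equals the parameter minus 1. It serves to place
  \<open>return_point r a\<close> above \<open>a - 1\<close>.\<close>

lemma below_special_param:
  assumes r: "2 \<le> r" and a: "1 < a" "a < special_param (Suc r)"
  shows "a - 1 < neg_orbit a (Suc (Suc r))"
proof -
  let ?s = "special_param (Suc r)"
  have s: "is_special (Suc r) ?s" using r by (intro is_special_special_param) simp
  have "neg_orbit ?s (Suc (Suc r)) - neg_orbit a (Suc (Suc r)) \<le> - (?s - a)"
    using a r is_special_neg(3)[OF s] by (intro neg_orbit_antimono_param) (auto simp: less_imp_le)
  then show ?thesis using s a by (simp add: is_special_def)
qed

section \<open>The modulus of continuity of the distribution function\<close>

text \<open>For the exponent \<open>1 - 1 / r\<close> the sharp constant is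
  \<open>2 powr (1 / r)\<close>, attained at s = t. After normalizing s + t = 1, a larger exponent
  only makes the left side smaller. This constant is the cost of cutting an interval at the turning
  point.\<close>

lemma powr_add_le:
  fixes s t \<alpha> :: real
  assumes r: "2 \<le> r" and \<alpha>: "1 - 1 / real r \<le> \<alpha>" and st: "0 \<le> s" "0 \<le> t"
  shows "s powr \<alpha> + t powr \<alpha> \<le> 2 powr (1 / real r) * (s + t) powr \<alpha>"
proof -
  define \<beta> where "\<beta> = 1 - 1 / real r"
  have \<beta>: "0 < \<beta>" "\<beta> < 1" "\<beta> \<le> \<alpha>" using r \<alpha> by (auto simp: \<beta>_def field_simps)
  have lam: "1 \<le> 2 powr (1 / real r)" by (rule ge_one_powr_ge_zero) auto
  show ?thesis
  proof (cases "s = 0 \<or> t = 0")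
    case True
    have "x powr \<alpha> \<le> 2 powr (1 / real r) * x powr \<alpha>" for x :: real
      using lam mult_right_mono[OF lam, of "x powr \<alpha>"] by simp
    then show ?thesis using True \<beta> by auto
  next
    case False
    then have pos: "0 < s" "0 < t" using st by auto
    define u v where "u = s / (s + t)" and "v = t / (s + t)"
    have uv: "0 < u" "0 < v" "u + v = 1"
      using pos by (auto simp: u_def v_def add_divide_distrib[symmetric])
    have "1 \<le> 1 / \<beta>" using \<beta> by simp
    \<comment> \<open>Jensen's inequality for the convex function with exponent
      \<open>1 / \<beta>\<close> at the points \<open>u powr \<beta>\<close> and
      \<open>v powr \<beta>\<close>.\<close>
    then have "(1 / 2 * u powr \<beta> + 1 / 2 * v powr \<beta>) powr (1 / \<beta>)
        \<le> 1 / 2 * (u powr \<beta>) powr (1 / \<beta>) + 1 / 2 * (v powr \<beta>) powr (1 / \<beta>)"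
      using convex_onD[OF powr_convex, of "1 / \<beta>" "1 / 2" "u powr \<beta>" "v powr \<beta>"] uv by simp
    also have "\<dots> = 1 / 2" using \<beta> uv by (simp add: powr_powr)
    finally have "((u powr \<beta> + v powr \<beta>) / 2) powr (1 / \<beta>) \<le> 1 / 2" by (simp add: add_divide_distrib)
    then have "(((u powr \<beta> + v powr \<beta>) / 2) powr (1 / \<beta>)) powr \<beta> \<le> (1 / 2) powr \<beta>"
      using \<beta> by (intro powr_mono2) auto
    then have "u powr \<beta> + v powr \<beta> \<le> 2 * (1 / 2) powr \<beta>" using \<beta> uv by (simp add: powr_powr)
    also have "\<dots> = 2 powr (1 - \<beta>)" by (simp add: powr_diff powr_divide)
    also have "1 - \<beta> = 1 / real r" by (simp add: \<beta>_def)
    finally have "u powr \<beta> + v powr \<beta> \<le> 2 powr (1 / real r)" .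
    moreover have "u powr \<alpha> \<le> u powr \<beta>" "v powr \<alpha> \<le> v powr \<beta>" using \<beta> uv by (auto intro!: powr_mono')
    ultimately have "u powr \<alpha> + v powr \<alpha> \<le> 2 powr (1 / real r)" by simp
    then have "(u powr \<alpha> + v powr \<alpha>) * (s + t) powr \<alpha> \<le> 2 powr (1 / real r) * (s + t) powr \<alpha>"
      by (rule mult_right_mono) simp
    moreover have "s = u * (s + t)" "t = v * (s + t)" using pos by (auto simp: u_def v_def)
    then have "s powr \<alpha> = u powr \<alpha> * (s + t) powr \<alpha>" "t powr \<alpha> = v powr \<alpha> * (s + t) powr \<alpha>"
      using pos uv by (metis add_nonneg_nonneg less_imp_le powr_mult)+
    ultimately show ?thesis by (simp add: distrib_right)
  qed
qed

context tent_cdf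
begin

lemma funpow_tent_lipschitz: "\<bar>(tent a ^^ n) x - (tent a ^^ n) y\<bar> \<le> a ^ n * \<bar>x - y\<bar>"
proof (induction n)
  case (Suc n)
  have "\<bar>tent a u - tent a v\<bar> \<le> a * \<bar>u - v\<bar>" for u v
  proof -
    have "\<bar>tent a u - tent a v\<bar> = a * \<bar>\<bar>u\<bar> - \<bar>v\<bar>\<bar>"
      using a_gt by (simp add: tent_def abs_mult flip: right_diff_distrib)
    also have "\<dots> \<le> a * \<bar>u - v\<bar>" using a_gt by (intro mult_left_mono) auto
    finally show ?thesis .
  qed
  then have "\<bar>(tent a ^^ Suc n) x - (tent a ^^ Suc n) y\<bar> \<le> a * \<bar>(tent a ^^ n) x - (tent a ^^ n) y\<bar>" by simp
  also have "\<dots> \<le> a * (a ^ n * \<bar>x - y\<bar>)" using Suc a_gt by (intro mult_left_mono) auto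
  finally show ?case by (simp add: mult.assoc)
qed simp

lemma funpow_tent_lipschitz2: "\<bar>(tent a ^^ n) x - (tent a ^^ n) y\<bar> \<le> 2 ^ n * \<bar>x - y\<bar>"
  by (rule order_trans[OF funpow_tent_lipschitz]) (use a_gt a_le in \<open>auto intro!: mult_right_mono power_mono\<close>)

lemma mid_step:
  assumes "x \<in> {1 - a..a - 1}" "y \<in> {1 - a..a - 1}" "0 \<le> x * y"
  shows "\<bar>F x - F y\<bar> = \<bar>F (tent a x) - F (tent a y)\<bar> / 2"
proof (cases "0 \<le> x \<and> 0 \<le> y")
  case True
  then have "F (tent a x) - F (tent a y) = 2 * (F y - F x)" using assms F_right[of x] F_right[of y] by auto
  then have "\<bar>F (tent a x) - F (tent a y)\<bar> = 2 * \<bar>F y - F x\<bar>" by (simp only: abs_mult abs_numeral)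
  then show ?thesis by (simp add: abs_minus_commute)
next
  case False
  then have "x \<le> 0" "y \<le> 0" using assms(3) by (auto simp: zero_le_mult_iff)
  then have "F (tent a x) - F (tent a y) = 2 * (F x - F y)" using assms F_left[of x] F_left[of y] by auto
  then have "\<bar>F (tent a x) - F (tent a y)\<bar> = 2 * \<bar>F x - F y\<bar>" by (simp only: abs_mult abs_numeral)
  then show ?thesis by simp
qed

text \<open>On the right of the turning point a step either halves or preserves increments, and both
  branches are decreasing. So nothing is lost even for an interval across
  \<open>a - 1\<close>.\<close>

lemma pos_step:
  assumes "x \<in> {0..1}" "y \<in> {0..1}"
  shows "\<bar>F x - F y\<bar> \<le> \<bar>F (tent a x) - F (tent a y)\<bar>"
proof -
  have *: "\<bar>F x - F y\<bar> \<le> \<bar>F (tent a x) - F (tent a y)\<bar>" if xy: "0 \<le> x" "x \<le> y" "y \<le> 1" for x y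
  proof -
    have m: "F x \<le> F y" using xy a_gt by (intro F_mono) auto
    consider "y \<le> a - 1" | "x \<le> a - 1" "a - 1 \<le> y" | "a - 1 \<le> x" by linarith
    then show ?thesis
    proof cases
      case 1 then show ?thesis using F_right[of x] F_right[of y] xy by auto
    next
      case 2
      have "F x \<le> F (a - 1)" using 2 xy a_gt a_le by (intro F_mono) auto
      then show ?thesis using 2 m F_right[of x] F_high[of y] F_chat2 xy by auto
    next
      case 3 then show ?thesis using F_high[of x] F_high[of y] xy by auto
    qed
  qed
  show ?thesis using assms *[of x y] *[of y x] by (cases "x \<le> y") (auto simp: abs_minus_commute)
qed

lemma neg_run:
  assumes "u \<in> {1 - a..1}" "v \<in> {1 - a..1}" "\<And>i. i < k \<Longrightarrow> (tent a ^^ i) u \<le> 0" "\<And>i. i < k \<Longrightarrow> (tent a ^^ i) v \<le> 0"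
  shows "F u - F v = (F ((tent a ^^ k) u) - F ((tent a ^^ k) v)) / 2 ^ k"
  using assms(3,4)
proof (induction k)
  case (Suc k)
  let ?u = "(tent a ^^ k) u" and ?v = "(tent a ^^ k) v"
  have "?u \<in> {1 - a..1}" "?v \<in> {1 - a..1}" using assms(1,2) by (auto intro!: funpow_tent_mem[unfolded atLeastAtMost_iff])
  then have "F (tent a ?u) - F (tent a ?v) = 2 * (F ?u - F ?v)"
    using F_left[of ?u] F_left[of ?v] Suc.prems[of k] by auto
  then have "(F ((tent a ^^ Suc k) u) - F ((tent a ^^ Suc k) v)) / 2 ^ Suc k = 2 * (F ?u - F ?v) / 2 ^ Suc k"
    by (simp only: funpow.simps o_apply)
  also have "\<dots> = (F ?u - F ?v) / 2 ^ k" by (simp only: power_Suc mult_divide_mult_cancel_left_if) simp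
  also have "\<dots> = F u - F v" using Suc by simp
  finally show ?case by simp
qed simp

end

section \<open>Halvings along the turning orbit and between returns\<close>

locale tent_special = tent_cdf a F for a F +
  fixes r :: nat
  assumes r2: "2 \<le> r" and above: "special_param r \<le> a"
begin

lemma c_neg: "2 \<le> i \<Longrightarrow> i \<le> r \<Longrightarrow> turning_orbit a i \<le> - neg_gap r"
  by (rule above_special_param(1)[OF r2 above a_le])

lemma c_Suc_r: "turning_orbit a (Suc r) \<le> a - 1"
  using above_special_param(2)[OF r2 above a_le] above by linarith

lemma gap_pos: "0 < neg_gap r"
  by (rule neg_gap_pos[OF r2])

lemma c_funpow: "turning_orbit a (n + k) = (tent a ^^ k) (turning_orbit a n)"
  by (simp add: turning_orbit_def funpow_add add.commute)

lemma c_mem: "turning_orbit a n \<in> {1 - a..1}"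
  unfolding turning_orbit_def by (rule funpow_tent_mem) (use a_gt in auto)

text \<open>The step at 0 halves, the step near 1 may preserve, and the r - 1 steps near the points
  of indices 2 to r halve: r halvings in r + 1 steps. \<open>neg_gap\<close> keeps the orbit of x on
  the negative side during the last of these.\<close>

lemma turning_block:
  assumes x: "2 ^ Suc r * \<bar>x\<bar> \<le> neg_gap r" "\<bar>x\<bar> \<le> 1 / 4"
  shows "\<bar>F x - F 0\<bar> \<le> \<bar>F ((tent a ^^ Suc r) x) - F (turning_orbit a (Suc r))\<bar> / 2 ^ r"
proof -
  let ?c = "turning_orbit a"
  have c0: "?c n = (tent a ^^ n) 0" for n by (simp add: turning_orbit_def)
  have xI: "x \<in> {1 - a..1}" using x a_gt by auto
  have "\<bar>F x - F 0\<bar> = \<bar>F (tent a x) - F (tent a 0)\<bar> / 2"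
    using x a_gt by (intro mid_step) auto
  also have "\<bar>F (tent a x) - F (tent a 0)\<bar> \<le> \<bar>F (tent a (tent a x)) - F (tent a (tent a 0))\<bar>"
  proof (rule pos_step)
    have "a * \<bar>x\<bar> \<le> 2 * (1 / 4)" using x a_gt a_le by (intro mult_mono) auto
    then show "tent a x \<in> {0..1}" using a_gt by (simp add: tent_def)
  qed (simp add: tent_def)
  also have "\<bar>F (tent a (tent a x)) - F (tent a (tent a 0))\<bar> = \<bar>F ((tent a ^^ 2) x) - F (?c 2)\<bar>"
    by (simp add: c0 numeral_2_eq_2)
  also have "F ((tent a ^^ 2) x) - F (?c 2)
      = (F ((tent a ^^ (r - 1)) ((tent a ^^ 2) x)) - F ((tent a ^^ (r - 1)) (?c 2))) / 2 ^ (r - 1)"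
  proof (rule neg_run[OF funpow_tent_mem[OF xI] c_mem])
    fix i assume i: "i < r - 1"
    have ci: "(tent a ^^ i) (?c 2) = ?c (2 + i)" by (rule c_funpow[symmetric])
    have neg: "?c (2 + i) \<le> - neg_gap r" using i by (intro c_neg) auto
    then show "(tent a ^^ i) (?c 2) \<le> 0" using ci gap_pos by simp
    have "\<bar>(tent a ^^ (2 + i)) x - ?c (2 + i)\<bar> \<le> 2 ^ (2 + i) * \<bar>x\<bar>"
      using funpow_tent_lipschitz2[of "2 + i" x 0] by (simp only: c0 diff_0_right)
    also have "\<dots> \<le> 2 ^ Suc r * \<bar>x\<bar>" using i by (intro mult_right_mono power_increasing) auto
    finally have "(tent a ^^ (2 + i)) x \<le> 0" using x neg by linarith
    moreover have "(tent a ^^ i) ((tent a ^^ 2) x) = (tent a ^^ (2 + i)) x"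
      unfolding add.commute[of 2 i] funpow_add by simp
    ultimately show "(tent a ^^ i) ((tent a ^^ 2) x) \<le> 0" by simp
  qed
  also have "(tent a ^^ (r - 1)) ((tent a ^^ 2) x) = (tent a ^^ Suc r) x"
  proof -
    have "Suc r = (r - 1) + 2" using r2 by simp
    then show ?thesis by (simp only: funpow_add o_apply)
  qed
  also have "(tent a ^^ (r - 1)) (?c 2) = ?c (Suc r)"
    using c_funpow[of 2 "r - 1"] r2 by (simp add: numeral_2_eq_2)
  also have "\<bar>(F ((tent a ^^ Suc r) x) - F (?c (Suc r))) / 2 ^ (r - 1)\<bar> / 2
      = \<bar>F ((tent a ^^ Suc r) x) - F (?c (Suc r))\<bar> / 2 ^ r"
    using r2 by (cases r) (auto simp: abs_divide)
  finally show ?thesis by (simp add: divide_right_mono)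
qed

text \<open>The image of \<open>[a - 1, 1]\<close> lies below that of \<open>a - 1\<close>, the
  turning orbit's point of index 3. As these points are negative up to index r, the increasing
  branch preserves the order.\<close>

lemma high_orbit:
  assumes "a - 1 \<le> x" "x \<le> 1" "i + 1 \<le> r" "1 \<le> i"
  shows "(tent a ^^ i) x \<le> turning_orbit a (i + 2)"
  using assms(4,3)
proof (induction i rule: dec_induct)
  case base
  have c3: "turning_orbit a 3 = 1 - a * (a - 1)" using a_gt by (simp add: turning_orbit_def tent_def numeral_3_eq_3)
  have "a * (a - 1) \<le> a * x" using assms a_gt by (intro mult_left_mono) auto
  then have "tent a x \<le> 1 - a * (a - 1)" using assms a_gt by (simp add: tent_def)
  then show ?case using c3 by (simp add: numeral_3_eq_3)
next
  case (step i)
  let ?u = "(tent a ^^ i) x" and ?c = "turning_orbit a (i + 2)"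
  have le: "?u \<le> ?c" "?c \<le> 0" using step c_neg[of "i + 2"] gap_pos by auto
  then have "tent a ?u = 1 + a * ?u" "tent a ?c = 1 + a * ?c" by (auto simp: tent_def)
  moreover have "a * ?u \<le> a * ?c" using le a_gt by (intro mult_left_mono) auto
  ultimately show ?case by (simp add: turning_orbit_Suc)
qed

text \<open>The return to the region with a single preimage takes at least \<open>r\<close> steps; a pair of points
  on different sides of \<open>a - 1\<close> may return after \<open>r - 1\<close> steps but still gains \<open>2\<^bsup>r-1\<^esup>\<close>.\<close>

lemma high_block:
  fixes x y :: real
  defines "X \<equiv> (tent a ^^ (r - 1)) x" and "Y \<equiv> (tent a ^^ (r - 1)) y"
  assumes x: "a - 1 < x" "x \<le> 1" and y: "0 \<le> y" "y \<le> 1" and small: "2 ^ Suc r * \<bar>x - y\<bar> \<le> neg_gap r"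
  shows "\<bar>F x - F y\<bar> \<le> \<bar>F X - F Y\<bar> / 2 ^ (r - 2)"
    and "0 \<le> X * Y \<Longrightarrow> \<bar>F x - F y\<bar> \<le> \<bar>F (tent a X) - F (tent a Y)\<bar> / 2 ^ (r - 1)"
proof -
  let ?c = "turning_orbit a"
  have xI: "x \<in> {1 - a..1}" and yI: "y \<in> {1 - a..1}" using x y a_gt by auto
  have XI: "X \<in> {1 - a..1}" and YI: "Y \<in> {1 - a..1}"
    unfolding X_def Y_def using funpow_tent_mem[OF xI] funpow_tent_mem[OF yI] by auto
  have r1: "r - 1 = Suc (r - 2)" using r2 by simp
  have shift: "(tent a ^^ i) (tent a z) = (tent a ^^ Suc i) z" for i z by (simp add: funpow_swap1)
  have negx: "(tent a ^^ i) (tent a x) \<le> - neg_gap r" if "i < r - 2" for i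
  proof -
    have i: "Suc i + 1 \<le> r" "Suc i + 2 \<le> r" using that by auto
    have "(tent a ^^ Suc i) x \<le> turning_orbit a (Suc i + 2)" using x i by (intro high_orbit) auto
    also have "\<dots> \<le> - neg_gap r" using i by (intro c_neg) auto
    finally show ?thesis unfolding shift .
  qed
  have negy: "(tent a ^^ i) (tent a y) \<le> 0" if "i < r - 2" for i
  proof -
    have "\<bar>(tent a ^^ Suc i) x - (tent a ^^ Suc i) y\<bar> \<le> 2 ^ Suc i * \<bar>x - y\<bar>" by (rule funpow_tent_lipschitz2)
    also have "\<dots> \<le> 2 ^ Suc r * \<bar>x - y\<bar>" using that by (intro mult_right_mono power_increasing) auto
    finally show ?thesis using negx[OF that] small unfolding shift by linarith
  qed
  have negc: "(tent a ^^ i) (?c 3) \<le> 0" if "i < r - 2" for i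
  proof -
    have "3 + i \<le> r" using that by simp
    then have "?c (3 + i) \<le> - neg_gap r" by (intro c_neg) auto
    then show ?thesis using gap_pos by (simp add: c_funpow)
  qed
  have all: "w \<in> {1 - a..1} \<and> (\<forall>i<r - 2. (tent a ^^ i) w \<le> 0)" if "w \<in> {tent a x, tent a y, ?c 3}" for w
    using that tent_mem[OF xI] tent_mem[OF yI] c_mem[of 3] negy negc negx gap_pos
    by (fastforce intro: order_trans)
  have run: "F u - F v = (F ((tent a ^^ (r - 2)) u) - F ((tent a ^^ (r - 2)) v)) / 2 ^ (r - 2)"
    if "u \<in> {tent a x, tent a y, ?c 3}" "v \<in> {tent a x, tent a y, ?c 3}" for u v
    using all[OF that(1)] all[OF that(2)] by (intro neg_run) auto
  have X: "X = (tent a ^^ (r - 2)) (tent a x)" and Y: "Y = (tent a ^^ (r - 2)) (tent a y)"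
    unfolding X_def Y_def r1 by (simp_all add: shift)
  define c where "c = ?c (Suc r)"
  have idx: "Suc r = 3 + (r - 2)" "r - 1 + 2 = Suc r" using r2 by auto
  have c: "(tent a ^^ (r - 2)) (?c 3) = c" unfolding c_def idx(1) by (rule c_funpow[symmetric])
  have cI: "1 - a \<le> c" "c \<le> a - 1" using c_mem[of "Suc r"] c_Suc_r by (auto simp: c_def)
  have c3: "?c 3 = 1 - a * (a - 1)" using a_gt by (simp add: turning_orbit_def tent_def numeral_3_eq_3)
  have high_le_c: "(tent a ^^ (r - 1)) z \<le> c" if "a - 1 \<le> z" "z \<le> 1" for z
    using high_orbit[OF that, of "r - 1"] r2 unfolding idx(2) c_def by simp
  have Xc: "X \<le> c" using high_le_c[of x] x by (simp add: X_def)
  let ?p = "2 ^ (r - 2) :: real"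
  have p2: "2 ^ (r - 1) = 2 * ?p" unfolding r1 by simp
  have "\<bar>F x - F y\<bar> \<le> \<bar>F X - F Y\<bar> / ?p \<and> (0 \<le> X * Y \<longrightarrow> \<bar>F x - F y\<bar> \<le> \<bar>F (tent a X) - F (tent a Y)\<bar> / 2 / ?p)"
  proof (cases "a - 1 \<le> y")
    case True
    have "\<bar>F x - F y\<bar> = \<bar>F (tent a x) - F (tent a y)\<bar>" using F_high[of x] F_high[of y] True x y by auto
    also have "\<dots> = \<bar>F X - F Y\<bar> / ?p" using run[of "tent a x" "tent a y"] by (simp add: X Y abs_divide)
    finally have 1: "\<bar>F x - F y\<bar> = \<bar>F X - F Y\<bar> / ?p" .
    have "Y \<le> c" using high_le_c[of y] True y by (simp add: Y_def)
    then have "\<bar>F X - F Y\<bar> = \<bar>F (tent a X) - F (tent a Y)\<bar> / 2" if "0 \<le> X * Y"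
      using that XI YI Xc cI by (intro mid_step) auto
    then have "\<bar>F x - F y\<bar> = \<bar>F (tent a X) - F (tent a Y)\<bar> / 2 / ?p" if "0 \<le> X * Y"
      unfolding 1 using that by (simp only:)
    then show ?thesis using 1 by (intro conjI impI) (simp_all only: order_refl)
  next
    \<comment> \<open>Now y < a - 1 < x. The interval is cut at \<open>a - 1\<close>, whose iterate
      of order r - 1 is c. The part above enters with weight 1 and the part below, already halved,
      with weight 1/2.\<close>
    case False
    have "F x - F y = 1 - F (tent a x) - (1 / 2 + F 0 - F (tent a y) / 2)"
      using F_high[of x] F_right[of y] x y False by (simp add: field_simps)
    also have "\<dots> = (F (?c 3) - F (tent a x)) + (F (tent a y) - F (?c 3)) / 2"
      using F_c3 by (simp add: c3 field_simps)
    also have "\<dots> = ((F c - F X) + (F Y - F c) / 2) / ?p"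
      using run[of "?c 3" "tent a x"] run[of "tent a y" "?c 3"] by (simp add: X Y c add_divide_distrib)
    finally have eq: "F x - F y = ((F c - F X) + (F Y - F c) / 2) / ?p" .
    have Yc: "c \<le> Y"
    proof -
      have "tent a y \<ge> ?c 3" using mult_left_mono[of y "a - 1" a] False y a_gt by (simp add: c3 tent_def)
      have "?c (3 + i) \<le> (tent a ^^ i) (tent a y)" if "i \<le> r - 2" for i
        using that
      proof (induction i)
        case 0 then show ?case using \<open>tent a y \<ge> ?c 3\<close> by simp
      next
        case (Suc i)
        let ?u = "(tent a ^^ i) (tent a y)"
        have "?u \<le> 0" "?c (3 + i) \<le> 0" using negy[of i] negc[of i] Suc by (auto simp: c_funpow)
        then have "tent a (?c (3 + i)) = 1 + a * ?c (3 + i)" "tent a ?u = 1 + a * ?u" by (simp_all add: tent_def)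
        moreover have "a * ?c (3 + i) \<le> a * ?u" using Suc a_gt by (intro mult_left_mono) auto
        ultimately have "tent a (?c (3 + i)) \<le> tent a ?u" by simp
        then show ?case by (simp only: add_Suc_right turning_orbit_Suc funpow.simps o_apply)
      qed
      from this[of "r - 2"] show ?thesis unfolding c_funpow Y c by simp
    qed
    have mon: "F X \<le> F c" "F c \<le> F Y" "F y \<le> F x"
      using XI YI Xc Yc cI False x y a_gt by (auto intro!: F_mono)
    have 1: "\<bar>F x - F y\<bar> \<le> \<bar>F X - F Y\<bar> / ?p"
    proof -
      have "\<bar>F x - F y\<bar> = ((F c - F X) + (F Y - F c) / 2) / ?p" using mon eq by simp
      also have "\<dots> \<le> \<bar>F X - F Y\<bar> / ?p" using mon by (intro divide_right_mono) (auto simp: field_simps)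
      finally show ?thesis .
    qed
    have "\<bar>F x - F y\<bar> \<le> \<bar>F (tent a X) - F (tent a Y)\<bar> / 2 / ?p" if XY: "0 \<le> X * Y"
    proof (cases "Y \<le> a - 1")
      case True
      then have "\<bar>F X - F Y\<bar> = \<bar>F (tent a X) - F (tent a Y)\<bar> / 2"
        using XY XI YI Xc cI by (intro mid_step) auto
      then show ?thesis using 1 by (simp only:)
    next
      \<comment> \<open>Y has returned to the region without halving, but its part was halved in the
        first step. The claim reduces to \<open>F c \<le> F (a - 1) = 2 * F 0\<close>, which is
        where \<open>c \<le> a - 1\<close> enters.\<close>
      case False
      then have "0 \<le> X" using XY a_gt by (auto simp: zero_le_mult_iff)
      have "F Y = 1 - F (tent a Y)" using F_high[of Y] False YI by simp
      moreover have "F X = F 0 + 1 / 2 - F (tent a X) / 2" using F_right[of X] \<open>0 \<le> X\<close> Xc cI by (simp add: field_simps)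
      moreover have "F c \<le> 2 * F 0" using F_mono[of c "a - 1"] cI a_le F_chat2 by simp
      ultimately have "(F c - F X) + (F Y - F c) / 2 \<le> (F (tent a X) - F (tent a Y)) / 2" by argo
      also have "\<dots> \<le> \<bar>F (tent a X) - F (tent a Y)\<bar> / 2" by (intro divide_right_mono abs_ge_self) simp
      finally have "((F c - F X) + (F Y - F c) / 2) / ?p \<le> \<bar>F (tent a X) - F (tent a Y)\<bar> / 2 / ?p"
        by (rule divide_right_mono) simp
      moreover have "\<bar>F x - F y\<bar> = F x - F y" using mon by simp
      ultimately show ?thesis unfolding eq by (simp only:)
    qed
    then show ?thesis using 1 by simp
  qed
  then show "\<bar>F x - F y\<bar> \<le> \<bar>F X - F Y\<bar> / 2 ^ (r - 2)"
    and "0 \<le> X * Y \<Longrightarrow> \<bar>F x - F y\<bar> \<le> \<bar>F (tent a X) - F (tent a Y)\<bar> / 2 ^ (r - 1)"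
    unfolding p2 by auto
qed

end

section \<open>Iterative improvement of the Hoelder estimate\<close>

locale tent_holder = tent_special a F r for a F r +
  fixes \<alpha> lam :: real
  assumes alpha: "1 - 1 / real r \<le> \<alpha>" and lam_def: "lam = 2 powr (1 / real r)"
    and rho_le: "a powr \<alpha> \<le> 2 / lam"
begin

lemma lam_gt_1: "1 < lam"
  unfolding lam_def using r2 by (simp add: gr_one_powr)

lemma lam_power: "lam ^ r = 2"
  unfolding lam_def using r2 by (simp add: powr_power)

lemma lam_sq: "lam\<^sup>2 \<le> 2"
  using power_increasing[of 2 r lam] lam_power lam_gt_1 r2 by simp

lemma alpha_pos: "0 < \<alpha>"
proof -
  have "1 / real r < 1" using r2 by simp
  then show ?thesis using alpha by linarith
qed

text \<open>The factor by which the Hoelder bound can grow in one step. The hypothesis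
  \<open>rho \<le> 2 / lam\<close> says that r steps with r - 1 halvings are just balanced; equality
  holds for \<open>\<alpha> = holder_exponent r b\<close> at \<open>a = b\<close>.\<close>

definition "rho = a powr \<alpha>"

lemma rho_pos: "0 < rho"
  using a_gt by (simp add: rho_def)

lemma rho_power_le: "rho ^ n \<le> (2 / lam) ^ n"
  using rho_le rho_pos by (intro power_mono) (auto simp: rho_def)

lemma rho_bounds:
  "rho / 2 \<le> 1 / lam" "rho ^ r \<le> 2 ^ (r - 1)" "rho ^ (r - 1) \<le> 2 ^ (r - 2) * lam"
  "rho ^ (r + 2) \<le> 2 ^ (r + 1) / lam\<^sup>2" "rho ^ Suc r \<le> 2 ^ r / lam"
proof -
  have p: "(2 / lam) ^ n = 2 ^ n / lam ^ n" for n by (rule power_divide)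
  obtain k where k: "r = Suc (Suc k)" using r2 by (metis Suc_le_D numeral_2_eq_2 Suc_le_mono)
  show "rho / 2 \<le> 1 / lam" using rho_le by (simp add: rho_def)
  show "rho ^ r \<le> 2 ^ (r - 1)" using rho_power_le[of r] k lam_power by (simp add: p)
  have "lam ^ (r - 1) = 2 / lam" using lam_power lam_gt_1 by (simp add: k field_simps)
  then show "rho ^ (r - 1) \<le> 2 ^ (r - 2) * lam" using rho_power_le[of "r - 1"] k by (simp add: p)
  show "rho ^ (r + 2) \<le> 2 ^ (r + 1) / lam\<^sup>2"
    using rho_power_le[of "r + 2"] lam_power by (simp add: p power_add power2_eq_square)
  show "rho ^ Suc r \<le> 2 ^ r / lam" using rho_power_le[of "Suc r"] lam_power by (simp add: p)
qed

lemma powr_scale: "0 \<le> t \<Longrightarrow> (a ^ n * t) powr \<alpha> = rho ^ n * t powr \<alpha>"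
  using a_gt by (simp add: powr_mult rho_def powr_power powr_realpow[symmetric] powr_powr mult.commute)

lemma powr_funpow_le: "\<bar>(tent a ^^ n) x - (tent a ^^ n) y\<bar> powr \<alpha> \<le> rho ^ n * \<bar>x - y\<bar> powr \<alpha>"
proof -
  have "\<bar>(tent a ^^ n) x - (tent a ^^ n) y\<bar> powr \<alpha> \<le> (a ^ n * \<bar>x - y\<bar>) powr \<alpha>"
    using alpha_pos by (intro powr_mono2 funpow_tent_lipschitz) auto
  then show ?thesis by (simp add: powr_scale)
qed

text \<open>The additive error is the quantity that is iterated: it starts at 1, because F has
  values in [0, 1], and each round halves it while C stays fixed.\<close>

definition holder_err :: "real \<Rightarrow> real \<Rightarrow> bool" where
  "holder_err C e \<longleftrightarrow> (\<forall>x\<in>{1 - a..1}. \<forall>y\<in>{1 - a..1}. \<bar>F x - F y\<bar> \<le> C * \<bar>x - y\<bar> powr \<alpha> + e)"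

text \<open>The estimate at the turning point is better by \<open>lam\<^sup>2\<close>, which pays for splitting an interval
  there into two.\<close>

definition fold_err :: "real \<Rightarrow> real \<Rightarrow> bool" where
  "fold_err C e \<longleftrightarrow> (\<forall>x\<in>{1 - a..1}. \<bar>F x - F 0\<bar> \<le> C / lam\<^sup>2 * \<bar>x\<bar> powr \<alpha> + e)"

text \<open>The cut costs \<open>lam\<close> by \<open>powr_add_le\<close>, against the
  \<open>lam\<^sup>2\<close> gained on each side in \<open>fold_err\<close>. One factor
  \<open>1 / lam\<close> is left over.\<close>

lemma split_at_0:
  assumes "fold_err C e" "0 \<le> C" and XY: "X \<in> {1 - a..1}" "Y \<in> {1 - a..1}" "X * Y \<le> 0"
  shows "\<bar>F X - F Y\<bar> \<le> C / lam * \<bar>X - Y\<bar> powr \<alpha> + 2 * e"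
proof -
  have "\<bar>F X - F Y\<bar> \<le> \<bar>F X - F 0\<bar> + \<bar>F Y - F 0\<bar>" by linarith
  also have "\<dots> \<le> (C / lam\<^sup>2 * \<bar>X\<bar> powr \<alpha> + e) + (C / lam\<^sup>2 * \<bar>Y\<bar> powr \<alpha> + e)"
    using assms(1) XY by (intro add_mono) (auto simp: fold_err_def)
  also have "\<dots> = C / lam\<^sup>2 * (\<bar>X\<bar> powr \<alpha> + \<bar>Y\<bar> powr \<alpha>) + 2 * e" by (simp add: distrib_left)
  also have "\<dots> \<le> C / lam\<^sup>2 * (lam * (\<bar>X\<bar> + \<bar>Y\<bar>) powr \<alpha>) + 2 * e"
    using powr_add_le[OF r2 alpha, of "\<bar>X\<bar>" "\<bar>Y\<bar>"] assms(2)
    by (intro add_right_mono mult_left_mono) (auto simp: lam_def)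
  also have "\<bar>X\<bar> + \<bar>Y\<bar> = \<bar>X - Y\<bar>" using XY(3) by (auto simp: mult_le_0_iff)
  also have "C / lam\<^sup>2 * (lam * \<bar>X - Y\<bar> powr \<alpha>) = C / lam * \<bar>X - Y\<bar> powr \<alpha>"
    using lam_gt_1 by (simp add: power2_eq_square)
  finally show ?thesis .
qed

text \<open>If n steps gain the factor q, the bound C is reproduced with the factor K whenever
  \<open>rho ^ n * q \<le> K\<close>, and the additive error shrinks by q.\<close>

lemma scaled_step:
  assumes "holder_err C e" "0 \<le> C" and I: "x \<in> {1 - a..1}" "y \<in> {1 - a..1}"
    and D: "D \<le> \<bar>F ((tent a ^^ n) x) - F ((tent a ^^ n) y)\<bar> * q" "0 \<le> q" "rho ^ n * q \<le> K"
  shows "D \<le> K * C * \<bar>x - y\<bar> powr \<alpha> + q * e"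
proof -
  let ?x = "(tent a ^^ n) x" and ?y = "(tent a ^^ n) y"
  have "\<bar>F ?x - F ?y\<bar> \<le> C * \<bar>?x - ?y\<bar> powr \<alpha> + e"
    using assms(1) funpow_tent_mem[OF I(1)] funpow_tent_mem[OF I(2)] by (auto simp: holder_err_def)
  also have "\<dots> \<le> C * (rho ^ n * \<bar>x - y\<bar> powr \<alpha>) + e"
    using assms(2) by (intro add_right_mono mult_left_mono powr_funpow_le) auto
  finally have "\<bar>F ?x - F ?y\<bar> * q \<le> (C * (rho ^ n * \<bar>x - y\<bar> powr \<alpha>) + e) * q" using D(2) by (rule mult_right_mono)
  also have "\<dots> = (rho ^ n * q) * (C * \<bar>x - y\<bar> powr \<alpha>) + q * e" by (simp add: algebra_simps)
  also have "\<dots> \<le> K * (C * \<bar>x - y\<bar> powr \<alpha>) + q * e"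
    using D(3) assms(2) by (intro add_right_mono mult_right_mono) auto
  finally show ?thesis using D(1) by (simp add: mult.assoc)
qed

lemma split_step:
  assumes "fold_err C e" "0 \<le> C" and I: "x \<in> {1 - a..1}" "y \<in> {1 - a..1}"
    and D: "D \<le> \<bar>F ((tent a ^^ n) x) - F ((tent a ^^ n) y)\<bar> * q" "0 \<le> q" "rho ^ n * q / lam \<le> K"
    and XY: "(tent a ^^ n) x * (tent a ^^ n) y \<le> 0"
  shows "D \<le> K * C * \<bar>x - y\<bar> powr \<alpha> + q * (2 * e)"
proof -
  let ?x = "(tent a ^^ n) x" and ?y = "(tent a ^^ n) y"
  have "\<bar>F ?x - F ?y\<bar> \<le> C / lam * \<bar>?x - ?y\<bar> powr \<alpha> + 2 * e"
    by (rule split_at_0[OF assms(1,2) funpow_tent_mem[OF I(1)] funpow_tent_mem[OF I(2)] XY])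
  also have "\<dots> \<le> C / lam * (rho ^ n * \<bar>x - y\<bar> powr \<alpha>) + 2 * e"
    using assms(2) lam_gt_1 by (intro add_right_mono mult_left_mono powr_funpow_le) auto
  finally have "\<bar>F ?x - F ?y\<bar> * q \<le> (C / lam * (rho ^ n * \<bar>x - y\<bar> powr \<alpha>) + 2 * e) * q" using D(2) by (rule mult_right_mono)
  also have "\<dots> = (rho ^ n * q / lam) * (C * \<bar>x - y\<bar> powr \<alpha>) + q * (2 * e)" by (simp add: algebra_simps)
  also have "\<dots> \<le> K * (C * \<bar>x - y\<bar> powr \<alpha>) + q * (2 * e)"
    using D(3) assms(2) by (intro add_right_mono mult_right_mono) auto
  finally show ?thesis using D(1) by (simp add: mult.assoc)
qed

text \<open>Below the scale d there are four configurations: a pair with a point above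
  \<open>a - 1\<close>, with or without a cut at 0 after r - 1 steps, and a pair in the middle
  region, with or without a cut at once. In each the constant C is reproduced and the additive error
  is at most e / 2. From scale d on, C makes the bound trivial.\<close>

lemma general_step:
  assumes h: "holder_err C e" and f: "fold_err C (e / 8)" and e: "0 \<le> e"
    and d: "0 < d" "d \<le> 1 / 4" "2 ^ Suc r * d \<le> neg_gap r" and C: "2 \<le> C * d powr \<alpha>"
  shows "holder_err C (e / 2)"
proof -
  have C0: "0 \<le> C" using C d by (smt (verit) mult_nonneg_nonneg powr_ge_zero mult_neg_pos powr_gt_zero)
  have *: "\<bar>F x - F y\<bar> \<le> C * \<bar>x - y\<bar> powr \<alpha> + e / 2"
    if I: "x \<in> {1 - a..1}" "y \<in> {1 - a..1}" and yx: "y \<le> x" for x y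
  proof (cases "d \<le> \<bar>x - y\<bar>")
    case True
    have "\<bar>F x - F y\<bar> \<le> 1" using F_bounds[OF I(1)] F_bounds[OF I(2)] by linarith
    also have "1 \<le> C * d powr \<alpha>" using C by simp
    also have "\<dots> \<le> C * \<bar>x - y\<bar> powr \<alpha>" using True d C0 alpha_pos by (intro mult_left_mono powr_mono2) auto
    finally show ?thesis using e by simp
  next
    case False
    then have small: "2 ^ Suc r * \<bar>x - y\<bar> \<le> neg_gap r"
      using d by (intro order_trans[OF mult_left_mono d(3)]) auto
    show ?thesis
    proof (cases "a - 1 < x")
      case True
      have "\<bar>x - y\<bar> < 1 / 4" using False d(2) by linarith
      moreover have "7 / 5 < a" using a_gt by simp
      ultimately have y0: "0 \<le> y" using True by linarith
      let ?X = "(tent a ^^ (r - 1)) x" and ?Y = "(tent a ^^ (r - 1)) y"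
      note hb = high_block[of x y, OF True _ y0 _ small]
      have r1: "Suc (r - 1) = r" using r2 by simp
      show ?thesis
      proof (cases "0 \<le> ?X * ?Y")
        case True
        have fr: "tent a ((tent a ^^ (r - 1)) z) = (tent a ^^ r) z" for z
          using r1 by (metis funpow.simps(2) o_apply)
        have "\<bar>F x - F y\<bar> \<le> \<bar>F ((tent a ^^ r) x) - F ((tent a ^^ r) y)\<bar> * (1 / 2 ^ (r - 1))"
          using hb(2) True I unfolding fr by simp
        then have "\<bar>F x - F y\<bar> \<le> 1 * C * \<bar>x - y\<bar> powr \<alpha> + 1 / 2 ^ (r - 1) * e"
          by (rule scaled_step[OF h C0 I]) (use rho_bounds(2) in auto)
        also have "1 / 2 ^ (r - 1) * e \<le> 1 / 2 * e"
          using e r2 power_increasing[of 1 "r - 1" "2::real"] by (intro mult_right_mono divide_left_mono) auto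
        finally show ?thesis by simp
      next
        case False
        \<comment> \<open>There are only r - 2 halvings in r - 1 steps. The missing factor
          \<open>lam\<close> is the one left over by the cut at 0.\<close>
        have "\<bar>F x - F y\<bar> \<le> \<bar>F ?X - F ?Y\<bar> * (1 / 2 ^ (r - 2))" using hb(1) I by simp
        then have "\<bar>F x - F y\<bar> \<le> 1 * C * \<bar>x - y\<bar> powr \<alpha> + 1 / 2 ^ (r - 2) * (2 * (e / 8))"
          by (rule split_step[OF f C0 I]) (use False rho_bounds(3) lam_gt_1 in \<open>auto simp: field_simps\<close>)
        also have "1 / 2 ^ (r - 2) * (2 * (e / 8)) \<le> 1 * (2 * (e / 8))"
          using e by (intro mult_right_mono) auto
        finally show ?thesis using e by simp
      qed
    next
      case False
      then have mid: "x \<in> {1 - a..a - 1}" "y \<in> {1 - a..a - 1}" using I yx by auto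
      show ?thesis
      proof (cases "0 \<le> x * y")
        case True
        have "\<bar>F x - F y\<bar> \<le> \<bar>F ((tent a ^^ 1) x) - F ((tent a ^^ 1) y)\<bar> * (1 / 2)"
          using mid_step[OF mid True] by simp
        then have "\<bar>F x - F y\<bar> \<le> 1 * C * \<bar>x - y\<bar> powr \<alpha> + 1 / 2 * e"
        proof (rule scaled_step[OF h C0 I])
          have "1 / lam \<le> 1" using lam_gt_1 by simp
          then show "rho ^ 1 * (1 / 2) \<le> 1" using rho_bounds(1) by simp
        qed simp
        then show ?thesis by simp
      next
        case False
        then have "\<bar>F x - F y\<bar> \<le> C / lam * \<bar>x - y\<bar> powr \<alpha> + 2 * (e / 8)"
          by (intro split_at_0[OF f C0 I]) auto
        moreover have "C / lam \<le> C / 1" using C0 lam_gt_1 by (intro divide_left_mono) auto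
        then have "C / lam * \<bar>x - y\<bar> powr \<alpha> \<le> C * \<bar>x - y\<bar> powr \<alpha>" by (intro mult_right_mono) auto
        ultimately show ?thesis using e by linarith
      qed
    qed
  qed
  show ?thesis
    unfolding holder_err_def
  proof (intro ballI)
    fix x y assume "x \<in> {1 - a..1}" "y \<in> {1 - a..1}"
    then show "\<bar>F x - F y\<bar> \<le> C * \<bar>x - y\<bar> powr \<alpha> + e / 2"
      using *[of x y] *[of y x] by (cases "y \<le> x") (simp_all add: abs_minus_commute)
  qed
qed

lemma fold_step:
  assumes C: "2 \<le> C * d powr \<alpha>" and d: "0 < d" "d \<le> 1 / 4" "2 ^ Suc r * d \<le> neg_gap r" and e: "0 \<le> e"
    and small: "\<And>x. x \<in> {1 - a..1} \<Longrightarrow> \<bar>x\<bar> < d \<Longrightarrow>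
      \<bar>F ((tent a ^^ Suc r) x) - F (turning_orbit a (Suc r))\<bar> / 2 ^ r \<le> C / lam\<^sup>2 * \<bar>x\<bar> powr \<alpha> + e"
  shows "fold_err C e"
  unfolding fold_err_def
proof
  fix x assume x: "x \<in> {1 - a..1}"
  show "\<bar>F x - F 0\<bar> \<le> C / lam\<^sup>2 * \<bar>x\<bar> powr \<alpha> + e"
  proof (cases "\<bar>x\<bar> < d")
    case True
    have "2 ^ Suc r * \<bar>x\<bar> \<le> 2 ^ Suc r * d" using True by (intro mult_left_mono) auto
    then show ?thesis using turning_block[of x] small[OF x True] d True by linarith
  next
    case False
    have C0: "0 \<le> C" using C d by (smt (verit) mult_nonneg_nonneg powr_ge_zero mult_neg_pos powr_gt_zero)
    have "(0::real) \<in> {1 - a..1}" using a_gt by simp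
    from F_bounds[OF x] F_bounds[OF this] have "\<bar>F x - F 0\<bar> \<le> 1" by linarith
    \<comment> \<open>The 2 in the requirement on C compensates for the division by
      \<open>lam\<^sup>2\<close>, which is at most 2 because \<open>r \<ge> 2\<close>.\<close>
    also have "1 \<le> 2 / lam\<^sup>2" using lam_sq lam_gt_1 by simp
    also have "2 / lam\<^sup>2 \<le> C * d powr \<alpha> / lam\<^sup>2" using C by (intro divide_right_mono) auto
    also have "\<dots> = C / lam\<^sup>2 * d powr \<alpha>" by simp
    also have "\<dots> \<le> C / lam\<^sup>2 * \<bar>x\<bar> powr \<alpha>"
      using False d C0 alpha_pos by (intro mult_left_mono powr_mono2) auto
    finally show ?thesis using e by simp
  qed
qed

lemma fold_base:
  assumes C: "2 \<le> C * d powr \<alpha>" and d: "0 < d" "d \<le> 1 / 4" "2 ^ Suc r * d \<le> neg_gap r"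
  shows "fold_err C (1 / 4)"
proof (rule fold_step[OF C d])
  fix x assume x: "x \<in> {1 - a..1}" "\<bar>x\<bar> < d"
  have C0: "0 \<le> C" using C d by (smt (verit) mult_nonneg_nonneg powr_ge_zero mult_neg_pos powr_gt_zero)
  have "\<bar>F ((tent a ^^ Suc r) x) - F (turning_orbit a (Suc r))\<bar> \<le> 1"
    using F_bounds[OF funpow_tent_mem[OF x(1), of "Suc r"]] F_bounds[OF c_mem[of "Suc r"]] by linarith
  then have "\<bar>F ((tent a ^^ Suc r) x) - F (turning_orbit a (Suc r))\<bar> / 2 ^ r \<le> 1 / 2 ^ 2"
    using power_increasing[OF r2, of "2::real"] by (intro frac_le) auto
  also have "\<dots> \<le> C / lam\<^sup>2 * \<bar>x\<bar> powr \<alpha> + 1 / 4" using C0 by simp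
  finally show "\<bar>F ((tent a ^^ Suc r) x) - F (turning_orbit a (Suc r))\<bar> / 2 ^ r \<le> C / lam\<^sup>2 * \<bar>x\<bar> powr \<alpha> + 1 / 4" .
qed simp

text \<open>The two errors are improved alternately and keep the ratio 4 to 1. This is preserved
  because the first fold estimate already has error 1/4, from r halvings with
  \<open>r \<ge> 2\<close>.\<close>

lemma cdf_holder_of_fold:
  assumes C: "2 \<le> C * d powr \<alpha>" and d: "0 < d" "d \<le> 1 / 4" "2 ^ Suc r * d \<le> neg_gap r"
    and step: "\<And>e. 0 \<le> e \<Longrightarrow> holder_err C e \<Longrightarrow> fold_err C (e / 4) \<Longrightarrow> fold_err C (e / 8)"
    and xy: "x \<in> {1 - a..1}" "y \<in> {1 - a..1}"
  shows "\<bar>F x - F y\<bar> \<le> C * \<bar>x - y\<bar> powr \<alpha>"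
proof -
  have C0: "0 \<le> C" using C d by (smt (verit) mult_nonneg_nonneg powr_ge_zero mult_neg_pos powr_gt_zero)
  have "holder_err C (1 / 2 ^ N) \<and> fold_err C (1 / 2 ^ N / 4)" for N
  proof (induction N)
    case 0
    have "holder_err C 1"
      unfolding holder_err_def
    proof (intro ballI)
      fix x y assume I: "x \<in> {1 - a..1}" "y \<in> {1 - a..1}"
      have "\<bar>F x - F y\<bar> \<le> 1" using F_bounds[OF I(1)] F_bounds[OF I(2)] by linarith
      then show "\<bar>F x - F y\<bar> \<le> C * \<bar>x - y\<bar> powr \<alpha> + 1" using C0 by (smt (verit) mult_nonneg_nonneg powr_ge_zero)
    qed
    then show ?case using fold_base[OF C d] by simp
  next
    case (Suc N)
    let ?e = "1 / 2 ^ N :: real"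
    have f: "fold_err C (?e / 8)" using step[of ?e] Suc by simp
    have "holder_err C (?e / 2)" by (rule general_step[OF _ f _ d C]) (use Suc in auto)
    then show ?case using f by (simp add: field_simps)
  qed
  then have "\<bar>F x - F y\<bar> \<le> C * \<bar>x - y\<bar> powr \<alpha> + 1 / 2 ^ N" for N
    using xy by (auto simp: holder_err_def)
  moreover have "(\<lambda>N. C * \<bar>x - y\<bar> powr \<alpha> + (1 / 2) ^ N) \<longlonglongrightarrow> C * \<bar>x - y\<bar> powr \<alpha> + 0"
    by (intro tendsto_intros LIMSEQ_realpow_zero) auto
  ultimately show ?thesis by (intro LIMSEQ_le_const[of _ _ "\<bar>F x - F y\<bar>"]) (auto simp: power_one_over)
qed

text \<open>After the r + 1 steps from the turning point, with surplus \<open>lam\<close>, the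
  margin \<open>far\<close> keeps the pair in the middle region. There it is either halved once more
  or cut at 0, and each alternative gives the second factor \<open>lam\<close>.\<close>

lemma cdf_holder_far:
  assumes C: "2 \<le> C * d powr \<alpha>" and d: "0 < d" "d \<le> 1 / 4" "2 ^ Suc r * d \<le> neg_gap r"
    and far: "turning_orbit a (Suc r) + 2 ^ Suc r * d \<le> a - 1"
    and xy: "x \<in> {1 - a..1}" "y \<in> {1 - a..1}"
  shows "\<bar>F x - F y\<bar> \<le> C * \<bar>x - y\<bar> powr \<alpha>"
proof (rule cdf_holder_of_fold[OF C d _ xy])
  have C0: "0 \<le> C" using C d by (smt (verit) mult_nonneg_nonneg powr_ge_zero mult_neg_pos powr_gt_zero)
  fix e :: real assume e: "0 \<le> e" and h: "holder_err C e" and f: "fold_err C (e / 4)"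
  have zI: "(0::real) \<in> {1 - a..1}" using a_gt by simp
  show "fold_err C (e / 8)"
  proof (rule fold_step[OF C d])
    fix x assume x: "x \<in> {1 - a..1}" "\<bar>x\<bar> < d"
    let ?X = "(tent a ^^ Suc r) x" and ?c = "turning_orbit a (Suc r)"
    have c0: "?c = (tent a ^^ Suc r) 0" by (simp add: turning_orbit_def)
    have "\<bar>?X - ?c\<bar> \<le> 2 ^ Suc r * \<bar>x\<bar>"
      using funpow_tent_lipschitz2[of "Suc r" x 0] by (simp only: c0 diff_0_right)
    also have "\<dots> \<le> 2 ^ Suc r * d" using x by (intro mult_left_mono) auto
    finally have "?X \<le> a - 1" using far by linarith
    moreover have "?X \<in> {1 - a..1}" by (rule funpow_tent_mem[OF x(1)])
    ultimately have mid: "?X \<in> {1 - a..a - 1}" "?c \<in> {1 - a..a - 1}"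
      using c_mem[of "Suc r"] c_Suc_r by auto
    have q: "1 / 2 ^ r * (2 * (e / 4)) \<le> e / 8"
    proof -
      have "1 / 2 ^ r * (2 * (e / 4)) \<le> 1 / 2 ^ 2 * (2 * (e / 4))"
        using e power_increasing[OF r2, of "2::real"] by (intro mult_right_mono divide_left_mono) auto
      then show ?thesis by simp
    qed
    show "\<bar>F ?X - F ?c\<bar> / 2 ^ r \<le> C / lam\<^sup>2 * \<bar>x\<bar> powr \<alpha> + e / 8"
    proof (cases "0 \<le> ?X * ?c")
      case True
      have "\<bar>F ?X - F ?c\<bar> / 2 ^ r \<le> \<bar>F ((tent a ^^ (r + 2)) x) - F ((tent a ^^ (r + 2)) 0)\<bar> * (1 / 2 ^ (r + 1))"
      proof -
        have fr: "(tent a ^^ (r + 2)) z = tent a ((tent a ^^ Suc r) z)" for z by simp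
        show ?thesis unfolding fr mid_step[OF mid True] c0[symmetric] by simp
      qed
      then have "\<bar>F ?X - F ?c\<bar> / 2 ^ r \<le> 1 / lam\<^sup>2 * C * \<bar>x - 0\<bar> powr \<alpha> + 1 / 2 ^ (r + 1) * e"
        by (rule scaled_step[OF h C0 x(1) zI]) (use rho_bounds(4) lam_gt_1 in \<open>auto simp: field_simps\<close>)
      also have "1 / 2 ^ (r + 1) * e \<le> e / 8"
        using q by (simp add: field_simps)
      finally show ?thesis by simp
    next
      case False
      have "\<bar>F ?X - F ?c\<bar> / 2 ^ r \<le> \<bar>F ?X - F ((tent a ^^ Suc r) 0)\<bar> * (1 / 2 ^ r)" by (simp add: c0)
      then have "\<bar>F ?X - F ?c\<bar> / 2 ^ r \<le> 1 / lam\<^sup>2 * C * \<bar>x - 0\<bar> powr \<alpha> + 1 / 2 ^ r * (2 * (e / 4))"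
        by (rule split_step[OF f C0 x(1) zI])
          (use False rho_bounds(5) lam_gt_1 in \<open>auto simp: c0 field_simps power2_eq_square\<close>)
      then show ?thesis using q by simp
    qed
  qed (use e in simp)
qed

text \<open>Close to \<open>special_param r\<close> the interval may straddle \<open>a - 1\<close>, but then it stays away from the
  turning point for many steps, each of which gains \<open>kap\<close>.\<close>

lemma zero_free_chain:
  assumes I: "u \<in> {1 - a..1}" "v \<in> {1 - a..1}"
    and same: "\<And>j. j \<le> n + r \<Longrightarrow> 0 \<le> (tent a ^^ j) u * (tent a ^^ j) v"
    and close: "\<And>j. j \<le> n + r \<Longrightarrow> 2 ^ Suc r * \<bar>(tent a ^^ j) u - (tent a ^^ j) v\<bar> \<le> neg_gap r"
  shows "\<exists>m. n \<le> m \<and> m \<le> n + r \<and> \<bar>F u - F v\<bar> \<le> \<bar>F ((tent a ^^ m) u) - F ((tent a ^^ m) v)\<bar> * (lam / 2) ^ m"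
  using same close
proof (induction n)
  case 0
  show ?case by (intro exI[of _ 0]) simp
next
  case (Suc n)
  from Suc obtain m where m: "n \<le> m" "m \<le> n + r"
    "\<bar>F u - F v\<bar> \<le> \<bar>F ((tent a ^^ m) u) - F ((tent a ^^ m) v)\<bar> * (lam / 2) ^ m" by auto
  show ?case
  \<comment> \<open>Only a time equal to n has to be advanced, by 1 in the middle region or by r
    through \<open>high_block\<close>. Hence the window from n to n + r.\<close>
  proof (cases "m = n")
    case False
    then show ?thesis using m by (intro exI[of _ m]) auto
  next
    case True
    let ?u = "(tent a ^^ n) u" and ?v = "(tent a ^^ n) v"
    have uv: "?u \<in> {1 - a..1}" "?v \<in> {1 - a..1}" using funpow_tent_mem I by blast+
    have s: "0 \<le> ?u * ?v" using Suc.prems(1)[of n] by simp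
    have lam2: "0 \<le> lam / 2" "1 / 2 \<le> lam / 2" using lam_gt_1 by auto
    have "\<exists>k. 1 \<le> k \<and> k \<le> r \<and> \<bar>F ?u - F ?v\<bar> \<le> \<bar>F ((tent a ^^ k) ?u) - F ((tent a ^^ k) ?v)\<bar> * (lam / 2) ^ k"
    proof (cases "?u \<le> a - 1 \<and> ?v \<le> a - 1")
      case True
      have "\<bar>F ?u - F ?v\<bar> = \<bar>F (tent a ?u) - F (tent a ?v)\<bar> / 2"
        using True uv s by (intro mid_step) auto
      also have "\<dots> \<le> \<bar>F (tent a ?u) - F (tent a ?v)\<bar> * (lam / 2)"
        using lam2(2) mult_left_mono[OF lam2(2), of "\<bar>F (tent a ?u) - F (tent a ?v)\<bar>"] by simp
      finally show ?thesis using r2 by (intro exI[of _ 1]) auto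
    next
      case False
      have high: "\<bar>F x - F y\<bar> \<le> \<bar>F ((tent a ^^ r) x) - F ((tent a ^^ r) y)\<bar> * (lam / 2) ^ r"
        if x: "a - 1 < x" "x \<in> {1 - a..1}" and y: "y \<in> {1 - a..1}" and xy: "0 \<le> x * y"
          "2 ^ Suc r * \<bar>x - y\<bar> \<le> neg_gap r" "0 \<le> (tent a ^^ (r - 1)) x * (tent a ^^ (r - 1)) y" for x y
      proof -
        have "0 \<le> y" using x xy(1) a_gt by (auto simp: zero_le_mult_iff)
        then have *: "\<bar>F x - F y\<bar> \<le> \<bar>F (tent a ((tent a ^^ (r - 1)) x)) - F (tent a ((tent a ^^ (r - 1)) y))\<bar> / 2 ^ (r - 1)"
          using high_block(2)[of x y] x y xy by auto
        have fr: "tent a ((tent a ^^ (r - 1)) z) = (tent a ^^ r) z" for z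
        proof -
          have "Suc (r - 1) = r" using r2 by simp
          then show ?thesis by (metis funpow.simps(2) o_apply)
        qed
        have p: "2 ^ (r - 1) = 1 / (lam / 2) ^ r"
          using lam_power r2 by (cases r) (auto simp: power_divide)
        show ?thesis using * unfolding fr p by simp
      qed
      have shift: "(tent a ^^ (r - 1)) ((tent a ^^ n) z) = (tent a ^^ (r - 1 + n)) z" for z
        by (simp add: funpow_add)
      have s2: "0 \<le> (tent a ^^ (r - 1)) ?u * (tent a ^^ (r - 1)) ?v"
        unfolding shift using Suc.prems(1)[of "r - 1 + n"] r2 by simp
      have cl: "2 ^ Suc r * \<bar>?u - ?v\<bar> \<le> neg_gap r" using Suc.prems(2)[of n] by simp
      show ?thesis
      proof (intro exI[of _ r] conjI)
        show "\<bar>F ?u - F ?v\<bar> \<le> \<bar>F ((tent a ^^ r) ?u) - F ((tent a ^^ r) ?v)\<bar> * (lam / 2) ^ r"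
          using False high[of ?u ?v] high[of ?v ?u] uv s s2 cl
          by (cases "a - 1 < ?u") (auto simp: abs_minus_commute mult.commute)
      qed (use r2 in auto)
    qed
    then obtain k where k: "1 \<le> k" "k \<le> r" 
      "\<bar>F ?u - F ?v\<bar> \<le> \<bar>F ((tent a ^^ k) ?u) - F ((tent a ^^ k) ?v)\<bar> * (lam / 2) ^ k" by auto
    have "\<bar>F u - F v\<bar> \<le> \<bar>F ?u - F ?v\<bar> * (lam / 2) ^ n" using m(3) True by simp
    also have "\<dots> \<le> (\<bar>F ((tent a ^^ k) ?u) - F ((tent a ^^ k) ?v)\<bar> * (lam / 2) ^ k) * (lam / 2) ^ n"
      using k(3) lam2 by (intro mult_right_mono) auto
    also have "\<dots> = \<bar>F ((tent a ^^ (k + n)) u) - F ((tent a ^^ (k + n)) v)\<bar> * (lam / 2) ^ (k + n)"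
      by (simp add: funpow_add power_add)
    finally show ?thesis using k by (intro exI[of _ "k + n"]) auto
  qed
qed

text \<open>The r + 1 steps from the turning point leave the surplus \<open>lam\<close>, and the
  chain that follows is merely balanced for the rate \<open>2 / lam\<close>. Since the actual rate
  is smaller by \<open>kap\<close>, at least n further steps gain
  \<open>kap ^ n \<le> 1 / lam\<close>, the second factor. The hypothesis \<open>near\<close>
  excludes cuts at 0 up to time M.\<close>

lemma cdf_holder_near:
  assumes C: "2 \<le> C * d powr \<alpha>" and d: "0 < d" "d \<le> 1 / 4"
    and kap: "a powr \<alpha> \<le> kap * (2 / lam)" "kap \<le> 1" "kap ^ n \<le> 1 / lam"
    and M: "M = Suc r + (n + r)" "2 \<le> n" "2 ^ Suc r * (2 ^ M * d) \<le> neg_gap r"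
    and near: "\<And>j. 2 \<le> j \<Longrightarrow> j \<le> M \<Longrightarrow> 2 ^ M * d \<le> \<bar>turning_orbit a j\<bar>"
    and xy: "x \<in> {1 - a..1}" "y \<in> {1 - a..1}"
  shows "\<bar>F x - F y\<bar> \<le> C * \<bar>x - y\<bar> powr \<alpha>"
proof -
  have C0: "0 \<le> C" using C d by (smt (verit) mult_nonneg_nonneg powr_ge_zero mult_neg_pos powr_gt_zero)
  have "d \<le> 2 ^ M * d" using d(1) by simp
  then have "2 ^ Suc r * d \<le> 2 ^ Suc r * (2 ^ M * d)" by (rule mult_left_mono) simp
  from order_trans[OF this M(3)] have d3: "2 ^ Suc r * d \<le> neg_gap r" .
  show ?thesis
  proof (rule cdf_holder_of_fold[OF C d d3 _ xy])
    fix e :: real assume e: "0 \<le> e" and h: "holder_err C e"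
    have zI: "(0::real) \<in> {1 - a..1}" using a_gt by simp
    show "fold_err C (e / 8)"
    proof (rule fold_step[OF C d d3])
      fix x assume x: "x \<in> {1 - a..1}" "\<bar>x\<bar> < d"
      let ?X = "(tent a ^^ Suc r) x" and ?c = "turning_orbit a (Suc r)"
      have c0: "turning_orbit a k = (tent a ^^ k) 0" for k by (simp add: turning_orbit_def)
      have XI: "?X \<in> {1 - a..1}" by (rule funpow_tent_mem[OF x(1)])
      have shiftX: "(tent a ^^ j) ?X = (tent a ^^ (Suc r + j)) x" for j
        unfolding add.commute[of "Suc r" j] by (simp only: funpow_add o_apply)
      have shiftc: "(tent a ^^ j) ?c = turning_orbit a (Suc r + j)" for j by (rule c_funpow[symmetric])
      have dist: "\<bar>(tent a ^^ (Suc r + j)) x - turning_orbit a (Suc r + j)\<bar> \<le> 2 ^ M * d" if "j \<le> n + r" for j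
      proof -
        have "\<bar>(tent a ^^ (Suc r + j)) x - turning_orbit a (Suc r + j)\<bar> \<le> 2 ^ (Suc r + j) * \<bar>x\<bar>"
          using funpow_tent_lipschitz2[of "Suc r + j" x 0] by (simp only: c0 diff_0_right)
        also have "\<dots> \<le> 2 ^ M * d" using that x M(1) by (intro mult_mono power_increasing) auto
        finally show ?thesis .
      qed
      have same: "0 \<le> (tent a ^^ j) ?X * (tent a ^^ j) ?c" if "j \<le> n + r" for j
      proof -
        have "2 ^ M * d \<le> \<bar>turning_orbit a (Suc r + j)\<bar>" using that r2 M(1) by (intro near) auto
        then show ?thesis using dist[OF that] unfolding shiftX shiftc by (auto simp: zero_le_mult_iff)
      qed
      have "2 ^ Suc r * \<bar>(tent a ^^ j) ?X - (tent a ^^ j) ?c\<bar> \<le> neg_gap r" if "j \<le> n + r" for j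
        using dist[OF that] unfolding shiftX shiftc by (intro order_trans[OF mult_left_mono M(3)]) auto
      from zero_free_chain[OF XI c_mem same this] obtain m where m: "n \<le> m" "m \<le> n + r"
        "\<bar>F ?X - F ?c\<bar> \<le> \<bar>F ((tent a ^^ m) ?X) - F ((tent a ^^ m) ?c)\<bar> * (lam / 2) ^ m" by auto
      let ?q = "(lam / 2) ^ m / 2 ^ r"
      have "\<bar>F ?X - F ?c\<bar> / 2 ^ r \<le> \<bar>F ((tent a ^^ m) ?X) - F ((tent a ^^ m) ?c)\<bar> * (lam / 2) ^ m / 2 ^ r"
        by (rule divide_right_mono[OF m(3)]) simp
      then have "\<bar>F ?X - F ?c\<bar> / 2 ^ r \<le> \<bar>F ((tent a ^^ (Suc r + m)) x) - F ((tent a ^^ (Suc r + m)) 0)\<bar> * ?q"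
        by (simp only: shiftX shiftc c0[of "Suc r + m"] times_divide_eq_right)
      then have "\<bar>F ?X - F ?c\<bar> / 2 ^ r \<le> 1 / lam\<^sup>2 * C * \<bar>x - 0\<bar> powr \<alpha> + ?q * e"
      proof (rule scaled_step[OF h C0 x(1) zI])
        show "0 \<le> ?q" using lam_gt_1 by simp
        have kap0: "0 \<le> kap"
        proof (rule ccontr)
          assume "\<not> 0 \<le> kap"
          then have "kap * (2 / lam) < 0" using lam_gt_1 by (intro mult_neg_pos) auto
          then show False using kap(1) by (smt (verit) powr_ge_zero)
        qed
        have "rho ^ (Suc r + m) \<le> (kap * (2 / lam)) ^ (Suc r + m)"
          using kap(1) rho_pos by (intro power_mono) (auto simp: rho_def)
        also have "\<dots> = kap ^ (Suc r + m) * (2 / lam) ^ (Suc r + m)" by (rule power_mult_distrib)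
        also have "\<dots> \<le> kap ^ n * (2 / lam) ^ (Suc r + m)"
          using kap0 kap(2) m(1) lam_gt_1 by (intro mult_right_mono power_decreasing) auto
        also have "\<dots> \<le> 1 / lam * (2 / lam) ^ (Suc r + m)"
          using kap(3) lam_gt_1 by (intro mult_right_mono) auto
        finally have "rho ^ (Suc r + m) * ?q \<le> 1 / lam * (2 / lam) ^ (Suc r + m) * ?q"
          using lam_gt_1 by (intro mult_right_mono) auto
        also have "\<dots> = 1 / lam\<^sup>2"
          using lam_gt_1 lam_power by (simp add: power_add power_divide field_simps power2_eq_square)
        finally show "rho ^ (Suc r + m) * ?q \<le> 1 / lam\<^sup>2" .
      qed
      also have "?q * e \<le> 1 / 8 * e"
      proof (rule mult_right_mono[OF _ e])
        have "lam \<le> 2" using lam_sq lam_gt_1 by (smt (verit) power2_eq_square mult_le_cancel_left1)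
        then have "(lam / 2) ^ m \<le> (lam / 2) ^ 2"
          using lam_gt_1 m(1) M(2) by (intro power_decreasing) auto
        also have "\<dots> \<le> 1 / 2" using lam_sq by (simp add: power_divide)
        finally have "?q \<le> 1 / 2 / 2 ^ 2"
          using power_increasing[OF r2, of "2::real"] lam_gt_1 by (intro frac_le) auto
        then show "?q \<le> 1 / 8" by simp
      qed
      finally show "\<bar>F ?X - F ?c\<bar> / 2 ^ r \<le> C / lam\<^sup>2 * \<bar>x\<bar> powr \<alpha> + e / 8" by simp
    qed (use e in simp)
  qed
qed

end

section \<open>Uniform constants and Hoelder continuity of the entropy\<close>

lemma holder_exponent_powr:
  assumes "2 \<le> r" "1 < b"
  shows "b powr holder_exponent r b = 2 / 2 powr (1 / real r)"
proof -
  have "holder_exponent r b * ln b = (1 - 1 / real r) * ln 2"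
    using assms by (simp add: holder_exponent_def field_simps)
  then have "b powr holder_exponent r b = 2 powr (1 - 1 / real r)"
    using assms by (simp add: powr_def)
  then show ?thesis by (simp add: powr_diff)
qed

lemma holder_exponent_ge:
  assumes "2 \<le> r" "1 < b" "b \<le> 2"
  shows "1 - 1 / real r \<le> holder_exponent r b"
proof -
  have ln: "0 < ln b" "ln b \<le> ln 2" using assms by auto
  have "(real r - 1) / real r = (real r - 1) * ln b / (real r * ln b)" using ln by simp
  also have "\<dots> \<le> (real r - 1) * ln 2 / (real r * ln b)"
    using ln assms by (intro divide_right_mono mult_left_mono) auto
  finally show ?thesis using assms by (simp add: holder_exponent_def diff_divide_distrib)
qed

lemma holder_exponent_pos: "2 \<le> r \<Longrightarrow> 1 < b \<Longrightarrow> 0 < holder_exponent r b"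
  by (simp add: holder_exponent_def)

lemma turning_orbit_mem: "tent_param a \<Longrightarrow> turning_orbit a n \<in> {1 - a..1}"
  unfolding turning_orbit_def by (rule tent_param.funpow_tent_mem) (auto dest: tent_param.a_gt)

lemma turning_orbit_lipschitz:
  assumes "tent_param a" "tent_param a'"
  shows "\<bar>turning_orbit a n - turning_orbit a' n\<bar> \<le> (2 ^ n - 1) * \<bar>a - a'\<bar>"
proof (induction n)
  case 0
  then show ?case by (simp add: turning_orbit_0_1_2)
next
  case (Suc n)
  let ?c = "turning_orbit a n" and ?c' = "turning_orbit a' n"
  have "\<bar>?c\<bar> \<le> 1" using turning_orbit_mem[OF assms(1), of n] tent_param.a_le[OF assms(1)] by auto
  then have "\<bar>tent a ?c - tent a' ?c\<bar> \<le> \<bar>a - a'\<bar>" by (rule tent_param_lipschitz)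
  moreover have "\<bar>tent a' ?c - tent a' ?c'\<bar> \<le> 2 * \<bar>?c - ?c'\<bar>" by (rule tent_param.tent_lipschitz[OF assms(2)])
  moreover have "2 * \<bar>?c - ?c'\<bar> \<le> 2 * ((2 ^ n - 1) * \<bar>a - a'\<bar>)" using Suc by (rule mult_left_mono) simp
  moreover have "\<bar>tent a ?c - tent a' ?c'\<bar> \<le> \<bar>tent a ?c - tent a' ?c\<bar> + \<bar>tent a' ?c - tent a' ?c'\<bar>" by simp
  ultimately have "\<bar>tent a ?c - tent a' ?c'\<bar> \<le> \<bar>a - a'\<bar> + 2 * ((2 ^ n - 1) * \<bar>a - a'\<bar>)"
    by (meson add_mono order_trans)
  then show ?case by (simp add: turning_orbit_Suc algebra_simps)
qed

text \<open>The turning orbit is preperiodic: the point of index r + 1 is minus the one of index 2,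
  so both have the same image and only the indices 2 to r + 1 matter.\<close>

lemma special_param_orbit_away:
  assumes r: "2 \<le> r" and j: "2 \<le> j"
  shows "min (neg_gap r) (special_param r - 1) \<le> \<bar>turning_orbit (special_param r) j\<bar>"
proof -
  let ?s = "special_param r" and ?c = "turning_orbit (special_param r)"
  have s: "special_param r < 2" "1 < special_param r" using special_param_bounds[OF r] sqrt2_bounds by auto
  have cr: "?c (Suc r) = ?s - 1"
    using above_special_param(3)[OF r order_refl, of "Suc r"] s r is_special_special_param[OF r]
    by (simp add: is_special_def)
  have "\<exists>i\<in>{2..Suc r}. ?c j = ?c i"
    using j
  proof (induction j rule: dec_induct)
    case base
    then show ?case using r by auto
  next
    case (step j)
    then obtain i where i: "i \<in> {2..Suc r}" "?c j = ?c i" by auto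
    show ?case
    proof (cases "i = Suc r")
      case True
      have "?c (Suc j) = tent ?s (?s - 1)" using i True cr by (simp add: turning_orbit_Suc)
      also have "\<dots> = tent ?s (?c 2)" by (simp add: turning_orbit_0_1_2 tent_def abs_minus_commute)
      also have "\<dots> = ?c 3" by (simp add: turning_orbit_Suc[symmetric])
      finally show ?thesis using r by (intro bexI[of _ 3]) auto
    next
      case False
      then show ?thesis using i by (intro bexI[of _ "Suc i"]) (auto simp: turning_orbit_Suc)
    qed
  qed
  then obtain i where i: "2 \<le> i" "i \<le> Suc r" "?c j = ?c i" by auto
  show ?thesis
  proof (cases "i = Suc r")
    case True
    then show ?thesis using i cr s by simp
  next
    case False
    then have "?c i \<le> - neg_gap r" using i s by (intro above_special_param(1)[OF r order_refl]) auto
    then show ?thesis using i by linarith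
  qed
qed

text \<open>All constants are chosen from r and b alone, which makes C uniform in a. Parameters
  within \<open>\<sigma>\<close> of \<open>special_param r\<close> are treated by
  \<open>cdf_holder_near\<close>, all others by \<open>cdf_holder_far\<close>.\<close>

lemma cdf_holder_uniform:
  assumes r: "2 \<le> r" and b: "special_param r < b" "b \<le> 2"
  obtains C where "0 \<le> C" "\<And>a F x y. special_param r \<le> a \<Longrightarrow> a \<le> b \<Longrightarrow> tent_cdf a F \<Longrightarrow>
    x \<in> {1 - a..1} \<Longrightarrow> y \<in> {1 - a..1} \<Longrightarrow> \<bar>F x - F y\<bar> \<le> C * \<bar>x - y\<bar> powr holder_exponent r b"
proof -
  define s where "s = special_param r"
  define \<alpha> where "\<alpha> = holder_exponent r b"
  define lam where "lam = 2 powr (1 / real r)"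
  have s: "sqrt 2 \<le> s" "s < 2" "1 < s" "s < b"
    using special_param_bounds[OF r] sqrt2_bounds b by (auto simp: s_def)
  have b1: "1 < b" using s by simp
  have \<alpha>: "1 - 1 / real r \<le> \<alpha>" "0 < \<alpha>" "b powr \<alpha> = 2 / lam"
    using holder_exponent_ge[OF r b1 b(2)] holder_exponent_pos[OF r b1] holder_exponent_powr[OF r b1]
    by (auto simp: \<alpha>_def lam_def)
  have lam: "1 < lam" unfolding lam_def using r by (simp add: gr_one_powr)
  \<comment> \<open>Any m strictly between s and b yields a rate \<open>kap < 1\<close> that holds
    for all parameters up to m.\<close>
  define m where "m = (s + b) / 2"
  have m: "s < m" "m < b" using s by (auto simp: m_def)
  define kap where "kap = m powr \<alpha> / b powr \<alpha>"
  have bpos: "0 < b powr \<alpha>" using b1 by simp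
  have kap: "0 < kap" "kap < 1"
    using m s bpos \<alpha>(2) powr_less_mono2[of \<alpha> m b] by (auto simp: kap_def)
  have "(\<lambda>n. kap ^ n) \<longlonglongrightarrow> 0" using kap by (intro LIMSEQ_realpow_zero) auto
  then have "\<forall>\<^sub>F n in sequentially. kap ^ n < 1 / lam" using lam by (intro order_tendstoD) auto
  then have "\<forall>\<^sub>F n in sequentially. kap ^ n < 1 / lam \<and> 2 \<le> n"
    using eventually_ge_at_top[of 2] by (rule eventually_conj)
  then obtain n where n: "kap ^ n < 1 / lam" "2 \<le> n" by (auto simp: eventually_sequentially)
  define M where "M = Suc r + (n + r)"
  define g where "g = min (neg_gap r) (s - 1)"
  have g: "0 < g" "g \<le> neg_gap r" using neg_gap_pos[OF r] s by (auto simp: g_def)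
  \<comment> \<open>So small that for parameters within \<open>\<sigma>\<close> of s the turning
    orbit up to time M moves by at most half its distance g from 0.\<close>
  define \<sigma> where "\<sigma> = min (m - s) (g / 2 / 2 ^ M)"
  have \<sigma>: "0 < \<sigma>" "\<sigma> \<le> m - s" "2 ^ M * \<sigma> \<le> g / 2" 
  proof -
    show "0 < \<sigma>" using m g by (simp add: \<sigma>_def)
    show "\<sigma> \<le> m - s" by (simp add: \<sigma>_def)
    have "\<sigma> \<le> g / 2 / 2 ^ M" by (simp add: \<sigma>_def)
    then have "2 ^ M * \<sigma> \<le> 2 ^ M * (g / 2 / 2 ^ M)" by (rule mult_left_mono) simp
    then show "2 ^ M * \<sigma> \<le> g / 2" by simp
  qed
  \<comment> \<open>The bound by \<open>\<sigma>\<close> provides the margin of the far case; the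
    last bound keeps pairs started within d below the other half of g, and below
    \<open>neg_gap\<close>, up to time M.\<close>
  define d where "d = min (1 / 4) (min (\<sigma> / 2 ^ Suc r) (g / 2 / 2 ^ (Suc r + M)))"
  have d: "0 < d" "d \<le> 1 / 4" "2 ^ Suc r * d \<le> \<sigma>" "2 ^ (Suc r + M) * d \<le> g / 2"
  proof -
    show "0 < d" using \<sigma> g by (simp add: d_def)
    show "d \<le> 1 / 4" by (simp add: d_def)
    have "d \<le> \<sigma> / 2 ^ Suc r" by (simp add: d_def)
    then have "2 ^ Suc r * d \<le> 2 ^ Suc r * (\<sigma> / 2 ^ Suc r)" by (rule mult_left_mono) simp
    then show "2 ^ Suc r * d \<le> \<sigma>" by simp
    have "d \<le> g / 2 / 2 ^ (Suc r + M)" by (simp add: d_def)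
    then have "2 ^ (Suc r + M) * d \<le> 2 ^ (Suc r + M) * (g / 2 / 2 ^ (Suc r + M))" by (rule mult_left_mono) simp
    then show "2 ^ (Suc r + M) * d \<le> g / 2" by simp
  qed
  have p1: "t \<le> 2 ^ k * t" if "0 \<le> t" for t :: real and k :: nat
    using mult_right_mono[OF one_le_power[of "2::real" k] that] by simp
  have dM: "2 ^ Suc r * (2 ^ M * d) \<le> g / 2" using d(4) by (simp add: power_add mult.assoc)
  have dM1: "2 ^ M * d \<le> g / 2" by (rule order_trans[OF p1 dM]) (use d(1) in simp)
  have "2 ^ Suc r * d \<le> 2 ^ Suc r * (2 ^ M * d)" using p1[of d M] d(1) by (intro mult_left_mono) auto
  then have dr: "2 ^ Suc r * d \<le> neg_gap r" using dM g by linarith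
  define C where "C = 2 / d powr \<alpha>"
  have C: "0 \<le> C" "2 \<le> C * d powr \<alpha>" using d by (auto simp: C_def)
  show thesis
  proof (rule that[OF C(1)])
    fix a F x y
    assume a: "special_param r \<le> a" "a \<le> b" and "tent_cdf a F"
      and xy: "x \<in> {1 - a..1}" "y \<in> {1 - a..1}"
    then interpret tent_cdf a F by simp
    have a1: "1 < a" using a s by (simp add: s_def)
    have "a powr \<alpha> \<le> b powr \<alpha>" using a a1 \<alpha>(2) by (intro powr_mono2) auto
    then interpret tent_holder a F r \<alpha> lam
      by unfold_locales (use r a \<alpha> in \<open>auto simp: lam_def\<close>)
    show "\<bar>F x - F y\<bar> \<le> C * \<bar>x - y\<bar> powr holder_exponent r b"
    proof (cases "a \<le> s + \<sigma>")
      case True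
      then have am: "a \<le> m" using \<sigma> by simp
      have "a powr \<alpha> \<le> m powr \<alpha>" using am a1 \<alpha>(2) by (intro powr_mono2) auto
      also have "\<dots> = kap * (2 / lam)" using bpos by (simp add: kap_def \<alpha>(3)[symmetric])
      finally have k: "a powr \<alpha> \<le> kap * (2 / lam)" .
      have near: "2 ^ M * d \<le> \<bar>turning_orbit a j\<bar>" if "2 \<le> j" "j \<le> M" for j
      proof -
        have "tent_param s" using s by unfold_locales auto
        then have "\<bar>turning_orbit a j - turning_orbit s j\<bar> \<le> (2 ^ j - 1) * \<bar>a - s\<bar>"
          by (rule turning_orbit_lipschitz[OF tent_param_axioms])
        also have "\<dots> \<le> 2 ^ M * \<sigma>"
        proof (rule mult_mono)
          have "(2::real) ^ j - 1 \<le> 2 ^ j" by simp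
          also have "\<dots> \<le> 2 ^ M" using that by (intro power_increasing) auto
          finally show "(2::real) ^ j - 1 \<le> 2 ^ M" .
        qed (use True a in \<open>auto simp: s_def\<close>)
        finally have "\<bar>turning_orbit a j - turning_orbit s j\<bar> \<le> g / 2" using \<sigma>(3) by simp
        moreover have "g \<le> \<bar>turning_orbit s j\<bar>"
          using special_param_orbit_away[OF r that(1)] by (simp add: g_def s_def)
        ultimately show ?thesis using dM1 by linarith
      qed
      have "2 ^ Suc r * (2 ^ M * d) \<le> neg_gap r" using dM g by linarith
      then show ?thesis
        using cdf_holder_near[OF C(2) d(1,2) k _ _ M_def n(2) _ near xy] n kap
        unfolding \<alpha>_def by simp
    next
      case False
      have "turning_orbit a (Suc r) \<le> s - 1"
        using above_special_param(2)[OF r a(1)] a b by (simp add: s_def)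
      then have far: "turning_orbit a (Suc r) + 2 ^ Suc r * d \<le> a - 1" using False d(3) by linarith
      show ?thesis using cdf_holder_far[OF C(2) d(1,2) dr far xy] unfolding \<alpha>_def .
    qed
  qed
qed

lemma obtain_tent_cdf:
  assumes "a \<in> {sqrt 2..2}"
  obtains F where "tent_cdf a F" "normalized_fair_entropy a = F 0"
proof -
  interpret tent_param a using assms by unfold_locales auto
  obtain F where "fair_cdf a F" using fair_cdf_exists by blast
  then have "tent_cdf a F" by unfold_locales
  then show thesis using that normalized_fair_entropy_cdf by blast
qed

theorem normalized_fair_entropy_holder:
  assumes r: "2 \<le> r" and b: "special_param r < b" "b \<le> 2"
  shows "holder_on (holder_exponent r b) {special_param r..b} normalized_fair_entropy"
proof -
  let ?\<alpha> = "holder_exponent r b" and ?H = normalized_fair_entropy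
  have "1 < sqrt (2::real)" by simp
  then have b1: "1 < b" using special_param_bounds[OF r] b by linarith
  obtain C where C: "0 \<le> C" "\<And>a F x y. special_param r \<le> a \<Longrightarrow> a \<le> b \<Longrightarrow> tent_cdf a F \<Longrightarrow>
    x \<in> {1 - a..1} \<Longrightarrow> y \<in> {1 - a..1} \<Longrightarrow> \<bar>F x - F y\<bar> \<le> C * \<bar>x - y\<bar> powr ?\<alpha>"
    using cdf_holder_uniform[OF assms] by blast
  have *: "\<bar>?H q - ?H p\<bar> \<le> 15 / 4 * C * 2 powr ?\<alpha> * \<bar>q - p\<bar> powr ?\<alpha>"
    if pq: "special_param r \<le> p" "p \<le> q" "q \<le> b" for p q
  proof -
    have "p \<in> {sqrt 2..2}" "q \<in> {sqrt 2..2}" using pq b special_param_bounds[OF r] by auto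
    then obtain F G where F: "tent_cdf p F" "?H p = F 0" and G: "tent_cdf q G" "?H q = G 0"
      using obtain_tent_cdf by metis
    have "tent_cdf_pair p q F G (C * (2 * (q - p)) powr ?\<alpha>)"
    proof (intro tent_cdf_pair.intro tent_cdf_pair_axioms.intro F(1) G(1) pq(2))
      fix u v assume uv: "u \<in> {1 - q..1}" "v \<in> {1 - q..1}" "\<bar>u - v\<bar> \<le> 2 * (q - p)"
      have "\<bar>G u - G v\<bar> \<le> C * \<bar>u - v\<bar> powr ?\<alpha>" using C(2)[OF _ _ G(1) uv(1,2)] pq by simp
      also have "\<dots> \<le> C * (2 * (q - p)) powr ?\<alpha>"
        using C(1) uv(3) holder_exponent_pos[OF r b1] by (intro mult_left_mono powr_mono2) auto
      finally show "\<bar>G u - G v\<bar> \<le> C * (2 * (q - p)) powr ?\<alpha>" .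
    qed
    then have "\<bar>G 0 - F 0\<bar> \<le> 15 / 4 * (C * (2 * (q - p)) powr ?\<alpha>)" by (rule tent_cdf_pair.entropy_close)
    also have "(2 * (q - p)) powr ?\<alpha> = 2 powr ?\<alpha> * \<bar>q - p\<bar> powr ?\<alpha>" using pq by (subst powr_mult) auto
    finally show ?thesis by (simp add: F G mult.assoc)
  qed
  show ?thesis
    unfolding holder_on_def
  proof (intro conjI holder_exponent_pos[OF r b1] exI[of _ "15 / 4 * C * 2 powr ?\<alpha>"] ballI)
    fix x y assume "x \<in> {special_param r..b}" "y \<in> {special_param r..b}"
    then show "dist (?H x) (?H y) \<le> 15 / 4 * C * 2 powr ?\<alpha> * dist x y powr ?\<alpha>"
      using *[of x y] *[of y x] by (cases "x \<le> y") (auto simp: dist_real_def abs_minus_commute)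
  qed
qed

section \<open>Optimality of the exponents\<close>

text \<open>An interval on which F is constant has images of the same kind, and these would grow
  beyond the length of the whole interval. A fold at 0 may lose half of the length, but the image
  then ends at 1 and stays to the right of 0, so the next step expands without loss.\<close>

lemma (in tent_cdf) cdf_strict_mono:
  assumes a: "sqrt 2 < a" and xy: "1 - a \<le> x" "x < y" "y \<le> 1"
  shows "F x < F y"
proof (rule ccontr)
  define null where "null u v \<longleftrightarrow> 1 - a \<le> u \<and> u < v \<and> v \<le> 1 \<and> F u = F v" for u v
  assume "\<not> F x < F y"
  then have "null x y" using F_mono[of x y] xy by (auto simp: null_def)
  have sub: "F u' = F v'" if "null u v" "u \<le> u'" "u' \<le> v'" "v' \<le> v" for u v u' v'
  proof -
    have "F u \<le> F u'" "F u' \<le> F v'" "F v' \<le> F v"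
      using that F_mono[of u u'] F_mono[of u' v'] F_mono[of v' v] by (auto simp: null_def)
    then show ?thesis using that by (auto simp: null_def)
  qed
  have image_pos: "null (tent a v) (tent a u) \<and> tent a u - tent a v = a * (v - u)" if "null u v" "0 \<le> u" for u v
  proof -
    have uv: "1 - a \<le> u" "u < v" "v \<le> 1" using that by (auto simp: null_def)
    have "F (tent a u) = F (tent a v)"
    proof -
      consider "v \<le> a - 1" | "u \<le> a - 1" "a - 1 \<le> v" | "a - 1 \<le> u" by linarith
      then show ?thesis
      proof cases
        case 1 then show ?thesis using F_right[of u] F_right[of v] that uv by (simp add: null_def)
      next
        case 2
        have "F u = F (a - 1)" "F v = F (a - 1)" using sub[OF that(1), of u "a - 1"] sub[OF that(1), of "a - 1" v] 2 uv by auto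
        then show ?thesis using F_right[of u] F_high[of v] F_chat2 2 that uv by simp
      next
        case 3 then show ?thesis using F_high[of u] F_high[of v] that uv by (simp add: null_def)
      qed
    qed
    moreover have "a * u < a * v" using uv a_gt by simp
    moreover have "tent a u \<in> {1 - a..1}" "tent a v \<in> {1 - a..1}" using uv by (auto intro!: tent_mem[unfolded atLeastAtMost_iff])
    ultimately show ?thesis using uv that(2) by (simp add: null_def tent_def right_diff_distrib)
  qed
  have image_neg: "null (tent a u) (tent a v) \<and> tent a v - tent a u = a * (v - u)" if "null u v" "v \<le> 0" for u v
  proof -
    have uv: "1 - a \<le> u" "u < v" "v \<le> 1" using that by (auto simp: null_def)
    have "F (tent a u) = F (tent a v)" using F_left[of u] F_left[of v] that uv by (simp add: null_def)
    moreover have "a * u < a * v" using uv a_gt by simp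
    moreover have "tent a u \<in> {1 - a..1}" "tent a v \<in> {1 - a..1}" using uv by (auto intro!: tent_mem[unfolded atLeastAtMost_iff])
    ultimately show ?thesis using uv that(2) by (simp add: null_def tent_def right_diff_distrib)
  qed
  \<comment> \<open>Either one step without a fold, or two steps with one;
    \<open>a\<^sup>2 / 2 > 1\<close> is where \<open>a > sqrt 2\<close> is used.\<close>
  define g where "g = min a (a\<^sup>2 / 2)"
  have "(sqrt 2)\<^sup>2 < a\<^sup>2" using a by (intro power_strict_mono) auto
  then have g: "1 < g" using a_gt by (simp add: g_def)
  have grow: "\<exists>u' v'. null u' v' \<and> g * (v - u) \<le> v' - u'" if N: "null u v" for u v
  proof -
    have uv: "u < v" using N by (simp add: null_def)
    have ga: "g * (v - u) \<le> a * (v - u)" using uv by (intro mult_right_mono) (auto simp: g_def)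
    consider "0 \<le> u" | "v \<le> 0" | "u < 0" "0 < v" by linarith
    then show ?thesis
    proof cases
      case 1
      then have "null (tent a v) (tent a u) \<and> g * (v - u) \<le> tent a u - tent a v" using image_pos[OF N] ga by simp
      then show ?thesis by (intro exI)
    next
      case 2
      then have "null (tent a u) (tent a v) \<and> g * (v - u) \<le> tent a v - tent a u" using image_neg[OF N] ga by simp
      then show ?thesis by (intro exI)
    next
      case 3
      obtain w where w: "(v - u) / 2 \<le> w" "0 < w" "null (1 - a * w) 1"
      proof (cases "- u \<le> v")
        case True
        have "null 0 v" using sub[OF N, of 0 v] N 3 by (auto simp: null_def)
        then have "null (1 - a * v) 1" using image_pos[of 0 v] 3 by (simp add: tent_def)
        then show thesis using that[of v] True 3 by simp
      next
        case False
        have "null u 0" using sub[OF N, of u 0] N 3 by (auto simp: null_def)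
        then have "null (1 + a * u) 1" using image_neg[of u 0] 3 by (simp add: tent_def)
        then show thesis using that[of "- u"] False 3 by simp
      qed
      \<comment> \<open>Otherwise F would be constant on [0, 1], against
        \<open>F 0 \<le> 1 / 2\<close>.\<close>
      have "0 < 1 - a * w"
      proof (rule ccontr)
        assume "\<not> 0 < 1 - a * w"
        then have "F 0 = F 1" using sub[OF w(3), of 0 1] by simp
        then show False using H_bounds F_ends by simp
      qed
      then have "null (tent a 1) (tent a (1 - a * w)) \<and> tent a (1 - a * w) - tent a 1 = a * (1 - (1 - a * w))"
        using image_pos[OF w(3)] by simp
      moreover have "g * (v - u) \<le> a * (1 - (1 - a * w))"
      proof -
        have "g * (v - u) \<le> a\<^sup>2 / 2 * (v - u)" using uv by (intro mult_right_mono) (auto simp: g_def)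
        also have "\<dots> = a\<^sup>2 * ((v - u) / 2)" by simp
        also have "\<dots> \<le> a\<^sup>2 * w" using w(1) by (intro mult_left_mono) auto
        finally show ?thesis by (simp add: power2_eq_square)
      qed
      ultimately have "null (tent a 1) (tent a (1 - a * w)) \<and> g * (v - u) \<le> tent a (1 - a * w) - tent a 1"
        by simp
      then show ?thesis by (intro exI)
    qed
  qed
  have "\<exists>u v. null u v \<and> g ^ k * (y - x) \<le> v - u" for k
  proof (induction k)
    case 0 then show ?case using \<open>null x y\<close> by auto
  next
    case (Suc k)
    then obtain u v where uv: "null u v" "g ^ k * (y - x) \<le> v - u" by auto
    obtain u' v' where uv': "null u' v'" "g * (v - u) \<le> v' - u'" using grow[OF uv(1)] by auto
    have "g * (g ^ k * (y - x)) \<le> g * (v - u)" using uv(2) g by (intro mult_left_mono) auto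
    then have "g ^ Suc k * (y - x) \<le> v' - u'" using uv'(2) by (simp add: mult.assoc)
    then show ?case using uv'(1) by blast
  qed
  then have bound: "g ^ k * (y - x) \<le> a" for k by (smt (verit) null_def)
  obtain k where "a / (y - x) < g ^ k" using real_arch_pow[OF g] by blast
  then have "a < g ^ k * (y - x)" using xy by (simp add: field_simps)
  then show False using bound[of k] by simp
qed

section \<open>Transversality of the turning orbits\<close>

lemma turning_orbit_continuous: "continuous_on S (\<lambda>a. turning_orbit a n)"
proof (induction n)
  case 0 then show ?case by (simp add: turning_orbit_0_1_2)
next
  case (Suc n) then show ?case unfolding turning_orbit_Suc tent_def by (intro continuous_intros)
qed

text \<open>A discrete form of the recursion for the derivative in the parameter: the map expands
  the distance by at least p, and changing the map itself costs at most the distance of the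
  parameters.\<close>

lemma turning_orbit_expand:
  assumes "tent_param x" "tent_param y" "p \<le> x" "p \<le> y" "0 \<le> turning_orbit x n * turning_orbit y n"
  shows "p * \<bar>turning_orbit x n - turning_orbit y n\<bar> - \<bar>x - y\<bar> \<le> \<bar>turning_orbit x (Suc n) - turning_orbit y (Suc n)\<bar>"
proof -
  let ?c = "turning_orbit x n" and ?c' = "turning_orbit y n"
  have "\<bar>?c'\<bar> \<le> 1" using turning_orbit_mem[OF assms(2), of n] tent_param.a_le[OF assms(2)] by auto
  then have 1: "\<bar>x - y\<bar> * \<bar>?c'\<bar> \<le> \<bar>x - y\<bar>" by (simp add: mult_left_le)
  have 2: "\<bar>\<bar>?c\<bar> - \<bar>?c'\<bar>\<bar> = \<bar>?c - ?c'\<bar>" using assms(5) by (auto simp: zero_le_mult_iff)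
  have 3: "p * \<bar>?c - ?c'\<bar> \<le> x * \<bar>?c - ?c'\<bar>" using assms(3) by (intro mult_right_mono) auto
  have "turning_orbit x (Suc n) - turning_orbit y (Suc n) = - (x * (\<bar>?c\<bar> - \<bar>?c'\<bar>) + (x - y) * \<bar>?c'\<bar>)"
    by (simp add: turning_orbit_Suc tent_def algebra_simps)
  then have "\<bar>turning_orbit x (Suc n) - turning_orbit y (Suc n)\<bar> \<ge> \<bar>x * (\<bar>?c\<bar> - \<bar>?c'\<bar>)\<bar> - \<bar>(x - y) * \<bar>?c'\<bar>\<bar>"
    by linarith
  then have "\<bar>turning_orbit x (Suc n) - turning_orbit y (Suc n)\<bar> \<ge> x * \<bar>\<bar>?c\<bar> - \<bar>?c'\<bar>\<bar> - \<bar>x - y\<bar> * \<bar>?c'\<bar>"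
    using tent_param.a_gt[OF assms(1)] by (simp add: abs_mult)
  then show ?thesis unfolding 2 by (rule order_trans[OF diff_mono[OF 3 1]])
qed

text \<open>The recursion of \<open>turning_orbit_expand\<close> grows only from above its fixed
  point \<open>\<bar>x - y\<bar> / (p - 1)\<close>, which is at most 5/2 times the distance of the
  parameters. Explicit formulas show that index 5 is already above it, for either sign at index
  3.\<close>

lemma turning_orbit_base:
  assumes x: "tent_param x" and y: "tent_param y" and xy: "x < y"
    and same: "\<And>i. i < 5 \<Longrightarrow> 0 \<le> turning_orbit x i * turning_orbit y i"
  shows "13 / 5 * (y - x) \<le> \<bar>turning_orbit x 5 - turning_orbit y 5\<bar>"
proof -
  have b: "7 / 5 < x" "x \<le> 2" "7 / 5 < y" "y \<le> 2" "2 \<le> x\<^sup>2" "2 \<le> y\<^sup>2" "1.414 < x" "1.414 < y"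
    using tent_param.a_gt[OF x] tent_param.a_gt[OF y] tent_param.a_le[OF x] tent_param.a_le[OF y]
      tent_param.a_sq[OF x] tent_param.a_sq[OF y] by auto
  have c3: "turning_orbit a 3 = 1 - a * (a - 1)" if "1 < a" for a
    using that by (simp add: turning_orbit_def tent_def numeral_3_eq_3)
  have c4: "turning_orbit a 4 = 1 - a * \<bar>turning_orbit a 3\<bar>" for a
    using turning_orbit_Suc[of a 3] by (simp add: tent_def)
  have c5: "turning_orbit a 5 = 1 - a * \<bar>turning_orbit a 4\<bar>" for a
    using turning_orbit_Suc[of a 4] by (simp add: tent_def)
  have s3: "0 \<le> turning_orbit x 3 * turning_orbit y 3" using same[of 3] by simp
  have xy2: "2 \<le> x * y"
  proof -
    have "2 \<le> x * x" using b(5) by (simp only: power2_eq_square)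
    also have "x * x \<le> x * y" using xy b by (intro mult_left_mono) auto
    finally show ?thesis .
  qed
  show ?thesis
  proof (cases "0 \<le> turning_orbit x 3 \<and> 0 \<le> turning_orbit y 3")
    case True
    have e4: "turning_orbit a 4 = (a - 1)\<^sup>2 * (a + 1)" if "1 < a" "0 \<le> turning_orbit a 3" for a
      using that c4[of a] c3[of a] by (simp add: power2_eq_square algebra_simps)
    have x4: "turning_orbit x 4 = (x - 1)\<^sup>2 * (x + 1)" and y4: "turning_orbit y 4 = (y - 1)\<^sup>2 * (y + 1)"
      using e4 True b by auto
    have "turning_orbit y 4 - turning_orbit x 4 = (x\<^sup>2 + x * y + y\<^sup>2 - x - y - 1) * (y - x)"
      unfolding x4 y4 by (simp add: power2_eq_square algebra_simps)
    moreover have "2 \<le> x\<^sup>2 + x * y + y\<^sup>2 - x - y - 1"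
    proof -
      have "x * (x - 1) \<ge> 1.414 * 0.414" "y * (y - 1) \<ge> 1.414 * 0.414" using b by (intro mult_mono; simp)+
      then show ?thesis using xy2 by (simp add: power2_eq_square algebra_simps)
    qed
    ultimately have "2 * (y - x) \<le> turning_orbit y 4 - turning_orbit x 4" 
      using mult_right_mono[of 2 _ "y - x"] xy by simp
    moreover have x4p: "0 \<le> turning_orbit x 4" "0 \<le> turning_orbit y 4" unfolding x4 y4 using b by auto
    have "turning_orbit x 5 - turning_orbit y 5 = y * (turning_orbit y 4 - turning_orbit x 4) + (y - x) * turning_orbit x 4"
      unfolding c5 using x4p by (simp add: algebra_simps)
    moreover have "0 \<le> (y - x) * turning_orbit x 4" using xy x4p by simp
    moreover have "y * (turning_orbit y 4 - turning_orbit x 4) \<ge> 7 / 5 * (2 * (y - x))"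
      using calculation(1) b xy by (intro mult_mono) auto
    ultimately show ?thesis using xy by linarith
  next
    case False
    then have neg: "turning_orbit x 3 \<le> 0" "turning_orbit y 3 \<le> 0"
      using s3 by (auto simp: zero_le_mult_iff)
    have E3: "turning_orbit x 3 - turning_orbit y 3 = (y - x) * (x + y - 1)"
      using c3 b by (simp add: algebra_simps)
    have E4: "turning_orbit x 4 - turning_orbit y 4 = y * ((y - x) * (x + y - 1)) + (y - x) * (- turning_orbit x 3)"
      unfolding c4 E3[symmetric] using neg by (simp add: algebra_simps)
    have nn: "0 \<le> (y - x) * (- turning_orbit x 3)" using xy neg by (intro mult_nonneg_nonneg) auto
    \<comment> \<open>Both parameters exceed 1.414, and 1.828 is twice this minus 1.\<close>
    have "1.414 * ((y - x) * 1.828) \<le> y * ((y - x) * (x + y - 1))"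
      using b xy by (intro mult_mono mult_left_mono) auto
    moreover have "2.58 * (y - x) \<le> 1.414 * ((y - x) * 1.828)" using xy by simp
    ultimately have e: "2.58 * (y - x) \<le> \<bar>turning_orbit x 4 - turning_orbit y 4\<bar>"
      unfolding E4 using nn by (smt (verit))
    have "0 \<le> turning_orbit x 4 * turning_orbit y 4" using same[of 4] by simp
    then have "1.414 * \<bar>turning_orbit x 4 - turning_orbit y 4\<bar> - \<bar>x - y\<bar> \<le> \<bar>turning_orbit x (Suc 4) - turning_orbit y (Suc 4)\<bar>"
      using b by (intro turning_orbit_expand x y) auto
    then show ?thesis using e xy by simp
  qed
qed

text \<open>Measured from the fixed point \<open>?w\<close>, the recursion is plain multiplication
  by p. The initial surplus 1/10 is 13/5 - 5/2.\<close>

lemma turning_orbit_transversal: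
  assumes x: "tent_param x" and y: "tent_param y" and p: "sqrt 2 \<le> p" "p \<le> x" "p \<le> y"
    and n: "5 \<le> n" and same: "\<And>i. i < n \<Longrightarrow> 0 \<le> turning_orbit x i * turning_orbit y i"
  shows "1 / 10 * p ^ (n - 5) * \<bar>x - y\<bar> \<le> \<bar>turning_orbit x n - turning_orbit y n\<bar>"
proof -
  have p1: "1.414 < p" using p sqrt2_bounds by linarith
  let ?E = "\<lambda>n. \<bar>turning_orbit x n - turning_orbit y n\<bar>" and ?w = "\<bar>x - y\<bar> / (p - 1)"
  have "1 / 10 * p ^ (n - 5) * \<bar>x - y\<bar> \<le> ?E n - ?w"
    using n same
  proof (induction n rule: dec_induct)
    case base
    have "13 / 5 * \<bar>x - y\<bar> \<le> ?E 5"
    proof (cases "x < y")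
      case True
      then show ?thesis using turning_orbit_base[OF x y True] base by simp
    next
      case False
      show ?thesis
      proof (cases "x = y")
        case False
        then have "y < x" using \<open>\<not> x < y\<close> by simp
        then show ?thesis
          using turning_orbit_base[OF y x] base by (simp add: mult.commute abs_minus_commute)
      qed simp
    qed
    moreover have "?w \<le> 5 / 2 * \<bar>x - y\<bar>"
    proof -
      have "1 / (p - 1) \<le> 5 / 2" using p1 by (simp add: field_simps)
      then have "\<bar>x - y\<bar> * (1 / (p - 1)) \<le> \<bar>x - y\<bar> * (5 / 2)" by (intro mult_left_mono) auto
      then show ?thesis by simp
    qed
    ultimately show ?case by simp
  next
    case (step n)
    have "0 \<le> turning_orbit x n * turning_orbit y n" using step.prems[of n] by simp
    then have ex: "p * ?E n - \<bar>x - y\<bar> \<le> ?E (Suc n)" by (rule turning_orbit_expand[OF x y p(2,3)])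
    have "1 / 10 * p ^ (Suc n - 5) * \<bar>x - y\<bar> = p * (1 / 10 * p ^ (n - 5) * \<bar>x - y\<bar>)"
    proof -
      have "Suc n - 5 = Suc (n - 5)" using step by simp
      then show ?thesis by (simp only: power_Suc mult.assoc mult.left_commute)
    qed
    also have "\<dots> \<le> p * (?E n - ?w)" using step p1 by (intro mult_left_mono) auto
    also have "\<dots> = p * ?E n - \<bar>x - y\<bar> - ?w"
    proof -
      have "p * ?w = \<bar>x - y\<bar> + ?w" using p1 by (simp add: field_simps)
      then show ?thesis by (simp add: right_diff_distrib)
    qed
    also have "\<dots> \<le> ?E (Suc n) - ?w" using ex by simp
    finally show ?case .
  qed
  moreover have "0 \<le> ?w" using p1 by simp
  ultimately show ?thesis by linarith
qed

text \<open>The signs are weak so that an interval may be cut at a zero of the next orbit point and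
  remain coherent.\<close>

definition coherent :: "real \<Rightarrow> real \<Rightarrow> nat \<Rightarrow> bool" where
  "coherent s t n \<longleftrightarrow>
     (\<forall>i<n. (\<forall>a\<in>{s..t}. 0 \<le> turning_orbit a i) \<or> (\<forall>a\<in>{s..t}. turning_orbit a i \<le> 0))"

lemma coherent_subset: "coherent s t n \<Longrightarrow> s \<le> s' \<Longrightarrow> t' \<le> t \<Longrightarrow> coherent s' t' n"
  unfolding coherent_def by (meson atLeastAtMost_iff order_trans)

lemma coherent_Suc:
  "coherent s t (Suc n) \<longleftrightarrow> coherent s t n \<and>
     ((\<forall>a\<in>{s..t}. 0 \<le> turning_orbit a n) \<or> (\<forall>a\<in>{s..t}. turning_orbit a n \<le> 0))"
  by (auto simp: coherent_def less_Suc_eq)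

lemma coherent_same_sign:
  "coherent s t n \<Longrightarrow> x \<in> {s..t} \<Longrightarrow> y \<in> {s..t} \<Longrightarrow> i < n \<Longrightarrow> 0 \<le> turning_orbit x i * turning_orbit y i"
  unfolding coherent_def by (metis mult_nonneg_nonneg mult_nonpos_nonpos)

section \<open>Parameters whose turning orbit meets a moving target\<close>

locale param_interval =
  fixes p q :: real
  assumes p: "sqrt 2 < p" and pq: "p < q" and q: "q \<le> 2"
begin

lemma param: "x \<in> {p..q} \<Longrightarrow> tent_param x"
  using p q by unfold_locales auto

lemma coherent_transversal:
  assumes "coherent s t n" "5 \<le> n" "p \<le> s" "t \<le> q" "x \<in> {s..t}" "y \<in> {s..t}"
  shows "1 / 10 * p ^ (n - 5) * \<bar>x - y\<bar> \<le> \<bar>turning_orbit x n - turning_orbit y n\<bar>"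
  using assms p by (intro turning_orbit_transversal param coherent_same_sign[OF assms(1,5,6)]) auto

lemma coherent_inj:
  assumes "coherent s t n" "5 \<le> n" "p \<le> s" "t \<le> q"
  shows "inj_on (\<lambda>a. turning_orbit a n) {s..t}"
proof (rule inj_onI)
  fix x y assume xy: "x \<in> {s..t}" "y \<in> {s..t}" "turning_orbit x n = turning_orbit y n"
  then have "1 / 10 * p ^ (n - 5) * \<bar>x - y\<bar> \<le> 0" using coherent_transversal[OF assms xy(1,2)] by simp
  moreover have "0 < p" using p sqrt2_bounds by linarith
  ultimately show "x = y" by (simp add: mult_le_0_iff power_le_zero_eq)
qed

text \<open>By transversality the orbit point is injective in the parameter, and as a continuous
  function it is then monotone. Signs on a coherent interval can thus be read off at its end
  points.\<close>

lemma coherent_monotone: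
  assumes "coherent s t n" "5 \<le> n" "p \<le> s" "t \<le> q" "x \<in> {s..t}"
  shows "turning_orbit x n \<in> {min (turning_orbit s n) (turning_orbit t n)..max (turning_orbit s n) (turning_orbit t n)}"
proof -
  consider "x = s" | "x = t" | "s < x" "x < t" using assms(5) by force
  then show ?thesis
  proof cases
    case 3
    from continuous_inj_imp_mono[OF this turning_orbit_continuous coherent_inj[OF assms(1-4)]]
    show ?thesis by auto
  qed auto
qed

lemma coherent_SucI:
  assumes "coherent s t n" "5 \<le> n" "p \<le> s" "t \<le> q" "0 \<le> turning_orbit s n * turning_orbit t n"
  shows "coherent s t (Suc n)"
proof -
  have "(0 \<le> turning_orbit s n \<and> 0 \<le> turning_orbit t n) \<or> (turning_orbit s n \<le> 0 \<and> turning_orbit t n \<le> 0)"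
    using assms(5) by (auto simp: zero_le_mult_iff)
  moreover have "turning_orbit x n \<in> {min (turning_orbit s n) (turning_orbit t n)..max (turning_orbit s n) (turning_orbit t n)}"
    if "x \<in> {s..t}" for x using coherent_monotone[OF assms(1-4) that] .
  ultimately show ?thesis unfolding coherent_Suc using assms(1) by fastforce
qed

text \<open>If the image is M times as long as the parameter interval, the cost of changing the map
  is a share \<open>1 / M\<close> of the image, and the expansion is nearly p.\<close>

lemma coherent_expand:
  assumes "coherent s t (Suc n)" "p \<le> s" "s \<le> t" "t \<le> q" "M * (t - s) \<le> \<bar>turning_orbit s n - turning_orbit t n\<bar>" "0 < M"
  shows "(p - 1 / M) * \<bar>turning_orbit s n - turning_orbit t n\<bar> \<le> \<bar>turning_orbit s (Suc n) - turning_orbit t (Suc n)\<bar>"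
proof -
  have "0 \<le> turning_orbit s n * turning_orbit t n" using assms by (intro coherent_same_sign[OF assms(1)]) auto
  then have "p * \<bar>turning_orbit s n - turning_orbit t n\<bar> - \<bar>s - t\<bar> \<le> \<bar>turning_orbit s (Suc n) - turning_orbit t (Suc n)\<bar>"
    using assms by (intro turning_orbit_expand param) auto
  moreover have "\<bar>s - t\<bar> \<le> 1 / M * \<bar>turning_orbit s n - turning_orbit t n\<bar>"
    using assms by (simp add: field_simps)
  ultimately show ?thesis by (simp add: left_diff_distrib)
qed

lemma coherent_subinterval: "\<exists>s t. p \<le> s \<and> s < t \<and> t \<le> q \<and> coherent s t n"
proof (induction n)
  case 0
  then show ?case using pq by (intro exI[of _ p] exI[of _ q]) (simp add: coherent_def)
next
  case (Suc n)
  then obtain s t where st: "p \<le> s" "s < t" "t \<le> q" "coherent s t n" by auto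
  show ?case
  proof (cases "\<forall>a\<in>{s..t}. turning_orbit a n = 0")
    case True
    then have "coherent s t (Suc n)" using st by (simp add: coherent_Suc)
    then show ?thesis using st by blast
  next
    case False
    then obtain a where a: "a \<in> {s..t}" "turning_orbit a n \<noteq> 0" by auto
    obtain d where d: "0 < d" "\<And>x. x \<in> {s..t} \<Longrightarrow> \<bar>x - a\<bar> < d \<Longrightarrow> \<bar>turning_orbit x n - turning_orbit a n\<bar> < \<bar>turning_orbit a n\<bar>"
      using turning_orbit_continuous[of "{s..t}" n] a unfolding continuous_on_iff dist_real_def
      by (meson zero_less_abs_iff)
    define s' where "s' = max s (a - d / 2)"
    define t' where "t' = min t (a + d / 2)"
    have st': "s \<le> s'" "s' < t'" "t' \<le> t" using a d(1) st by (auto simp: s'_def t'_def)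
    have near: "\<bar>turning_orbit x n - turning_orbit a n\<bar> < \<bar>turning_orbit a n\<bar>" if "x \<in> {s'..t'}" for x
      using that st' d(1) by (intro d(2)) (auto simp: s'_def t'_def)
    have "(\<forall>x\<in>{s'..t'}. 0 \<le> turning_orbit x n) \<or> (\<forall>x\<in>{s'..t'}. turning_orbit x n \<le> 0)"
    proof (cases "0 < turning_orbit a n")
      case True
      have "0 \<le> turning_orbit x n" if "x \<in> {s'..t'}" for x using near[OF that] True by linarith
      then show ?thesis by blast
    next
      case False
      have "turning_orbit x n \<le> 0" if "x \<in> {s'..t'}" for x using near[OF that] False by linarith
      then show ?thesis by blast
    qed
    then have "coherent s' t' (Suc n)"
      using coherent_subset[OF st(4) st'(1,3)] by (simp add: coherent_Suc)
    moreover have "p \<le> s'" "t' \<le> q" using st st' by auto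
    ultimately show ?thesis using st' by blast
  qed
qed

text \<open>The target z depends on the parameter; the sign change yields a hit by the intermediate
  value theorem. It will be used for \<open>return_point r\<close>.\<close>

definition crosses :: "(real \<Rightarrow> real) \<Rightarrow> nat \<Rightarrow> real \<Rightarrow> real \<Rightarrow> bool" where
  "crosses z n s t \<longleftrightarrow> p \<le> s \<and> s < t \<and> t \<le> q \<and> coherent s t n \<and>
     (turning_orbit s n - z s) * (turning_orbit t n - z t) < 0"

text \<open>Cutting at a zero of \<open>c\<^sub>n\<close> halves the image of a parameter interval, but if the image of the
  remaining half does not cover \<open>[0, 1]\<close> in the next step, it expands twice before the next cut.\<close>

lemma growth_step:
  assumes z: "\<And>a. a \<in> {p..q} \<Longrightarrow> 0 < z a \<and> z a < 1"
    and M: "0 < M" "1 \<le> L" "L = p - 2 / M"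
    and st: "p \<le> s" "s < t" "t \<le> q" "coherent s t n" "5 \<le> n"
    and large: "M * (t - s) \<le> \<bar>turning_orbit s n - turning_orbit t n\<bar>"
  shows "(\<exists>m s' t'. 5 \<le> m \<and> crosses z m s' t') \<or>
    (\<exists>m s' t'. 5 \<le> m \<and> p \<le> s' \<and> s' < t' \<and> t' \<le> q \<and> coherent s' t' m \<and>
      M * (t' - s') \<le> \<bar>turning_orbit s' m - turning_orbit t' m\<bar> \<and>
      min L (L\<^sup>2 / 2) * \<bar>turning_orbit s n - turning_orbit t n\<bar> \<le> \<bar>turning_orbit s' m - turning_orbit t' m\<bar>)"
proof (cases "0 \<le> turning_orbit s n * turning_orbit t n")
  case True
  let ?E = "\<bar>turning_orbit s n - turning_orbit t n\<bar>" and ?E' = "\<bar>turning_orbit s (Suc n) - turning_orbit t (Suc n)\<bar>"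
  have c: "coherent s t (Suc n)" by (rule coherent_SucI[OF st(4,5,1,3) True])
  have "(p - 1 / M) * ?E \<le> ?E'" by (rule coherent_expand[OF c st(1) less_imp_le[OF st(2)] st(3) large M(1)])
  moreover have "L * ?E \<le> (p - 1 / M) * ?E" using M by (intro mult_right_mono) (auto simp: divide_right_mono)
  ultimately have E': "L * ?E \<le> ?E'" by linarith
  have "1 * ?E \<le> L * ?E" using M(2) by (rule mult_right_mono) simp
  then have "?E \<le> L * ?E" by simp
  then have "M * (t - s) \<le> ?E'" using order_trans[OF order_trans[OF large] E'] by blast
  moreover have "min L (L\<^sup>2 / 2) * ?E \<le> L * ?E" by (intro mult_right_mono) auto
  then have "min L (L\<^sup>2 / 2) * ?E \<le> ?E'" using E' by linarith
  ultimately have "5 \<le> Suc n \<and> p \<le> s \<and> s < t \<and> t \<le> q \<and> coherent s t (Suc n) \<and> M * (t - s) \<le> ?E' \<and> min L (L\<^sup>2 / 2) * ?E \<le> ?E'"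
    using c st by simp
  then show ?thesis by blast
next
  case False
  let ?E = "\<bar>turning_orbit s n - turning_orbit t n\<bar>"
  have "\<exists>a\<in>{s..t}. turning_orbit a n = 0"
  proof (cases "turning_orbit s n \<le> 0")
    case True
    then have "0 \<le> turning_orbit t n" using False by (smt (verit) mult_nonpos_nonpos)
    then show ?thesis
      using IVT'[of "\<lambda>a. turning_orbit a n" s 0 t] True st turning_orbit_continuous by auto
  next
    case s: False
    then have "turning_orbit t n \<le> 0" using False by (smt (verit) mult_nonneg_nonneg)
    then show ?thesis
      using IVT2'[of "\<lambda>a. turning_orbit a n" t 0 s] s st turning_orbit_continuous by auto
  qed
  then obtain a0 where a0: "a0 \<in> {s..t}" "turning_orbit a0 n = 0" by auto
  have E2: "\<exists>e\<in>{s, t}. ?E / 2 \<le> \<bar>turning_orbit e n\<bar>" by (cases "?E / 2 \<le> \<bar>turning_orbit s n\<bar>") auto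
  \<comment> \<open>The end point farther from the cut keeps at least half of the image.\<close>
  then obtain e where e: "e \<in> {s, t}" "?E / 2 \<le> \<bar>turning_orbit e n\<bar>" by auto
  define s' where "s' = min a0 e"
  define t' where "t' = max a0 e"
  have Epos: "0 < ?E" using large st M by (smt (verit) mult_pos_pos)
  have ne: "e \<noteq> a0" using e a0 Epos by auto
  have st': "s \<le> s'" "s' < t'" "t' \<le> t" "p \<le> s'" "t' \<le> q" "t' - s' \<le> t - s"
    using a0 e(1) ne st by (auto simp: s'_def t'_def)
  have sw: "\<bar>turning_orbit s' m - turning_orbit t' m\<bar> = \<bar>turning_orbit a0 m - turning_orbit e m\<bar>"
    "turning_orbit s' m * turning_orbit t' m = turning_orbit a0 m * turning_orbit e m" for m
    by (auto simp: s'_def t'_def min_def max_def abs_minus_commute)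
  have c0: "coherent s' t' n" by (rule coherent_subset[OF st(4) st'(1,3)])
  have c1: "coherent s' t' (Suc n)" by (rule coherent_SucI[OF c0 st(5) st'(4,5)]) (simp add: sw a0)
  have E0: "\<bar>turning_orbit s' n - turning_orbit t' n\<bar> = \<bar>turning_orbit e n\<bar>" by (simp add: sw a0)
  have one: "turning_orbit a0 (Suc n) = 1" by (simp add: turning_orbit_Suc a0 tent_def)
  have eI: "e \<in> {p..q}" "a0 \<in> {p..q}" using e(1) st a0 by auto
  show ?thesis
  \<comment> \<open>At the cut the next orbit point is 1. If it is at most 0 at e, the image covers
    [0, 1] and the target in between is crossed.\<close>
  proof (cases "turning_orbit e (Suc n) \<le> 0")
    case True
    have "0 < turning_orbit a0 (Suc n) - z a0" "turning_orbit e (Suc n) - z e < 0"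
      using one z[OF eI(2)] z[OF eI(1)] True by auto
    then have "(turning_orbit s' (Suc n) - z s') * (turning_orbit t' (Suc n) - z t') < 0"
      by (cases "a0 \<le> e") (auto simp: s'_def t'_def mult_less_0_iff)
    then have "crosses z (Suc n) s' t'" using st' c1 by (simp add: crosses_def)
    then show ?thesis using st(5) by (intro disjI1 exI[of _ "Suc n"]) auto
  next
    case False
    have c2: "coherent s' t' (Suc (Suc n))"
      by (rule coherent_SucI[OF c1 _ st'(4,5)]) (use st(5) False in \<open>auto simp: sw one\<close>)
    let ?Ea = "\<bar>turning_orbit s' n - turning_orbit t' n\<bar>" and ?Eb = "\<bar>turning_orbit s' (Suc n) - turning_orbit t' (Suc n)\<bar>"
      and ?Ec = "\<bar>turning_orbit s' (Suc (Suc n)) - turning_orbit t' (Suc (Suc n))\<bar>"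
    have "M * (t' - s') \<le> M * (t - s)" using M st' by (intro mult_left_mono) auto
    \<comment> \<open>After the cut only the ratio M / 2 is guaranteed, whence
      \<open>L = p - 2 / M\<close>.\<close>
    from order_trans[OF this large] have "M * (t' - s') / 2 \<le> ?E / 2" by (rule divide_right_mono) simp
    from order_trans[OF this e(2)] have m0: "M / 2 * (t' - s') \<le> ?Ea" unfolding E0 by simp
    have M2: "0 < M / 2" "p - 1 / (M / 2) = L" using M by auto
    have e1: "L * ?Ea \<le> ?Eb"
      using coherent_expand[OF c1 st'(4) less_imp_le[OF st'(2)] st'(5) m0 M2(1)] unfolding M2(2) .
    have "1 * ?Ea \<le> L * ?Ea" using M(2) by (rule mult_right_mono) simp
    from order_trans[OF this e1] have "?Ea \<le> ?Eb" by (simp only: mult_1)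
    with m0 have m1: "M / 2 * (t' - s') \<le> ?Eb" by (rule order_trans)
    have e2: "L * ?Eb \<le> ?Ec"
      using coherent_expand[OF c2 st'(4) less_imp_le[OF st'(2)] st'(5) m1 M2(1)] unfolding M2(2) .
    have "L * (L * ?Ea) \<le> L * ?Eb" using e1 M(2) by (intro mult_left_mono) auto
    from order_trans[OF this e2] have E2: "L\<^sup>2 * ?Ea \<le> ?Ec" by (simp only: power2_eq_square mult.assoc)
    have "L\<^sup>2 / 2 * ?E = L\<^sup>2 * (?E / 2)" by simp
    also have "\<dots> \<le> L\<^sup>2 * ?Ea" unfolding E0 using e(2) by (intro mult_left_mono) auto
    finally have "L\<^sup>2 / 2 * ?E \<le> L\<^sup>2 * ?Ea" .
    from order_trans[OF this E2] have E3: "L\<^sup>2 / 2 * ?E \<le> ?Ec" .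
    have "min L (L\<^sup>2 / 2) * ?E \<le> L\<^sup>2 / 2 * ?E" by (intro mult_right_mono) auto
    from order_trans[OF this E3] have g: "min L (L\<^sup>2 / 2) * ?E \<le> ?Ec" .
    show ?thesis
    proof (cases "2 \<le> L\<^sup>2")
      case True
      have "2 * ?Ea \<le> L\<^sup>2 * ?Ea" using True by (rule mult_right_mono) simp
      from order_trans[OF this E2] have m2: "2 * ?Ea \<le> ?Ec" .
      have "2 * (M / 2 * (t' - s')) \<le> 2 * ?Ea" using m0 by (rule mult_left_mono) simp
      from order_trans[OF this m2] have "M * (t' - s') \<le> ?Ec" by simp
      then have "5 \<le> Suc (Suc n) \<and> p \<le> s' \<and> s' < t' \<and> t' \<le> q \<and> coherent s' t' (Suc (Suc n)) \<and>
          M * (t' - s') \<le> ?Ec \<and> min L (L\<^sup>2 / 2) * ?E \<le> ?Ec"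
        using c2 g st' st(5) by simp
      then show ?thesis by blast
    next
      \<comment> \<open>The growth factor is then less than 1 and the old interval will do.\<close>
      case False
      have "min L (L\<^sup>2 / 2) * ?E \<le> 1 * ?E" using False by (intro mult_right_mono) auto
      then have "5 \<le> n \<and> p \<le> s \<and> s < t \<and> t \<le> q \<and> coherent s t n \<and> M * (t - s) \<le> ?E \<and> min L (L\<^sup>2 / 2) * ?E \<le> ?E"
        using st large by simp
      then show ?thesis by blast
    qed
  qed
qed

text \<open>Without a crossing the images would grow geometrically, although their length is at most
  2. Since \<open>p > sqrt 2\<close>, M can be taken so large that
  \<open>(p - 2 / M)\<^sup>2 > 2\<close>, which makes the growth factor exceed 1.\<close>

lemma crossing_exists:
  assumes z: "\<And>a. a \<in> {p..q} \<Longrightarrow> 0 < z a \<and> z a < 1"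
  shows "\<exists>n s t. 5 \<le> n \<and> crosses z n s t"
proof (rule ccontr)
  assume none: "\<not> ?thesis"
  have p2: "1.414 < p" "2 < p\<^sup>2"
    using p sqrt2_bounds power_strict_mono[OF p, of 2] by auto
  have "(\<lambda>M. p - 2 * inverse (real (Suc M))) \<longlonglongrightarrow> p - 2 * 0"
    by (intro tendsto_intros LIMSEQ_inverse_real_of_nat)
  then have "(\<lambda>M. (p - 2 * inverse (real (Suc M)))\<^sup>2) \<longlonglongrightarrow> p\<^sup>2" and l2: "(\<lambda>M. p - 2 * inverse (real (Suc M))) \<longlonglongrightarrow> p"
    using tendsto_power[of "\<lambda>M. p - 2 * inverse (real (Suc M))" p _ 2] by auto
  from order_tendstoD(1)[OF this(1) p2(2)] order_tendstoD(1)[OF l2, of 1] p2(1)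
  have "\<forall>\<^sub>F M in sequentially. 2 < (p - 2 * inverse (real (Suc M)))\<^sup>2 \<and> 1 < p - 2 * inverse (real (Suc M))"
    by (auto intro: eventually_conj)
  then obtain M0 where M0: "2 < (p - 2 * inverse (real (Suc M0)))\<^sup>2" "1 < p - 2 * inverse (real (Suc M0))"
    by (auto simp: eventually_sequentially)
  define M where "M = real (Suc M0)"
  define L where "L = p - 2 / M"
  have M: "0 < M" "1 \<le> L" "2 < L\<^sup>2" "1 < L" using M0 by (auto simp: M_def L_def divide_inverse)
  define g where "g = min L (L\<^sup>2 / 2)"
  have g: "1 < g" using M by (simp add: g_def)
  have "1 < p" using p2(1) by simp
  \<comment> \<open>With this k transversality makes the image at time k + 5 at least M times as
    long as the parameter interval.\<close>
  then obtain k where k: "10 * M < p ^ k" using real_arch_pow by blast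
  obtain s0 t0 where st0: "p \<le> s0" "s0 < t0" "t0 \<le> q" "coherent s0 t0 (k + 5)"
    using coherent_subinterval by blast
  define E0 where "E0 = \<bar>turning_orbit s0 (k + 5) - turning_orbit t0 (k + 5)\<bar>"
  have "1 / 10 * p ^ (k + 5 - 5) * \<bar>s0 - t0\<bar> \<le> E0"
    unfolding E0_def using st0 by (intro coherent_transversal[OF st0(4)]) auto
  moreover have "M * \<bar>s0 - t0\<bar> \<le> 1 / 10 * p ^ k * \<bar>s0 - t0\<bar>" using k by (intro mult_right_mono) auto
  ultimately have "M * \<bar>s0 - t0\<bar> \<le> E0" by simp
  then have E0: "M * (t0 - s0) \<le> E0" using st0 by simp
  then have E0pos: "0 < E0" using M(1) st0(2) by (smt (verit) mult_pos_pos)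
  have "\<exists>n s t. 5 \<le> n \<and> p \<le> s \<and> s < t \<and> t \<le> q \<and> coherent s t n \<and>
      M * (t - s) \<le> \<bar>turning_orbit s n - turning_orbit t n\<bar> \<and> g ^ j * E0 \<le> \<bar>turning_orbit s n - turning_orbit t n\<bar>" for j
  proof (induction j)
    case 0
    show ?case using st0 E0 by (intro exI[of _ "k + 5"] exI[of _ s0] exI[of _ t0]) (simp add: E0_def)
  next
    case (Suc j)
    then obtain n s t where I: "5 \<le> n" "p \<le> s" "s < t" "t \<le> q" "coherent s t n"
      "M * (t - s) \<le> \<bar>turning_orbit s n - turning_orbit t n\<bar>" "g ^ j * E0 \<le> \<bar>turning_orbit s n - turning_orbit t n\<bar>"
      by blast
    have "(\<exists>m s' t'. 5 \<le> m \<and> crosses z m s' t') \<or>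
      (\<exists>m s' t'. 5 \<le> m \<and> p \<le> s' \<and> s' < t' \<and> t' \<le> q \<and> coherent s' t' m \<and>
        M * (t' - s') \<le> \<bar>turning_orbit s' m - turning_orbit t' m\<bar> \<and>
        min L (L\<^sup>2 / 2) * \<bar>turning_orbit s n - turning_orbit t n\<bar> \<le> \<bar>turning_orbit s' m - turning_orbit t' m\<bar>)"
      by (rule growth_step[OF z M(1,2) L_def I(2-5,1) I(6)])
    with none obtain m s' t' where I': "5 \<le> m" "p \<le> s'" "s' < t'" "t' \<le> q" "coherent s' t' m"
      "M * (t' - s') \<le> \<bar>turning_orbit s' m - turning_orbit t' m\<bar>"
      "g * \<bar>turning_orbit s n - turning_orbit t n\<bar> \<le> \<bar>turning_orbit s' m - turning_orbit t' m\<bar>"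
      unfolding g_def by blast
    have "g ^ Suc j * E0 \<le> g * \<bar>turning_orbit s n - turning_orbit t n\<bar>"
      using mult_left_mono[OF I(7), of g] g by (simp add: mult.assoc)
    then have "g ^ Suc j * E0 \<le> \<bar>turning_orbit s' m - turning_orbit t' m\<bar>" using I'(7) by linarith
    then show ?case using I' by blast
  qed
  note all = this
  have bound: "g ^ j * E0 \<le> 2" for j
  proof -
    obtain n s t where I: "p \<le> s" "s < t" "t \<le> q" "g ^ j * E0 \<le> \<bar>turning_orbit s n - turning_orbit t n\<bar>"
      using all[of j] by blast
    have "turning_orbit s n \<in> {1 - s..1}" "turning_orbit t n \<in> {1 - t..1}"
      using I by (auto intro!: turning_orbit_mem[unfolded atLeastAtMost_iff] param)
    then have "\<bar>turning_orbit s n - turning_orbit t n\<bar> \<le> 2" using I q by auto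
    then show ?thesis using I(4) by linarith
  qed
  obtain j where "2 / E0 < g ^ j" using real_arch_pow[OF g] by blast
  then have "2 < g ^ j * E0" using E0pos by (simp add: field_simps)
  then show False using bound[of j] by simp
qed

end

text \<open>The point of period \<open>r\<close> whose orbit is positive once and then negative \<open>r - 1\<close> times; it is the fixed
  point of \<open>w \<mapsto> a\<^sup>r (\<kappa> - w) - \<kappa>\<close> where \<open>\<kappa> = 1 / (a - 1)\<close>, the map to which \<open>f\<^sup>r\<close> is then equal.\<close>

definition return_point :: "nat \<Rightarrow> real \<Rightarrow> real" where
  "return_point r a = (a ^ r - 1) / ((a - 1) * (a ^ r + 1))"

lemma return_point_fixed:
  assumes "1 < a"
  shows "a ^ r * (1 / (a - 1) - return_point r a) - 1 / (a - 1) = return_point r a"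
proof -
  define A where "A = a ^ r"
  have A: "0 < A" using assms by (simp add: A_def)
  have k: "1 / (a - 1) - return_point r a = 2 / ((a - 1) * (A + 1))"
    using assms A unfolding return_point_def A_def[symmetric] by (simp add: divide_simps)
  show ?thesis
    unfolding k unfolding return_point_def A_def[symmetric] using assms A by (simp add: divide_simps)
qed

text \<open>After clearing denominators the inequality is the sign condition at index r. Likewise
  the lower bound \<open>a - 1\<close> of the next lemma is the condition at index r + 2.\<close>

lemma return_point_less_1:
  assumes "1 < a" "neg_orbit a r < 0" "1 \<le> r"
  shows "return_point r a < 1"
proof -
  define A where "A = a ^ (r - 1)"
  have A: "0 < A" "a ^ r = a * A" using assms power_minus_mult[of r a] by (auto simp: A_def mult.commute)
  have "A * (2 - a) < 1"
    using assms by (simp add: neg_orbit_def A_def divide_less_0_iff mult.commute)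
  then have "a * (A * (2 - a)) < a * 1" using assms by (intro mult_strict_left_mono) auto
  then have "a * A - 1 < (a - 1) * (a * A + 1)" by (simp add: algebra_simps)
  moreover have "0 < (a - 1) * (a * A + 1)" using A assms by (intro mult_pos_pos add_pos_pos) auto
  ultimately show ?thesis unfolding return_point_def A(2) by (simp add: pos_divide_less_eq)
qed

lemma return_point_greater:
  assumes "1 < a" "a - 1 < neg_orbit a (Suc (Suc r))"
  shows "a - 1 < return_point r a"
proof -
  define A where "A = a ^ r"
  have A: "0 < A" using assms by (auto simp: A_def)
  have "(a - 1) * (a - 1) < (2 - a) * (a * A) - 1"
    using assms by (simp add: neg_orbit_def A_def pos_less_divide_eq mult.commute mult.left_commute)
  then have "(a - 1) * ((a - 1) * (A + 1)) < A - 1" by (simp add: algebra_simps)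
  moreover have "0 < (a - 1) * (A + 1)" using A assms by simp
  ultimately show ?thesis unfolding return_point_def A_def[symmetric] by (simp add: pos_less_divide_eq)
qed

text \<open>The hypothesis \<open>le\<close> says that the affine formula for time r has a value of
  at most 1. The value at an earlier time j is then at most 0, since the increasing branch takes it
  to the value at j + 1, which is at most the value at r. So the formula applies all the
  way.\<close>

lemma tent_cycle:
  assumes a: "1 < a" "a \<le> 2" and w: "0 \<le> w" "w \<le> 1"
    and le: "return_point r a - a ^ r * (w - return_point r a) \<le> 1"
  shows "1 \<le> j \<Longrightarrow> j \<le> r \<Longrightarrow> (tent a ^^ j) w = a ^ j * (1 / (a - 1) - w) - 1 / (a - 1)"
    and "1 \<le> j \<Longrightarrow> j < r \<Longrightarrow> (tent a ^^ j) w \<le> 0"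
proof -
  define \<kappa> where "\<kappa> = 1 / (a - 1)"
  have k: "1 \<le> \<kappa>" "a * \<kappa> = \<kappa> + 1" using a by (auto simp: \<kappa>_def field_simps)
  have le': "a ^ r * (\<kappa> - w) - \<kappa> \<le> 1"
  proof -
    have "a ^ r * (\<kappa> - w) - \<kappa> = (a ^ r * (\<kappa> - return_point r a) - \<kappa>) - a ^ r * (w - return_point r a)"
      by (simp add: algebra_simps)
    also have "\<dots> \<le> 1" unfolding \<kappa>_def return_point_fixed[OF a(1)] by (rule le)
    finally show ?thesis .
  qed
  have neg: "a ^ j * (\<kappa> - w) - \<kappa> \<le> 0" if "j < r" for j
  proof -
    have "a ^ Suc j * (\<kappa> - w) \<le> a ^ r * (\<kappa> - w)" using that a k w by (intro mult_right_mono power_increasing) auto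
    then have "a * (a ^ j * (\<kappa> - w) - \<kappa>) \<le> 0" using le' k(2) by (simp add: right_diff_distrib mult.assoc)
    then show ?thesis using a by (simp add: mult_le_0_iff)
  qed
  have eq: "(tent a ^^ j) w = a ^ j * (\<kappa> - w) - \<kappa>" if "1 \<le> j" "j \<le> r" for j
    using that
  proof (induction j rule: dec_induct)
    case base
    show ?case using w k(2) by (simp add: tent_def algebra_simps)
  next
    case (step j)
    then have "(tent a ^^ j) w = a ^ j * (\<kappa> - w) - \<kappa>" by simp
    moreover have "a ^ j * (\<kappa> - w) - \<kappa> \<le> 0" using step by (intro neg) simp
    ultimately have "(tent a ^^ Suc j) w = 1 + a * (a ^ j * (\<kappa> - w) - \<kappa>)" by (simp add: tent_def[of a "_ - _"] right_diff_distrib)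
    also have "\<dots> = a ^ Suc j * (\<kappa> - w) - \<kappa>" using k(2) by (simp add: algebra_simps)
    finally show ?case .
  qed
  show "1 \<le> j \<Longrightarrow> j \<le> r \<Longrightarrow> (tent a ^^ j) w = a ^ j * (1 / (a - 1) - w) - 1 / (a - 1)"
    using eq[of j] by (simp add: \<kappa>_def)
  show "1 \<le> j \<Longrightarrow> j < r \<Longrightarrow> (tent a ^^ j) w \<le> 0" using eq[of j] neg[of j] by simp
qed

section \<open>Orbits that follow the cycle, and growth of the difference of distribution
  functions\<close>

lemma turning_orbit_add: "turning_orbit a (n + j) = (tent a ^^ j) (turning_orbit a n)"
  unfolding turning_orbit_def by (subst add.commute) (simp add: funpow_add)

text \<open>The return map multiplies the distance from \<open>return_point\<close> by exactly
  \<open>a ^ r\<close>, so the bound \<open>\<tau>\<close> after k cycles holds throughout. The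
  first condition on \<open>\<tau>\<close> makes \<open>tent_cycle\<close> applicable, the second
  keeps the returns above \<open>a - 1\<close>.\<close>

lemma turning_orbit_cycles:
  assumes a: "tent_param a" and r: "1 \<le> r"
    and \<tau>: "2 ^ r * \<tau> \<le> 1 - return_point r a" "\<tau> \<le> return_point r a - (a - 1)"
    and close: "a ^ (r * k) * \<bar>turning_orbit a n - return_point r a\<bar> \<le> \<tau>"
  shows "j \<le> k \<Longrightarrow> \<bar>turning_orbit a (n + r * j) - return_point r a\<bar> = a ^ (r * j) * \<bar>turning_orbit a n - return_point r a\<bar>"
    and "j \<le> k \<Longrightarrow> a - 1 \<le> turning_orbit a (n + r * j)"
    and "j < k \<Longrightarrow> 1 \<le> i \<Longrightarrow> i < r \<Longrightarrow> turning_orbit a (n + r * j + i) \<le> 0"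
proof -
  let ?z = "return_point r a" and ?c = "turning_orbit a"
  have a12: "1 < a" "a \<le> 2" using tent_param.a_gt[OF a] tent_param.a_le[OF a] by auto
  have near: "\<bar>w - ?z\<bar> \<le> \<tau> \<Longrightarrow> a - 1 \<le> w" for w using \<tau>(2) by linarith
  have le: "?z - a ^ r * (w - ?z) \<le> 1" if "\<bar>w - ?z\<bar> \<le> \<tau>" for w
  proof -
    have "a ^ r * (?z - w) \<le> a ^ r * \<bar>w - ?z\<bar>" using a12 by (intro mult_left_mono) auto
    moreover have "- (a ^ r * (w - ?z)) = a ^ r * (?z - w)" by (simp add: right_diff_distrib)
    ultimately have "- (a ^ r * (w - ?z)) \<le> a ^ r * \<bar>w - ?z\<bar>" by (simp only:)
    also have "\<dots> \<le> 2 ^ r * \<tau>" using a12 that by (intro mult_mono power_mono) auto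
    finally show ?thesis using \<tau>(1) by linarith
  qed
  have main: "\<bar>?c (n + r * j) - ?z\<bar> = a ^ (r * j) * \<bar>?c n - ?z\<bar> \<and> \<bar>?c (n + r * j) - ?z\<bar> \<le> \<tau>" if "j \<le> k" for j
    using that
  proof (induction j)
    case 0
    have "1 * \<bar>?c n - ?z\<bar> \<le> a ^ (r * k) * \<bar>?c n - ?z\<bar>" using a12 by (intro mult_right_mono one_le_power) auto
    then show ?case using close by simp
  next
    case (Suc j)
    let ?w = "?c (n + r * j)"
    have w: "\<bar>?w - ?z\<bar> = a ^ (r * j) * \<bar>?c n - ?z\<bar>" "\<bar>?w - ?z\<bar> \<le> \<tau>" using Suc by auto
    have w01: "0 \<le> ?w" "?w \<le> 1" using near[OF w(2)] a12 turning_orbit_mem[OF a, of "n + r * j"] by auto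
    have "?c (n + r * Suc j) = (tent a ^^ r) ?w"
      using turning_orbit_add[of a "n + r * j" r] by (simp add: algebra_simps)
    also have "\<dots> = a ^ r * (1 / (a - 1) - ?w) - 1 / (a - 1)" by (rule tent_cycle(1)[OF a12 w01 le[OF w(2)] r order_refl])
    also have "\<dots> = (a ^ r * (1 / (a - 1) - ?z) - 1 / (a - 1)) - a ^ r * (?w - ?z)" by (simp add: right_diff_distrib)
    also have "\<dots> = ?z - a ^ r * (?w - ?z)" by (simp only: return_point_fixed[OF a12(1)])
    finally have "\<bar>?c (n + r * Suc j) - ?z\<bar> = a ^ r * \<bar>?w - ?z\<bar>" using a12 by (simp add: abs_mult)
    then have 1: "\<bar>?c (n + r * Suc j) - ?z\<bar> = a ^ (r * Suc j) * \<bar>?c n - ?z\<bar>"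
      by (simp add: w(1) power_add mult.assoc)
    have "a ^ (r * Suc j) * \<bar>?c n - ?z\<bar> \<le> a ^ (r * k) * \<bar>?c n - ?z\<bar>"
      using a12 Suc.prems by (intro mult_right_mono power_increasing mult_le_mono) auto
    then show ?case using 1 close by linarith
  qed
  show "j \<le> k \<Longrightarrow> \<bar>?c (n + r * j) - ?z\<bar> = a ^ (r * j) * \<bar>?c n - ?z\<bar>" using main[of j] by simp
  show "j \<le> k \<Longrightarrow> a - 1 \<le> ?c (n + r * j)" using main[of j] near by blast
  show "?c (n + r * j + i) \<le> 0" if "j < k" "1 \<le> i" "i < r"
  proof -
    have m: "\<bar>?c (n + r * j) - ?z\<bar> \<le> \<tau>" using main[of j] that by simp
    have w01: "0 \<le> ?c (n + r * j)" "?c (n + r * j) \<le> 1"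
      using near[OF m] a12 turning_orbit_mem[OF a, of "n + r * j"] by auto
    show ?thesis unfolding turning_orbit_add[of a "n + r * j" i]
      by (rule tent_cycle(2)[OF a12 w01 le[OF m] that(2,3)])
  qed
qed

text \<open>One formula in \<open>F u\<close> and \<open>F 0\<close> for all three branches: two
  parameters can be compared even when their points lie on different branches.\<close>

lemma (in tent_cdf) cdf_tent:
  assumes "u \<in> {1 - a..1}"
  shows "F (tent a u) = min (1 - 2 * F 0 + 2 * F u) (max (1 + 2 * F 0 - 2 * F u) (1 - F u))"
proof -
  have H: "1 / 4 \<le> F 0" by (rule H_bounds)
  consider "u \<le> 0" | "0 \<le> u" "u \<le> a - 1" | "a - 1 \<le> u" by linarith
  then show ?thesis
  proof cases
    case 1
    then have "F u \<le> F 0" using assms by (intro F_mono) auto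
    then show ?thesis using F_left[of u] 1 assms by (auto simp: min_def max_def)
  next
    case 2
    have "F 0 \<le> F u" using assms 2 a_gt by (intro F_mono) auto
    moreover have "F u \<le> F (a - 1)" using assms 2 a_le by (intro F_mono) auto
    ultimately show ?thesis using F_right[of u] 2 F_chat2 by (auto simp: min_def max_def)
  next
    case 3
    have "F (a - 1) \<le> F u" using assms 3 a_gt by (intro F_mono) auto
    then show ?thesis using F_high[of u] 3 F_chat2 H assms by (auto simp: min_def max_def)
  qed
qed

text \<open>Adding twice the difference at the turning point absorbs the constants of the functional
  equation, and a step then at most doubles the sum.\<close>

lemma cdf_tent_dist:
  assumes "tent_cdf x F" "tent_cdf y G" "u \<in> {1 - x..1}" "w \<in> {1 - y..1}"
  shows "\<bar>F (tent x u) - G (tent y w)\<bar> + 2 * \<bar>F 0 - G 0\<bar> \<le> 2 * (\<bar>F u - G w\<bar> + 2 * \<bar>F 0 - G 0\<bar>)"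
proof -
  have minmax: "\<bar>min a (max b c) - min a' (max b' c')\<bar> \<le> e"
    if "\<bar>a - a'\<bar> \<le> e" "\<bar>b - b'\<bar> \<le> e" "\<bar>c - c'\<bar> \<le> e" for a b c a' b' c' e :: real
    using that by (smt (verit))
  have "\<bar>F (tent x u) - G (tent y w)\<bar> \<le> 2 * \<bar>F u - G w\<bar> + 2 * \<bar>F 0 - G 0\<bar>"
    unfolding tent_cdf.cdf_tent[OF assms(1,3)] tent_cdf.cdf_tent[OF assms(2,4)]
    by (rule minmax) (smt (verit))+
  then show ?thesis by simp
qed

text \<open>Both orbits start at 0, where the sum of \<open>cdf_tent_dist\<close> is 3 times the
  difference of the entropies. It doubles at most n times before the cycle and r - 1 times in each
  cycle, because the step above \<open>a - 1\<close> preserves it.\<close>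

lemma cdf_turning_orbit_dist:
  assumes F: "tent_cdf x F" and G: "tent_cdf y G" and r: "1 \<le> r"
    and high: "\<And>j. j < k \<Longrightarrow> x - 1 \<le> turning_orbit x (n + r * j)" "\<And>j. j < k \<Longrightarrow> y - 1 \<le> turning_orbit y (n + r * j)"
  shows "\<bar>F (turning_orbit x (n + r * k)) - G (turning_orbit y (n + r * k))\<bar>
    \<le> 3 * 2 ^ n * 2 ^ ((r - 1) * k) * \<bar>F 0 - G 0\<bar>"
proof -
  let ?D = "\<lambda>m. \<bar>F (turning_orbit x m) - G (turning_orbit y m)\<bar> + 2 * \<bar>F 0 - G 0\<bar>"
  have mem: "turning_orbit x m \<in> {1 - x..1}" "turning_orbit y m \<in> {1 - y..1}" for m
    using turning_orbit_mem F G by (auto simp only: tent_cdf_def)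
  have step: "?D (Suc m) \<le> 2 * ?D m" for m
    unfolding turning_orbit_Suc by (rule cdf_tent_dist[OF F G mem])
  have steps: "?D (m + i) \<le> 2 ^ i * ?D m" for m i
  proof (induction i)
    case (Suc i)
    have "?D (m + Suc i) \<le> 2 * ?D (m + i)" using step[of "m + i"] by (simp only: add_Suc_right)
    also have "\<dots> \<le> 2 * (2 ^ i * ?D m)" by (rule mult_left_mono[OF Suc]) simp
    finally show ?case by (simp only: power_Suc mult.assoc)
  qed simp
  have "?D (n + r * j) \<le> 2 ^ n * 2 ^ ((r - 1) * j) * (3 * \<bar>F 0 - G 0\<bar>)" if "j \<le> k" for j
    using that
  proof (induction j)
    case 0
    show ?case using steps[of 0 n] by (simp add: turning_orbit_0_1_2)
  next
    case (Suc j)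
    let ?m = "n + r * j"
    have "?D (Suc ?m) = ?D ?m"
      using high[of j] Suc.prems mem[of ?m] tent_cdf.F_high[OF F, of "turning_orbit x ?m"]
        tent_cdf.F_high[OF G, of "turning_orbit y ?m"] by (simp add: turning_orbit_Suc)
    moreover have "n + r * Suc j = Suc ?m + (r - 1)" using r by simp
    ultimately have "?D (n + r * Suc j) \<le> 2 ^ (r - 1) * ?D ?m" using steps[of "Suc ?m" "r - 1"] by metis
    also have "\<dots> \<le> 2 ^ (r - 1) * (2 ^ n * 2 ^ ((r - 1) * j) * (3 * \<bar>F 0 - G 0\<bar>))"
      using Suc by (intro mult_left_mono) auto
    also have "\<dots> = 2 ^ n * 2 ^ ((r - 1) * Suc j) * (3 * \<bar>F 0 - G 0\<bar>)"
      by (simp only: mult_Suc_right power_add mult.assoc mult.left_commute)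
    finally show ?case .
  qed
  from this[OF order_refl] have "?D (n + r * k) \<le> 3 * 2 ^ n * 2 ^ ((r - 1) * k) * \<bar>F 0 - G 0\<bar>"
    by (simp only: mult.assoc mult.left_commute)
  moreover have "0 \<le> 2 * \<bar>F 0 - G 0\<bar>" by simp
  ultimately show ?thesis by linarith
qed

lemma return_point_bounds:
  assumes r: "2 \<le> r" and a: "special_param r < a" "a < special_param (Suc r)"
  shows "a - 1 < return_point r a" "return_point r a < 1"
proof -
  have a12: "1 < a" "a \<le> 2"
    using special_param_bounds[OF r] special_param_bounds[of "Suc r"] r a sqrt2_bounds by auto
  have "turning_orbit a r \<le> - neg_gap r" "turning_orbit a r = neg_orbit a r"
    using above_special_param(1,3)[OF r less_imp_le[OF a(1)] a12(2), of r] r by auto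
  then have "neg_orbit a r < 0" using neg_gap_pos[OF r] by simp
  then show "return_point r a < 1" using a12 r by (intro return_point_less_1) auto
  show "a - 1 < return_point r a"
    using below_special_param[OF r a12(1) a(2)] by (rule return_point_greater[OF a12(1)])
qed

lemma return_point_continuous: "(\<And>a. a \<in> S \<Longrightarrow> 1 < a) \<Longrightarrow> continuous_on S (return_point r)"
proof -
  assume S: "\<And>a. a \<in> S \<Longrightarrow> 1 < a"
  have "(a - 1) * (a ^ r + 1) \<noteq> 0" if "a \<in> S" for a :: real
  proof -
    have "0 < a ^ r + 1" using S[OF that] by (intro add_pos_pos) auto
    then show ?thesis using S[OF that] by auto
  qed
  then show ?thesis unfolding return_point_def by (intro continuous_intros) auto
qed

text \<open>Compactness gives a common lower bound for both gaps; the division by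
  \<open>2 ^ r\<close> allows for the expansion during one cycle.\<close>

lemma return_point_margin:
  assumes r: "2 \<le> r" and pq: "special_param r < p" "p \<le> q" "q < special_param (Suc r)"
  obtains \<tau> where "0 < \<tau>" "\<And>a. a \<in> {p..q} \<Longrightarrow> 2 ^ r * \<tau> \<le> 1 - return_point r a \<and> \<tau> \<le> return_point r a - (a - 1)"
proof -
  let ?m = "\<lambda>a. min (1 - return_point r a) (return_point r a - (a - 1))"
  have p1: "1 < p" using special_param_bounds(1)[OF r] pq(1) real_sqrt_gt_1_iff[of 2] by linarith
  have "continuous_on {p..q} ?m"
    using p1 by (intro continuous_intros return_point_continuous) auto
  then obtain a0 where a0: "a0 \<in> {p..q}" "\<And>a. a \<in> {p..q} \<Longrightarrow> ?m a0 \<le> ?m a"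
    using continuous_attains_inf[of "{p..q}" ?m] pq by auto
  have pos: "0 < ?m a0" using return_point_bounds[OF r, of a0] a0(1) pq by auto
  have m: "?m a0 / 2 ^ r \<le> ?m a0" using divide_left_mono[of 1 "2 ^ r" "?m a0"] pos by simp
  show thesis
  proof (rule that[of "?m a0 / 2 ^ r"])
    show "0 < ?m a0 / 2 ^ r" using pos by simp
    fix a assume "a \<in> {p..q}"
    then have "?m a0 \<le> 1 - return_point r a" "?m a0 \<le> return_point r a - (a - 1)" using a0(2)[of a] by linarith+
    then show "2 ^ r * (?m a0 / 2 ^ r) \<le> 1 - return_point r a \<and> ?m a0 / 2 ^ r \<le> return_point r a - (a - 1)"
      using order_trans[OF m] by simp
  qed
qed

text \<open>Under the assumed bound the entropies at b and y differ by at most a constant times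
  \<open>\<theta> \<alpha> ^ k\<close>. The k cycles amplify this at most by
  \<open>2 ^ ((r - 1) * k)\<close>, and the product tends to 0 by the hypothesis on
  \<open>\<alpha>\<close>. At the end of the cycles, however, the orbits are about
  \<open>\<tau>\<close> apart, which F must see because it is strictly increasing.\<close>

lemma not_holder_between:
  assumes r: "2 \<le> r" and pq: "special_param r < p" "p < q" "q < special_param (Suc r)"
    and \<alpha>: "0 < \<alpha>" "2 ^ (r - 1) < (p powr \<alpha>) ^ r"
    and H: "\<And>x y. x \<in> {p..q} \<Longrightarrow> y \<in> {p..q} \<Longrightarrow>
      \<bar>normalized_fair_entropy x - normalized_fair_entropy y\<bar> \<le> C * \<bar>x - y\<bar> powr \<alpha>"
  shows False
proof -
  let ?H = normalized_fair_entropy and ?z = "return_point r" and ?c = turning_orbit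
  have bd: "sqrt 2 < p" "q < 2" "1 < p"
    using special_param_bounds[OF r] special_param_bounds[of "Suc r"] r pq sqrt2_bounds by auto
  interpret I: param_interval p q using bd pq by unfold_locales auto
  have z: "a - 1 < ?z a" "?z a < 1" if "a \<in> {p..q}" for a
    using return_point_bounds[OF r] that pq by auto
  have C: "0 \<le> C"
  proof -
    have "0 \<le> C * \<bar>p - q\<bar> powr \<alpha>" using H[of p q] pq by (simp add: order_trans[OF abs_ge_zero])
    moreover have "0 < \<bar>p - q\<bar> powr \<alpha>" using pq by simp
    ultimately show ?thesis by (simp add: zero_le_mult_iff)
  qed
  obtain \<tau> where \<tau>: "0 < \<tau>"
    "\<And>a. a \<in> {p..q} \<Longrightarrow> 2 ^ r * \<tau> \<le> 1 - ?z a \<and> \<tau> \<le> ?z a - (a - 1)"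
    using return_point_margin[OF r pq(1) less_imp_le[OF pq(2)] pq(3)] by blast
  have \<tau>1: "\<tau> \<le> 1 - ?z a" if "a \<in> {p..q}" for a
  proof -
    have "1 * \<tau> \<le> 2 ^ r * \<tau>" using \<tau>(1) by (intro mult_right_mono one_le_power) auto
    then show ?thesis using \<tau>(2)[OF that] by linarith
  qed
  have contz: "continuous_on S ?z" if "S \<subseteq> {p..q}" for S
    using that bd by (intro return_point_continuous) auto

  have "\<exists>n s t. 5 \<le> n \<and> I.crosses ?z n s t" using bd z by (intro I.crossing_exists) fastforce
  then obtain n s t where n: "5 \<le> n" and st: "p \<le> s" "s < t" "t \<le> q" "coherent s t n"
    and sgn: "(?c s n - ?z s) * (?c t n - ?z t) < 0" by (auto simp: I.crosses_def)
  let ?g = "\<lambda>a. ?c a n - ?z a"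
  have contg: "continuous_on {s..t} ?g"
    using st by (intro continuous_intros turning_orbit_continuous contz) auto
  have gt0: "?g t \<noteq> 0" "?g s \<noteq> 0" using sgn by auto
  obtain b where b: "s \<le> b" "b \<le> t" "?g b = 0"
  proof (cases "?g s \<le> 0")
    case True
    then have "0 \<le> ?g t" using sgn by (smt (verit) mult_nonpos_nonpos)
    then show ?thesis using IVT'[of ?g s 0 t] True st contg that by auto
  next
    case False
    then have "?g t \<le> 0" using sgn by (smt (verit) mult_nonneg_nonneg)
    then show ?thesis using IVT2'[of ?g t 0 s] False st contg that by auto
  qed
  have bI: "b \<in> {p..q}" using b st by auto

  obtain F where F: "tent_cdf b F" "?H b = F 0" using obtain_tent_cdf[of b] bI bd by auto
  define \<xi> where "\<xi> = min (F (?z b) - F (?z b - \<tau> / 2)) (F (?z b + \<tau> / 2) - F (?z b))"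
  have \<xi>: "0 < \<xi>"
  proof -
    have "sqrt 2 < b" using bI bd by auto
    then show ?thesis unfolding \<xi>_def
      using \<tau>(1) \<tau>(2)[OF bI] \<tau>1[OF bI] bI bd
      by (auto intro!: tent_cdf.cdf_strict_mono[OF F(1)])
  qed
  have far: "\<xi> \<le> \<bar>F w - F (?z b)\<bar>" if w: "1 - b \<le> w" "w \<le> 1" "\<tau> / 2 \<le> \<bar>w - ?z b\<bar>" for w
  proof (cases "w \<le> ?z b")
    case True
    have "F w \<le> F (?z b - \<tau> / 2)"
      using w True \<tau>(1) z[OF bI] by (intro tent_cdf.F_mono[OF F(1)]) auto
    then show ?thesis by (simp add: \<xi>_def)
  next
    case False
    have "F (?z b + \<tau> / 2) \<le> F w"
      using w False \<tau>(1) z[OF bI] bI bd by (intro tent_cdf.F_mono[OF F(1)]) auto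
    then show ?thesis by (simp add: \<xi>_def)
  qed

  obtain d where d: "0 < d" "\<And>y. y \<in> {p..q} \<Longrightarrow> \<bar>y - b\<bar> < d \<Longrightarrow> \<bar>?z y - ?z b\<bar> < \<tau> / 2"
    using contz[of "{p..q}"] bI \<tau>(1) unfolding continuous_on_iff dist_real_def
    by (metis half_gt_zero order_refl)
  \<comment> \<open>Any positive exponent valid for all parameters is enough for the error of
    comparing F and G at one point; r = 2 and b = 2 give 1/2.\<close>
  define \<beta> where "\<beta> = holder_exponent 2 2"
  have \<beta>: "0 < \<beta>" by (simp add: \<beta>_def holder_exponent_pos)
  obtain C' where C': "0 \<le> C'" "\<And>a F x y. sqrt 2 \<le> a \<Longrightarrow> a \<le> 2 \<Longrightarrow> tent_cdf a F \<Longrightarrow>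
      x \<in> {1 - a..1} \<Longrightarrow> y \<in> {1 - a..1} \<Longrightarrow> \<bar>F x - F y\<bar> \<le> C' * \<bar>x - y\<bar> powr \<beta>"
    using cdf_holder_uniform[of 2 2] special_param_bounds(2)[of 2] unfolding special_param_2 \<beta>_def by auto
  define \<theta> where "\<theta> \<gamma> = 1 / (p powr \<gamma>) ^ r" for \<gamma> :: real
  have \<theta>: "(20 / p ^ (r * k)) powr \<gamma> = 20 powr \<gamma> * \<theta> \<gamma> ^ k" for k \<gamma>
  proof -
    have "(p ^ (r * k)) powr \<gamma> = ((p powr \<gamma>) ^ r) ^ k"
      using bd(3) by (simp add: powr_realpow[symmetric] powr_powr power_mult[symmetric] mult.commute mult.left_commute flip: powr_realpow)
    then show ?thesis using bd(3) by (simp add: powr_divide \<theta>_def power_one_over)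
  qed
  \<comment> \<open>The upper bound that will be proved for \<open>\<xi>\<close>; both of its terms
    tend to 0.\<close>
  define B where "B k = 5 * 2 ^ n * (C * 20 powr \<alpha>) * (2 ^ (r - 1) * \<theta> \<alpha>) ^ k + 6 * (C' * 2 powr \<beta> * 20 powr \<beta>) * \<theta> \<beta> ^ k" for k
  have "(\<lambda>k. (2 ^ (r - 1) * \<theta> \<alpha>) ^ k) \<longlonglongrightarrow> 0"
    using \<alpha> bd(3) by (intro LIMSEQ_realpow_zero) (auto simp: \<theta>_def)
  moreover have "(\<lambda>k. \<theta> \<beta> ^ k) \<longlonglongrightarrow> 0"
  proof (rule LIMSEQ_realpow_zero)
    have "1 < (p powr \<beta>) ^ r" using bd(3) \<beta> r by (intro one_less_power gr_one_powr) auto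
    then show "0 \<le> \<theta> \<beta>" "\<theta> \<beta> < 1" by (auto simp: \<theta>_def)
  qed
  ultimately have "B \<longlonglongrightarrow> 5 * 2 ^ n * (C * 20 powr \<alpha>) * 0 + 6 * (C' * 2 powr \<beta> * 20 powr \<beta>) * 0"
    unfolding B_def by (intro tendsto_add tendsto_mult_left)
  then have "\<forall>\<^sub>F k in sequentially. B k < \<xi>" using \<xi> by (intro order_tendstoD(2)[of B 0]) auto
  moreover have "(\<lambda>k. (1 / p ^ r) ^ k) \<longlonglongrightarrow> 0"
    using bd(3) r by (intro LIMSEQ_realpow_zero) (auto intro!: one_less_power)
  then have lim: "(\<lambda>k. 1 / p ^ (r * k)) \<longlonglongrightarrow> 0" by (simp add: power_mult power_one_over)
  have "\<forall>\<^sub>F k in sequentially. 1 / p ^ (r * k) < min (d / 20) (\<bar>?g t\<bar> / \<tau>)"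
    using lim by (rule order_tendstoD(2)) (use d(1) gt0 \<tau>(1) in simp)
  ultimately have "\<forall>\<^sub>F k in sequentially. B k < \<xi> \<and> 1 / p ^ (r * k) < min (d / 20) (\<bar>?g t\<bar> / \<tau>)"
    by (rule eventually_conj)
  then obtain k where k: "B k < \<xi>" "1 / p ^ (r * k) < d / 20" "1 / p ^ (r * k) < \<bar>?g t\<bar> / \<tau>"
    by (auto simp: eventually_sequentially)
  have pk: "0 < p ^ (r * k)" using bd(3) by simp

  \<comment> \<open>The expression vanishes at b and is at least \<open>\<tau>\<close> at t, so some
    y lies at distance exactly \<open>\<tau>\<close> from its return point after k cycles.\<close>
  obtain y where y: "b \<le> y" "y \<le> t" "y ^ (r * k) * \<bar>?g y\<bar> = \<tau>"
  proof -
    have "\<tau> \<le> p ^ (r * k) * \<bar>?g t\<bar>" using k(3) pk \<tau>(1) by (simp add: field_simps)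
    also have "\<dots> \<le> t ^ (r * k) * \<bar>?g t\<bar>" using st bd(3) by (intro mult_right_mono power_mono) auto
    finally have "\<tau> \<le> t ^ (r * k) * \<bar>?g t\<bar>" .
    moreover have "continuous_on {b..t} (\<lambda>a. a ^ (r * k) * \<bar>?g a\<bar>)"
      using b by (intro continuous_intros continuous_on_subset[OF contg]) auto
    ultimately show ?thesis using IVT'[of "\<lambda>a. a ^ (r * k) * \<bar>?g a\<bar>" b \<tau> t] b \<tau>(1) that by auto
  qed
  have yI: "y \<in> {p..q}" using y b st by auto
  have r1: "1 \<le> r" using r by simp
  note tp = I.param[OF bI] I.param[OF yI]
  have cb: "b ^ (r * k) * \<bar>?g b\<bar> \<le> \<tau>" and cy: "y ^ (r * k) * \<bar>?g y\<bar> \<le> \<tau>" using b \<tau>(1) y by auto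
  note orb = turning_orbit_cycles[OF tp(1) r1 conjunct1[OF \<tau>(2)[OF bI]] conjunct2[OF \<tau>(2)[OF bI]] cb]
  note ory = turning_orbit_cycles[OF tp(2) r1 conjunct1[OF \<tau>(2)[OF yI]] conjunct2[OF \<tau>(2)[OF yI]] cy]
  let ?N = "n + r * k"

  \<comment> \<open>Up to time n the signs agree by coherence, afterwards because both orbits follow
    the same cycle. This extends transversality to time \<open>?N\<close>.\<close>
  have same: "0 \<le> ?c b i * ?c y i" if "i < ?N" for i
  proof (cases "i < n")
    case True
    then show ?thesis using st y b by (intro coherent_same_sign[OF st(4)]) auto
  next
    case False
    define j where "j = (i - n) div r"
    define l where "l = (i - n) mod r"
    have i: "i = n + r * j + l" using False by (simp add: j_def l_def)
    have l: "l < r" using r by (simp add: l_def)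
    have "r * j < r * k" using that i by linarith
    then have j: "j < k" by simp
    show ?thesis
    proof (cases "l = 0")
      case True
      have "b - 1 \<le> ?c b i" "y - 1 \<le> ?c y i" using orb(2)[of j] ory(2)[of j] j i True by auto
      then show ?thesis using bI yI bd by (intro mult_nonneg_nonneg) auto
    next
      case False
      then have "?c b i \<le> 0" "?c y i \<le> 0" using orb(3)[of j l] ory(3)[of j l] j l i by auto
      then show ?thesis by (rule mult_nonpos_nonpos)
    qed
  qed
  have le1: "\<bar>?c a m\<bar> \<le> 1" if "tent_param a" for a m
    using turning_orbit_mem[OF that, of m] tent_param.a_le[OF that] by auto
  \<comment> \<open>Two orbit points differ by at most 2, and transversality has the constant 1/10;
    hence 20.\<close>
  have \<delta>: "\<bar>b - y\<bar> \<le> 20 / p ^ (r * k)"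
  proof -
    have "1 / 10 * p ^ (?N - 5) * \<bar>b - y\<bar> \<le> \<bar>?c b ?N - ?c y ?N\<bar>"
      using n bd bI yI by (intro turning_orbit_transversal tp same) auto
    also have "\<dots> \<le> 2" using le1[OF tp(1), of ?N] le1[OF tp(2), of ?N] by linarith
    finally have "p ^ (?N - 5) * \<bar>b - y\<bar> \<le> 20" by simp
    moreover have "p ^ (r * k) * \<bar>b - y\<bar> \<le> p ^ (?N - 5) * \<bar>b - y\<bar>"
      using n bd(3) by (intro mult_right_mono power_increasing) auto
    ultimately show ?thesis using pk by (simp add: field_simps)
  qed

  obtain G where G: "tent_cdf y G" "?H y = G 0" using obtain_tent_cdf[of y] yI bd by auto
  define h where "h = \<bar>F 0 - G 0\<bar>"
  define e where "e = C' * (2 * (y - b)) powr \<beta>"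
  have "h \<le> C * \<bar>b - y\<bar> powr \<alpha>" unfolding h_def using H[OF bI yI] F(2) G(2) by simp
  also have "\<dots> \<le> C * (20 / p ^ (r * k)) powr \<alpha>" using C \<delta> \<alpha> by (intro mult_left_mono powr_mono2) auto
  finally have h: "h \<le> C * 20 powr \<alpha> * \<theta> \<alpha> ^ k" by (simp add: \<theta>)
  have "e = C' * 2 powr \<beta> * \<bar>b - y\<bar> powr \<beta>" unfolding e_def using y powr_mult[of 2 "y - b" \<beta>] by simp
  also have "\<dots> \<le> C' * 2 powr \<beta> * (20 / p ^ (r * k)) powr \<beta>"
    using C' \<delta> \<beta> by (intro mult_left_mono powr_mono2) auto
  finally have e: "e \<le> C' * 2 powr \<beta> * 20 powr \<beta> * \<theta> \<beta> ^ k" by (simp add: \<theta>)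

  have pair: "tent_cdf_pair b y F G e"
  proof (intro tent_cdf_pair.intro tent_cdf_pair_axioms.intro F(1) G(1) y(1))
    fix u v assume uv: "u \<in> {1 - y..1}" "v \<in> {1 - y..1}" "\<bar>u - v\<bar> \<le> 2 * (y - b)"
    have "\<bar>G u - G v\<bar> \<le> C' * \<bar>u - v\<bar> powr \<beta>" using C'(2)[OF _ _ G(1) uv(1,2)] yI bd by auto
    also have "\<dots> \<le> e" unfolding e_def using C'(1) uv(3) \<beta> by (intro mult_left_mono powr_mono2) auto
    finally show "\<bar>G u - G v\<bar> \<le> e" .
  qed
  have cN: "?c b ?N = ?z b" "\<bar>?c y ?N - ?z y\<bar> = \<tau>" using orb(1)[of k] ory(1)[of k] b y by auto
  have "\<bar>y - b\<bar> < d" using \<delta> k(2) by (simp add: abs_minus_commute)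
  then have "\<bar>?z y - ?z b\<bar> < \<tau> / 2" by (rule d(2)[OF yI])
  then have "\<tau> / 2 \<le> \<bar>?c y ?N - ?z b\<bar>" using cN(2) by linarith
  \<comment> \<open>F and G are compared on \<open>[1 - b, 1]\<close>, while a point of the orbit
    for y is a priori only above \<open>1 - y\<close>; at a return time it is positive.\<close>
  moreover have w: "1 - b \<le> ?c y ?N" "?c y ?N \<le> 1"
    using ory(2)[of k] yI bI bd turning_orbit_mem[OF tp(2), of ?N] by auto
  ultimately have 1: "\<xi> \<le> \<bar>F (?c y ?N) - F (?c b ?N)\<bar>" unfolding cN(1) by (intro far)
  have 2: "\<bar>G (?c y ?N) - F (?c y ?N)\<bar> \<le> 2 * h + 6 * e"
    unfolding h_def using tent_cdf_pair.cdf_close[OF pair, of "?c y ?N"] w by (simp add: abs_minus_commute)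
  have 3: "\<bar>F (?c b ?N) - G (?c y ?N)\<bar> \<le> 3 * 2 ^ n * 2 ^ ((r - 1) * k) * h"
    unfolding h_def using orb(2) ory(2) by (intro cdf_turning_orbit_dist[OF F(1) G(1) r1]) auto
  have "1 * h \<le> 2 ^ n * 2 ^ ((r - 1) * k) * h"
    unfolding power_add[symmetric] by (rule mult_right_mono[OF one_le_power]) (auto simp: h_def)
  with 1 2 3 have "\<xi> \<le> 5 * (2 ^ n * 2 ^ ((r - 1) * k) * h) + 6 * e" by linarith
  also have "\<dots> \<le> 5 * (2 ^ n * 2 ^ ((r - 1) * k) * (C * 20 powr \<alpha> * \<theta> \<alpha> ^ k)) + 6 * (C' * 2 powr \<beta> * 20 powr \<beta> * \<theta> \<beta> ^ k)"
    using h e by (intro add_mono mult_left_mono) auto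
  also have "\<dots> = B k" by (simp add: B_def power_mult_distrib power_mult)
  finally show False using k(1) by simp
qed

lemma interval_obtain_near_Sup:
  fixes J :: "real set"
  assumes J: "is_interval J" "\<exists>x\<in>J. \<exists>y\<in>J. x < y" "bdd_above J" and l: "l < Sup J"
  obtains p q where "l < p" "p < q" "q < Sup J" "{p..q} \<subseteq> J"
proof -
  obtain x y where xy: "x \<in> J" "y \<in> J" "x < y" using J(2) by auto
  then have "y \<le> Sup J" using J(3) by (intro cSup_upper)
  then obtain v where v: "v \<in> J" "max l x < v" using less_cSup_iff[of J "max l x"] J(3) l xy by force
  define m where "m = max l x"
  have m: "m < v" "v \<le> Sup J" using v J(3) by (auto simp: m_def intro: cSup_upper)
  define p q where "p = (2 * m + v) / 3" and "q = (m + 2 * v) / 3"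
  have pq: "m < p" "p < q" "q < v" using m by (auto simp: p_def q_def)
  have "w \<in> J" if "w \<in> {p..q}" for w
    using J(1) xy(1) v(1) that pq m_def unfolding is_interval_1 by (smt (verit) atLeastAtMost_iff)
  then have "{p..q} \<subseteq> J" by blast
  moreover have "l < p" "q < Sup J" using pq m by (auto simp: m_def)
  ultimately show thesis using pq(2) by (intro that)
qed

lemma holder_exponent_mono:
  assumes "2 \<le> r'" "r' \<le> r" "1 < b"
  shows "holder_exponent r' b \<le> holder_exponent r b"
proof -
  have "1 - 1 / real r' \<le> 1 - 1 / real r" using assms by (simp add: frac_le)
  then have "(1 - 1 / real r') * (ln 2 / ln b) \<le> (1 - 1 / real r) * (ln 2 / ln b)"
    using assms by (intro mult_right_mono) auto
  moreover have "holder_exponent k b = (1 - 1 / real k) * (ln 2 / ln b)" if "2 \<le> k" for k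
    using that by (simp add: holder_exponent_def diff_divide_distrib[symmetric] field_simps)
  ultimately show ?thesis using assms by simp
qed

text \<open>\<open>Sup J\<close> need not belong to J and may lie below
  \<open>special_param r\<close>. So r is lowered to an \<open>r'\<close> whose range contains
  \<open>Sup J\<close>, which only lowers the exponent, and a compact interval inside J is taken
  near the supremum.\<close>

theorem normalized_fair_entropy_not_holder:
  assumes r: "2 \<le> r" and J: "is_interval J" "J \<subseteq> {sqrt 2..2}" "\<exists>x\<in>J. \<exists>y\<in>J. x < y"
    and b: "Sup J \<le> special_param (Suc r)" and \<alpha>: "holder_exponent r (Sup J) < \<alpha>"
  shows "\<not> holder_on \<alpha> J normalized_fair_entropy"
proof
  assume hold: "holder_on \<alpha> J normalized_fair_entropy"
  then obtain C where C: "0 < \<alpha>"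
    "\<And>x y. x \<in> J \<Longrightarrow> y \<in> J \<Longrightarrow> \<bar>normalized_fair_entropy x - normalized_fair_entropy y\<bar> \<le> C * \<bar>x - y\<bar> powr \<alpha>"
    by (auto simp: holder_on_def dist_real_def)
  have bdd: "bdd_above J" using J(2) by (meson atLeastAtMost_iff bdd_above.I subsetD)
  let ?b = "Sup J"
  obtain x y where "x \<in> J" "y \<in> J" "x < y" using J(3) by auto
  then have b1: "sqrt 2 < ?b" using J(2) cSup_upper[OF _ bdd, of y] by force
  then have b2: "1 < ?b" using sqrt2_bounds by simp
  \<comment> \<open>Minimality of \<open>r'\<close> yields
    \<open>special_param r' < Sup J\<close>.\<close>
  define r' where "r' = (LEAST k. 2 \<le> k \<and> ?b \<le> special_param (Suc k))"
  have r': "2 \<le> r'" "?b \<le> special_param (Suc r')" "r' \<le> r"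
    using LeastI[of "\<lambda>k. 2 \<le> k \<and> ?b \<le> special_param (Suc k)" r]
      Least_le[of "\<lambda>k. 2 \<le> k \<and> ?b \<le> special_param (Suc k)" r] r b by (auto simp: r'_def)
  have low: "special_param r' < ?b"
  proof (cases "r' = 2")
    case True
    then show ?thesis using b1 special_param_2 by simp
  next
    case False
    then have "\<not> (2 \<le> r' - 1 \<and> ?b \<le> special_param (Suc (r' - 1)))"
      using r' not_less_Least[of "r' - 1" "\<lambda>k. 2 \<le> k \<and> ?b \<le> special_param (Suc k)"] unfolding r'_def[symmetric] by simp
    moreover have "2 \<le> r' - 1" "Suc (r' - 1) = r'" using r'(1) False by auto
    ultimately show ?thesis by simp
  qed
  define \<alpha>0 where "\<alpha>0 = holder_exponent r' ?b"
  have \<alpha>0: "0 < \<alpha>0" "\<alpha>0 < \<alpha>"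
    using holder_exponent_pos[OF r'(1) b2] holder_exponent_mono[OF r'(1,3) b2] \<alpha> by (auto simp: \<alpha>0_def)
  \<comment> \<open>To the right of \<open>?b powr (\<alpha>0 / \<alpha>)\<close>, which is below
    \<open>?b\<close> since \<open>\<alpha>0 < \<alpha>\<close>, already
    \<open>p powr \<alpha>\<close> exceeds the critical rate
    \<open>?b powr \<alpha>0\<close>.\<close>
  define l where "l = max (special_param r') (?b powr (\<alpha>0 / \<alpha>))"
  have "?b powr (\<alpha>0 / \<alpha>) < ?b powr 1" using \<alpha>0 b2 by (intro powr_less_mono) auto
  then have "l < ?b" using low b2 by (simp add: l_def)
  then obtain p q where pq: "l < p" "p < q" "q < ?b" "{p..q} \<subseteq> J"
    using interval_obtain_near_Sup[OF J(1,3) bdd] by blast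
  have "?b powr \<alpha>0 = (?b powr (\<alpha>0 / \<alpha>)) powr \<alpha>" using \<alpha>0 by (simp add: powr_powr)
  also have "\<dots> < p powr \<alpha>" using pq C(1) by (intro powr_less_mono2) (auto simp: l_def)
  finally have "2 / 2 powr (1 / real r') < p powr \<alpha>"
    using holder_exponent_powr[OF r'(1) b2] by (simp add: \<alpha>0_def)
  then have "(2 / 2 powr (1 / real r')) ^ r' < (p powr \<alpha>) ^ r'" using r' by (intro power_strict_mono) auto
  moreover have "(2 / 2 powr (1 / real r')) ^ r' = (2::real) ^ (r' - 1)"
    using r' by (simp add: power_divide powr_power power_diff)
  ultimately have "2 ^ (r' - 1) < (p powr \<alpha>) ^ r'" by simp
  moreover have "\<bar>normalized_fair_entropy x - normalized_fair_entropy y\<bar> \<le> C * \<bar>x - y\<bar> powr \<alpha>"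
    if "x \<in> {p..q}" "y \<in> {p..q}" for x y using C(2) pq(4) that by blast
  moreover have "special_param r' < p" "q < special_param (Suc r')" using pq r' by (auto simp: l_def)
  ultimately show False using not_holder_between[OF r'(1) _ pq(2) _ C(1), of C] by blast
qed

theorem theorem1p1:
  shows "(\<forall>r::nat. 2 \<le> r \<longrightarrow>
            (\<forall>b::real. special_param r < b \<and> b \<le> 2 \<longrightarrow>
               holder_on (holder_exponent r b) {special_param r..b} normalized_fair_entropy))
       \<and> holder_on (1 / 2) {sqrt 2..2} normalized_fair_entropy
       \<and> (\<forall>r::nat. 2 \<le> r \<longrightarrow>
            (\<forall>(J::real set) (\<alpha>::real).
               is_interval J \<and> J \<subseteq> {sqrt 2..2} \<and> (\<exists>x\<in>J. \<exists>y\<in>J. x < y) \<and>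
               Sup J \<le> special_param (Suc r) \<and> holder_exponent r (Sup J) < \<alpha> \<longrightarrow>
               \<not> holder_on \<alpha> J normalized_fair_entropy))"
proof (intro conjI allI impI)
  have half: "holder_exponent 2 2 = 1 / 2" by (simp add: holder_exponent_def)
  show "holder_on (1 / 2) {sqrt 2..2} normalized_fair_entropy"
    using normalized_fair_entropy_holder[of 2 2] special_param_bounds(2)[of 2]
    unfolding half special_param_2 by simp
qed (use normalized_fair_entropy_holder normalized_fair_entropy_not_holder in blast)+

end
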